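(* Let $E$ and $F$ be meteor graphs of length three in normal form with $E\approx F$, and let $A_E$ and $A_F$ denote the adjacency matrices of $E$ and $F$, respectively. Then $A_E$ and $A_F$ are strongly shift equivalent.
   Context: $\mathbb N=\{0,1,2,\dots\}$. A (directed) graph $E=(E^0,E^1,s,r)$ has vertices $E^0$, edges $E^1$ (parallel edges and loops allowed), source and range maps $s,r$. Its adjacency matrix has $(v,w)$ entry the number of edges from $v$ to $w$. A graph is essential if it is finite, connected, and has no sinks and no sources. A cycle is a path $e_1\cdots e_n$ ($n\ge1$) with $r(e_n)=s(e_1)$ and $s(e_1),\dots,s(e_n)$ distinct (up to cyclic rotation; $|C|$ is the length). Cycles are disjoint if every vertex is the base of at most one cycle; then write $C_1\ge C_2$ if there is a path from a vertex of $C_1$ to a vertex of $C_2$. Strong shift equivalence: nonnegative integer square matrices $A,B$ are elementary shift equivalent if $A=RS$, $B=SR$ for some nonnegative integer matrices $R,S$; strongly shift equivalent if they are joined by a finite sequence of elementary shift equivalences. Meteor graph of length three: a connected essential graph $E$ whose cycles are exactly three disjoint cycles $P_E,Q_E,R_E$, forming a unique chain $P_E>Q_E>R_E$. Put $x^E=|P_E|$, $y^E=|Q_E|$, $z^E=|R_E|$. A trail from a cycle $A$ to a cycle $B\neq A$ is a path $\alpha=e_1\cdots e_n$, $n\ge1$, $|\alpha|=n$, with $s(e_1)\in A^0$, $r(e_n)\in B^0$ and no $s(e_i)$, $1<i\le n$, on any cycle. Its interior vertices are its vertices not on cycles. Normal form: there are vertices $p_1\in P_E^0$, $q_1\in Q_E^0$,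 $r_1\in R_E^0$ such that all trails from $P_E$ to $Q_E$ go from $p_1$ to $q_1$, all trails from $Q_E$ to $R_E$ go from $q_1$ to $r_1$, all trails from $P_E$ to $R_E$ go from $p_1$ to $r_1$; distinct trails have no common interior vertices; and for each pair of distinct cycles $(A,B)$ and trails $\alpha,\beta$ from $A$ to $B$: if $|\alpha|\equiv|\beta|\pmod{\gcd(|A|,|B|)}$ then $|\alpha|=|\beta|$, and if $|\alpha|\equiv t\pmod{\gcd(|A|,|B|)}$ with $0\le t<\gcd(|A|,|B|)$ then $|\alpha|\equiv t\pmod{|A||B|}$. Counts: $N_1^E(c)$ is the number of trails from $P_E$ to $Q_E$ of length $\equiv c$ mod $\gcd(x^E,y^E)$ ($1\le c\le\gcd(x^E,y^E)$); $N_2^E(c)$ the number of trails from $Q_E$ to $R_E$ of length $\equiv c$ mod $\gcd(y^E,z^E)$ ($1\le c\le\gcd(y^E,z^E)$); $N_E(c)$ the number of trails from $P_E$ to $R_E$ of length $\equiv c$ mod $\gcd(x^E,z^E)$ ($1\le c\le \gcd(x^E,z^E)$). For $1\le a,b\le\delta:=\gcd(x^E,y^E,z^E)$, $S_1^E(a)=\sum N_1^E(k)$ over $1\le k\le\gcd(x^E,y^E)$ with $k\equiv a\pmod\delta$, and $S_2^E(b)=\sum N_2^E(k)$ over $1\le k\le \gcd(y^E,z^E)$ with $k\equiv b\pmod \delta$. Definition of $E\approx F$ (for meteor graphs of length three in normal form): (i) $x^E=x^F=:x$, $y^E=y^F=:y$, $z^E=z^F=:z$; (ii) $N_1^E(c)=N_1^F(c)$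 for all $1\le c\le\gcd(x,y)$; (iii) $N_2^E(c)=N_2^F(c)$ for all $1\le c\le\gcd(y,z)$; (iv) with $\delta=\gcd(x,y,z)$, $S_1:=S_1^E=S_1^F$, $S_2:=S_2^E=S_2^F$, there are integers $g_1,\dots,g_\delta$, $l_1,\dots,l_\delta$ such that $\operatorname{lcm}(x,y)\mid l_a$ and $\operatorname{lcm}(y,z)\mid g_a$ for all $a$; $l_a=0$ whenever $S_1(a)=0$; $g_b=0$ whenever $S_2(b)=0$; and for all $1\le h\le\gcd(x,z)$ $$N_F(h)-N_E(h)=\frac{\delta}{y\gcd(x,z)}\Bigl(\sum_{\substack{1\le a,b\le \delta\\ a+b\equiv h\,(\mathrm{mod}\ \delta)}}S_1(a)g_b+\sum_{\substack{1\le a,b\le \delta\\ a+b\equiv h\,(\mathrm{mod}\ \delta)}}l_aS_2(b)\Bigr).$$ *)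

theory Defs
  imports
    "Graph_Theory.Digraph_Component"
    "Jordan_Normal_Form.Matrix"
    "HOL-Number_Theory.Cong"
begin

section \<open>Strong shift equivalence\<close>

text \<open>
  Nonnegative integer matrices are matrices over \<^typ>\<open>nat\<close>; square matrices have positive size.
\<close>

definition elementary_shift_equiv :: "nat mat \<Rightarrow> nat mat \<Rightarrow> bool" where
  "elementary_shift_equiv A B \<longleftrightarrow>
     (\<exists>n m R S. 0 < n \<and> 0 < m \<and> A \<in> carrier_mat n n \<and> B \<in> carrier_mat m m \<and>
        R \<in> carrier_mat n m \<and> S \<in> carrier_mat m n \<and> A = R * S \<and> B = S * R)"

text \<open>
  The relation \<^const>\<open>elementary_shift_equiv\<close> is symmetric, and reflexive on square matrices
  of positive size, so that its transitive closure is the equivalence relation it generates there.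
\<close>

definition strong_shift_equiv :: "nat mat \<Rightarrow> nat mat \<Rightarrow> bool" where
  "strong_shift_equiv = elementary_shift_equiv\<^sup>+\<^sup>+"

section \<open>Graphs, cycles and trails\<close>

text \<open>
  The list \<open>vs\<close> is an enumeration of the vertices that fixes the order of rows and columns.
\<close>

definition adjacency_mat :: "('a, 'b) pre_digraph \<Rightarrow> 'a list \<Rightarrow> nat mat" where
  "adjacency_mat G vs =
     mat (length vs) (length vs)
       (\<lambda>(i, j). card {e \<in> arcs G. tail G e = vs ! i \<and> head G e = vs ! j})"

text \<open>
  Connectedness is that of the underlying undirected graph, as in
  \<^const>\<open>Digraph_Component.connected\<close>; it includes having at least one vertex.
\<close>

definition essential :: "('a, 'b) pre_digraph \<Rightarrow> bool" where
  "essential G \<longleftrightarrow> fin_digraph G \<and> Digraph_Component.connected G \<and>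
     (\<forall>v \<in> verts G. out_arcs G v \<noteq> {} \<and> in_arcs G v \<noteq> {})"

text \<open>
  A cycle is represented by one of its arc lists, as in \<^const>\<open>pre_digraph.cycle\<close>. Two
  arc lists represent the same cycle if they are cyclic rotations of each other.
\<close>

definition same_cycle :: "'b list \<Rightarrow> 'b list \<Rightarrow> bool" where
  "same_cycle C D \<longleftrightarrow> (\<exists>n. D = rotate n C)"

definition walk_verts :: "('a, 'b) pre_digraph \<Rightarrow> 'b list \<Rightarrow> 'a set" where
  "walk_verts G p = tail G ` set p \<union> head G ` set p"

definition on_cycle :: "('a, 'b) pre_digraph \<Rightarrow> 'a \<Rightarrow> bool" where
  "on_cycle G v \<longleftrightarrow> (\<exists>C. pre_digraph.cycle G C \<and> v \<in> walk_verts G C)"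

definition disjoint_cycles :: "('a, 'b) pre_digraph \<Rightarrow> bool" where
  "disjoint_cycles G \<longleftrightarrow>
     (\<forall>C D. pre_digraph.cycle G C \<and> pre_digraph.cycle G D \<and> tail G (hd C) = tail G (hd D)
        \<longrightarrow> C = D)"

definition cycle_ge :: "('a, 'b) pre_digraph \<Rightarrow> 'b list \<Rightarrow> 'b list \<Rightarrow> bool" where
  "cycle_ge G C D \<longleftrightarrow> (\<exists>u \<in> walk_verts G C. \<exists>v \<in> walk_verts G D. u \<rightarrow>\<^sup>*\<^bsub>G\<^esub> v)"

definition cycle_gt :: "('a, 'b) pre_digraph \<Rightarrow> 'b list \<Rightarrow> 'b list \<Rightarrow> bool" where
  "cycle_gt G C D \<longleftrightarrow> cycle_ge G C D \<and> \<not> same_cycle C D"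

definition cycle_trail :: "('a, 'b) pre_digraph \<Rightarrow> 'b list \<Rightarrow> 'b list \<Rightarrow> 'b list \<Rightarrow> bool" where
  "cycle_trail G A B p \<longleftrightarrow>
     p \<noteq> [] \<and>
     (\<exists>u v. pre_digraph.awalk G u p v \<and> u \<in> walk_verts G A \<and> v \<in> walk_verts G B) \<and>
     (\<forall>e \<in> set (tl p). \<not> on_cycle G (tail G e))"

definition interior_verts :: "('a, 'b) pre_digraph \<Rightarrow> 'b list \<Rightarrow> 'a set" where
  "interior_verts G p = {v \<in> walk_verts G p. \<not> on_cycle G v}"

section \<open>Meteor graphs of length three\<close>

text \<open>
  The arc lists \<open>P\<close>, \<open>Q\<close>, \<open>R\<close> represent the three cycles; they are determined by the graph up
  to cyclic rotation, and nothing below depends on the choice of the rotations. The last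
  conjunct, uniqueness of the chain, is already a consequence of the others.
\<close>

definition meteor3 ::
    "('a, 'b) pre_digraph \<Rightarrow> 'b list \<Rightarrow> 'b list \<Rightarrow> 'b list \<Rightarrow> bool" where
  "meteor3 G P Q R \<longleftrightarrow>
     essential G \<and> disjoint_cycles G \<and>
     (\<forall>C. pre_digraph.cycle G C \<longleftrightarrow> same_cycle P C \<or> same_cycle Q C \<or> same_cycle R C) \<and>
     \<not> same_cycle P Q \<and> \<not> same_cycle Q R \<and> \<not> same_cycle P R \<and>
     cycle_gt G P Q \<and> cycle_gt G Q R \<and>
     (\<forall>C D H. pre_digraph.cycle G C \<and> pre_digraph.cycle G D \<and> pre_digraph.cycle G H \<and>
        \<not> same_cycle C H \<and> cycle_gt G C D \<and> cycle_gt G D H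
        \<longrightarrow> same_cycle P C \<and> same_cycle Q D \<and> same_cycle R H)"

definition normal_form ::
    "('a, 'b) pre_digraph \<Rightarrow> 'b list \<Rightarrow> 'b list \<Rightarrow> 'b list \<Rightarrow> bool" where
  "normal_form G P Q R \<longleftrightarrow>
     (\<exists>p1 \<in> walk_verts G P. \<exists>q1 \<in> walk_verts G Q. \<exists>r1 \<in> walk_verts G R.
        (\<forall>\<alpha>. cycle_trail G P Q \<alpha> \<longrightarrow> pre_digraph.awalk G p1 \<alpha> q1) \<and>
        (\<forall>\<alpha>. cycle_trail G Q R \<alpha> \<longrightarrow> pre_digraph.awalk G q1 \<alpha> r1) \<and>
        (\<forall>\<alpha>. cycle_trail G P R \<alpha> \<longrightarrow> pre_digraph.awalk G p1 \<alpha> r1)) \<and>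
     (\<forall>A B A' B' \<alpha> \<beta>.
        pre_digraph.cycle G A \<and> pre_digraph.cycle G B \<and> \<not> same_cycle A B \<and>
        pre_digraph.cycle G A' \<and> pre_digraph.cycle G B' \<and> \<not> same_cycle A' B' \<and>
        cycle_trail G A B \<alpha> \<and> cycle_trail G A' B' \<beta> \<and> \<alpha> \<noteq> \<beta>
        \<longrightarrow> interior_verts G \<alpha> \<inter> interior_verts G \<beta> = {}) \<and>
     (\<forall>A B \<alpha> \<beta>.
        pre_digraph.cycle G A \<and> pre_digraph.cycle G B \<and> \<not> same_cycle A B \<and>
        cycle_trail G A B \<alpha> \<and> cycle_trail G A B \<beta> \<and>
        [length \<alpha> = length \<beta>] (mod gcd (length A) (length B))
        \<longrightarrow> length \<alpha> = length \<beta>) \<and>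
     (\<forall>A B \<alpha>. \<forall>t < gcd (length A) (length B).
        pre_digraph.cycle G A \<and> pre_digraph.cycle G B \<and> \<not> same_cycle A B \<and>
        cycle_trail G A B \<alpha> \<and> [length \<alpha> = t] (mod gcd (length A) (length B))
        \<longrightarrow> [length \<alpha> = t] (mod (length A * length B)))"

text \<open>
  With \<open>(A, B)\<close> equal to \<open>(P, Q)\<close>, \<open>(Q, R)\<close> and \<open>(P, R)\<close> the next definition gives $N_1$, $N_2$
  and $N$; the one after it gives $S_1$ and $S_2$ for the first two choices.
\<close>

definition trail_count :: "('a, 'b) pre_digraph \<Rightarrow> 'b list \<Rightarrow> 'b list \<Rightarrow> nat \<Rightarrow> nat" where
  "trail_count G A B c =
     card {\<alpha>. cycle_trail G A B \<alpha> \<and> [length \<alpha> = c] (mod gcd (length A) (length B))}"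

definition trail_sum ::
    "('a, 'b) pre_digraph \<Rightarrow> nat \<Rightarrow> 'b list \<Rightarrow> 'b list \<Rightarrow> nat \<Rightarrow> nat" where
  "trail_sum G \<delta> A B a =
     (\<Sum>k \<in> {k \<in> {1..gcd (length A) (length B)}. [k = a] (mod \<delta>)}. trail_count G A B k)"

text \<open>
  In the definition of $E \approx F$, the sums $S_1$ and $S_2$ are those of \<open>E\<close>; they agree with
  those of \<open>F\<close> by the preceding conditions.
\<close>

definition meteor3_equiv ::
    "('a, 'b) pre_digraph \<Rightarrow> 'b list \<Rightarrow> 'b list \<Rightarrow> 'b list \<Rightarrow>
     ('c, 'd) pre_digraph \<Rightarrow> 'd list \<Rightarrow> 'd list \<Rightarrow> 'd list \<Rightarrow> bool" where
  "meteor3_equiv E P Q R F P' Q' R' \<longleftrightarrow>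
     length P = length P' \<and> length Q = length Q' \<and> length R = length R' \<and>
     (let x = length P; y = length Q; z = length R;
          \<delta> = gcd (gcd x y) z;
          S1 = trail_sum E \<delta> P Q;
          S2 = trail_sum E \<delta> Q R
      in
       (\<forall>c \<in> {1..gcd x y}. trail_count E P Q c = trail_count F P' Q' c) \<and>
       (\<forall>c \<in> {1..gcd y z}. trail_count E Q R c = trail_count F Q' R' c) \<and>
       (\<exists>g l :: nat \<Rightarrow> int.
          (\<forall>a \<in> {1..\<delta>}. int (lcm x y) dvd l a \<and> int (lcm y z) dvd g a) \<and>
          (\<forall>a \<in> {1..\<delta>}. S1 a = 0 \<longrightarrow> l a = 0) \<and>
          (\<forall>b \<in> {1..\<delta>}. S2 b = 0 \<longrightarrow> g b = 0) \<and>
          (\<forall>h \<in> {1..gcd x z}.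
             rat_of_nat (trail_count F P' R' h) - rat_of_nat (trail_count E P R h) =
             rat_of_nat \<delta> / rat_of_nat (y * gcd x z) *
             ((\<Sum>(a, b) \<in> {(a, b). a \<in> {1..\<delta>} \<and> b \<in> {1..\<delta>} \<and> [a + b = h] (mod \<delta>)}.
                 rat_of_nat (S1 a) * rat_of_int (g b)) +
              (\<Sum>(a, b) \<in> {(a, b). a \<in> {1..\<delta>} \<and> b \<in> {1..\<delta>} \<and> [a + b = h] (mod \<delta>)}.
                 rat_of_int (l a) * rat_of_nat (S2 b))))))"

end

theory Submission
  imports Defs
begin

text \<open>
  In a strong shift equivalence class an edge may be pushed forward: an edge from \<open>u\<close> to \<open>t\<close> is
  removed, and the vertex \<open>s\<close> following \<open>u\<close> receives the edges that leave \<open>t\<close>, provided that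
  \<open>u\<close> is the source of all edges into \<open>s\<close>. For the matrix unit \<open>E\<close> at \<open>(s, t)\<close> this is
  the passage from \<open>A (1 + E)\<close> to \<open>(1 + E) A\<close> (\<open>sse_on_edge_move\<close>). The whole proof rests on this
  move and on merging two vertices with equal columns or equal rows (\<open>sse_on_merge\<close>).

  Merging removes the vertices off the cycles. The interior vertices of a trail that starts on
  \<open>P\<close> are merged one by one with the vertices of \<open>P\<close> that lie equally far from \<open>p\<^sub>1\<close>, and those of
  a trail from \<open>Q\<close> to \<open>R\<close> with the vertices of \<open>R\<close> that lie equally far before \<open>r\<^sub>1\<close>
  (\<open>collapse_after_P\<close>, \<open>collapse_before_R\<close>). Three cycles with single edges between them are left,
  one edge for each trail (\<open>sse_on_three_cycle_matrix\<close>). The edges are recorded in three multisets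
  \<open>U\<close> (from \<open>P\<close> to \<open>Q\<close>), \<open>V\<close> (from \<open>Q\<close> to \<open>R\<close>) and \<open>W\<close> (from \<open>P\<close> to \<open>R\<close>). By the conditions on
  lengths in the normal form, equal counts \<open>N\<^sub>1\<close> and \<open>N\<^sub>2\<close> make
  \<open>U\<close> and \<open>V\<close> the same for \<open>E\<close> and \<open>F\<close>, up to multiples of the cycle lengths.

  Pushing an edge of \<open>W\<close> costs nothing, so that \<open>W\<close> only matters through the number of its edges
  in each class modulo \<open>gcd x z\<close>. Pushing an edge of \<open>U\<close> past a vertex of \<open>Q\<close> at which edges of
  \<open>V\<close> start adds composite edges to \<open>W\<close>. After \<open>lcm x y\<close> pushes the edge is back at its place, and
  \<open>W\<close> has gained, for every edge of \<open>V\<close>, the same number of edges in every class compatible with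
  the two edges modulo \<open>\<delta>\<close> (\<open>addable_round_U\<close>); the number is \<open>\<delta> lcm x y / (y gcd x z)\<close>. Rounds of the
  edges of \<open>V\<close> do the same with the roles exchanged (\<open>addable_round_V\<close>). These are the terms of the
  last condition of \<open>E \<approx> F\<close>, with \<open>l\<^sub>a / lcm x y\<close> and \<open>g\<^sub>b / lcm y z\<close> as numbers of rounds. Rounds only
  add edges; negative numbers of rounds are therefore carried out on the side of \<open>F\<close>
  (\<open>tri_equiv_of_class_difference\<close>).
\<close>

section \<open>Strong shift equivalence of matrices indexed by sets\<close>

definition enum_mat :: "'i list \<Rightarrow> ('i \<Rightarrow> 'i \<Rightarrow> nat) \<Rightarrow> nat mat" where
  "enum_mat xs A = mat (length xs) (length xs) (\<lambda>(i, j). A (xs ! i) (xs ! j))"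

text \<open>
  Quantifying over all enumerations frees the relation from the order of rows and columns, and
  lets it compare matrices indexed by different types.
\<close>

definition sse_on :: "'i set \<Rightarrow> ('i \<Rightarrow> 'i \<Rightarrow> nat) \<Rightarrow> 'j set \<Rightarrow> ('j \<Rightarrow> 'j \<Rightarrow> nat) \<Rightarrow> bool" where
  "sse_on I A J B \<longleftrightarrow> (\<forall>xs ys. distinct xs \<and> set xs = I \<and> distinct ys \<and> set ys = J \<longrightarrow>
     strong_shift_equiv (enum_mat xs A) (enum_mat ys B))"

lemma sse_on_trans [trans]:
  assumes "sse_on I A J B" "sse_on J B K C" "finite J"
  shows "sse_on I A K C"
proof -
  obtain ys where "distinct ys" "set ys = J"
    using finite_distinct_list[OF \<open>finite J\<close>] by metis
  then show ?thesis
    using assms(1,2) unfolding sse_on_def strong_shift_equiv_def by (blast intro: tranclp_trans)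
qed

lemma sse_on_cong:
  assumes "sse_on I A J B" "\<And>i k. i \<in> I \<Longrightarrow> k \<in> I \<Longrightarrow> A i k = A' i k"
    "\<And>i k. i \<in> J \<Longrightarrow> k \<in> J \<Longrightarrow> B i k = B' i k"
  shows "sse_on I A' J B'"
proof -
  have "enum_mat xs A = enum_mat xs A'" if "set xs = I" for xs
    using assms(2) that by (intro eq_matI) (auto simp: enum_mat_def)
  moreover have "enum_mat xs B = enum_mat xs B'" if "set xs = J" for xs
    using assms(3) that by (intro eq_matI) (auto simp: enum_mat_def)
  ultimately show ?thesis using assms(1) unfolding sse_on_def by metis
qed

lemma sse_on_elementary:
  assumes ne: "I \<noteq> {}" "J \<noteq> {}"
    and A: "\<And>i k. i \<in> I \<Longrightarrow> k \<in> I \<Longrightarrow> A i k = (\<Sum>j\<in>J. R i j * S j k)"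
    and B: "\<And>j l. j \<in> J \<Longrightarrow> l \<in> J \<Longrightarrow> B j l = (\<Sum>i\<in>I. S j i * R i l)"
  shows "sse_on I A J B"
  unfolding sse_on_def
proof (intro allI impI)
  fix xs ys assume xy: "distinct xs \<and> set xs = I \<and> distinct ys \<and> set ys = J"
  define Rm where "Rm = mat (length xs) (length ys) (\<lambda>(i, j). R (xs ! i) (ys ! j))"
  define Sm where "Sm = mat (length ys) (length xs) (\<lambda>(i, j). S (ys ! i) (xs ! j))"
  have sum_nth: "(\<Sum>k = 0..<length zs. f (zs ! k)) = (\<Sum>z\<in>set zs. f z)" if "distinct zs"
    for zs :: "'z list" and f :: "'z \<Rightarrow> nat"
    using sum.reindex_bij_betw[OF bij_betw_nth[OF that refl refl]] by (simp add: atLeast0LessThan)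
  have a: "enum_mat xs A = Rm * Sm"
  proof (rule eq_matI)
    fix i j assume ij: "i < dim_row (Rm * Sm)" "j < dim_col (Rm * Sm)"
    have "(\<Sum>k = 0..<length ys. R (xs ! i) (ys ! k) * S (ys ! k) (xs ! j)) = A (xs ! i) (xs ! j)"
      using ij xy A[of "xs ! i" "xs ! j"] sum_nth[of ys "\<lambda>z. R (xs ! i) z * S z (xs ! j)"]
      by (auto simp: Rm_def Sm_def)
    with ij show "enum_mat xs A $$ (i, j) = (Rm * Sm) $$ (i, j)"
      by (simp add: enum_mat_def Rm_def Sm_def scalar_prod_def)
  qed (auto simp: enum_mat_def Rm_def Sm_def)
  have b: "enum_mat ys B = Sm * Rm"
  proof (rule eq_matI)
    fix i j assume ij: "i < dim_row (Sm * Rm)" "j < dim_col (Sm * Rm)"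
    have "(\<Sum>k = 0..<length xs. S (ys ! i) (xs ! k) * R (xs ! k) (ys ! j)) = B (ys ! i) (ys ! j)"
      using ij xy B[of "ys ! i" "ys ! j"] sum_nth[of xs "\<lambda>z. S (ys ! i) z * R z (ys ! j)"]
      by (auto simp: Rm_def Sm_def)
    with ij show "enum_mat ys B $$ (i, j) = (Sm * Rm) $$ (i, j)"
      by (simp add: enum_mat_def Rm_def Sm_def scalar_prod_def)
  qed (auto simp: enum_mat_def Rm_def Sm_def)
  have "length xs > 0" "length ys > 0" using xy ne by auto
  then have "elementary_shift_equiv (enum_mat xs A) (enum_mat ys B)"
    unfolding elementary_shift_equiv_def using a b
    by (intro exI[of _ "length xs"] exI[of _ "length ys"] exI[of _ Rm] exI[of _ Sm])
       (auto simp: enum_mat_def Rm_def Sm_def)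
  then show "strong_shift_equiv (enum_mat xs A) (enum_mat ys B)"
    unfolding strong_shift_equiv_def by blast
qed

lemma sse_on_sym:
  assumes "sse_on I A J B" shows "sse_on J B I A"
proof -
  have "symp elementary_shift_equiv"
    by (rule sympI) (auto simp: elementary_shift_equiv_def)
  then have "symp strong_shift_equiv"
    unfolding strong_shift_equiv_def
    by (metis symp_conv_conversep_eq tranclp_converse)
  then show ?thesis using assms unfolding sse_on_def by (blast dest: sympD)
qed

lemma enum_mat_transpose: "transpose_mat (enum_mat xs A) = enum_mat xs (\<lambda>i k. A k i)"
  by (rule eq_matI) (auto simp: enum_mat_def)

lemma elementary_shift_equiv_transpose:
  assumes "elementary_shift_equiv A B"
  shows "elementary_shift_equiv (transpose_mat A) (transpose_mat B)"
proof -
  obtain n m R S where *: "0 < n" "0 < m" "A \<in> carrier_mat n n" "B \<in> carrier_mat m m"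
    "R \<in> carrier_mat n m" "S \<in> carrier_mat m n" "A = R * S" "B = S * R"
    using assms unfolding elementary_shift_equiv_def by blast
  then have "transpose_mat A = transpose_mat S * transpose_mat R"
    "transpose_mat B = transpose_mat R * transpose_mat S"
    by (auto intro: transpose_mult)
  with * show ?thesis unfolding elementary_shift_equiv_def
    by (intro exI[of _ n] exI[of _ m] exI[of _ "transpose_mat S"] exI[of _ "transpose_mat R"]) auto
qed

lemma sse_on_transpose:
  assumes "sse_on I A J B" shows "sse_on I (\<lambda>i k. A k i) J (\<lambda>i k. B k i)"
proof -
  have "strong_shift_equiv (transpose_mat X) (transpose_mat Y)" if "strong_shift_equiv X Y" for X Y
    using that unfolding strong_shift_equiv_def
    by (induction rule: tranclp_induct)
       (auto intro: tranclp.intros elementary_shift_equiv_transpose)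
  then show ?thesis using assms unfolding sse_on_def
    by (metis enum_mat_transpose)
qed

lemma sum_mult_indicator:
  fixes f :: "'i \<Rightarrow> nat"
  assumes "finite I"
  shows "(\<Sum>j\<in>I. f j * of_bool (j = k)) = (if k \<in> I then f k else 0)"
    and "(\<Sum>j\<in>I. f j * of_bool (j = k \<and> b)) = (if k \<in> I \<and> b then f k else 0)"
    and "(\<Sum>j\<in>I. of_bool (k = j) * f j) = (if k \<in> I then f k else 0)"
    and "(\<Sum>j\<in>I. of_bool (b \<and> j = k) * f j) = (if k \<in> I \<and> b then f k else 0)"
proof -
  have *: "f j * of_bool (j = k) = (if j = k then f j else 0)"
      "f j * of_bool (j = k \<and> b) = (if j = k then if b then f j else 0 else 0)"
      "of_bool (k = j) * f j = (if j = k then f j else 0)"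
      "of_bool (b \<and> j = k) * f j = (if j = k then if b then f j else 0 else 0)" for j
    by auto
  show "(\<Sum>j\<in>I. f j * of_bool (j = k)) = (if k \<in> I then f k else 0)"
    "(\<Sum>j\<in>I. f j * of_bool (j = k \<and> b)) = (if k \<in> I \<and> b then f k else 0)"
    "(\<Sum>j\<in>I. of_bool (k = j) * f j) = (if k \<in> I then f k else 0)"
    "(\<Sum>j\<in>I. of_bool (b \<and> j = k) * f j) = (if k \<in> I \<and> b then f k else 0)"
    using assms unfolding * by simp_all
qed

lemma sse_on_reindex:
  assumes "bij_betw f I J" "finite I" "I \<noteq> {}" "\<And>i k. i \<in> I \<Longrightarrow> k \<in> I \<Longrightarrow> A i k = B (f i) (f k)"
  shows "sse_on I A J B"
proof (rule sse_on_elementary[where R = "\<lambda>i j. B (f i) j" and S = "\<lambda>j k. of_bool (j = f k)"])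
  show "I \<noteq> {}" "J \<noteq> {}" using assms by (auto simp: bij_betw_def)
  have fJ: "finite J" using assms(1,2) bij_betw_finite by blast
  show "A i k = (\<Sum>j\<in>J. B (f i) j * of_bool (j = f k))" if "i \<in> I" "k \<in> I" for i k
  proof -
    have "f k \<in> J" using assms(1) that by (auto simp: bij_betw_def)
    then show ?thesis using assms(4)[OF that] fJ by (simp add: sum_mult_indicator)
  qed
  show "B j l = (\<Sum>i\<in>I. of_bool (j = f i) * B (f i) l)" if "j \<in> J" "l \<in> J" for j l
  proof -
    have "(\<Sum>i\<in>I. of_bool (j = f i) * B (f i) l) = (\<Sum>i\<in>J. of_bool (j = i) * B i l)"
      by (rule sum.reindex_bij_betw[OF assms(1)])
    then show ?thesis using fJ that by (simp add: sum_mult_indicator)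
  qed
qed

lemma sse_on_refl: "finite I \<Longrightarrow> I \<noteq> {} \<Longrightarrow> sse_on I A I A"
  by (rule sse_on_reindex[of id]) auto

text \<open>
  With \<open>E\<close> the matrix unit at \<open>(s, t)\<close>, the two matrices are \<open>A (1 + E)\<close> and \<open>(1 + E) A\<close>, products of
  the same two factors. If all edges into \<open>s\<close> start at \<open>u\<close>, the left matrix has extra edges from
  \<open>u\<close> to \<open>t\<close>, which the right one replaces by their continuations, drawn from \<open>s\<close>.
\<close>

lemma sse_on_edge_move:
  assumes "finite I" "s \<in> I" "t \<in> I"
  shows "sse_on I (\<lambda>i k. A i k + (if k = t then A i s else 0))
              I (\<lambda>i k. A i k + (if i = s then A t k else 0))"
proof (rule sse_on_elementary[where R = A and S = "\<lambda>i k. of_bool (i = k) + of_bool (i = s \<and> k = t)"])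
  show "I \<noteq> {}" "I \<noteq> {}" using assms by auto
  show "A i k + (if k = t then A i s else 0) =
      (\<Sum>j\<in>I. A i j * (of_bool (j = k) + of_bool (j = s \<and> k = t)))" if "i \<in> I" "k \<in> I" for i k
    using that assms by (auto simp: distrib_left sum.distrib sum_mult_indicator)
  show "A i k + (if i = s then A t k else 0) =
      (\<Sum>j\<in>I. (of_bool (i = j) + of_bool (i = s \<and> j = t)) * A j k)" if "i \<in> I" "k \<in> I" for i k
    using that assms by (auto simp: distrib_right sum.distrib sum_mult_indicator)
qed

text \<open>
  Vertices with equal columns are copies of one vertex among which its outgoing edges have been
  distributed; merging them reunites these edges.
\<close>

lemma sse_on_merge:
  assumes "finite I" "s \<in> I" "u \<in> I" "s \<noteq> u" "\<And>i. i \<in> I \<Longrightarrow> A i s = A i u"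
  shows "sse_on I A (I - {s}) (\<lambda>i k. A i k + (if i = u then A s k else 0))"
proof (rule sse_on_elementary[where R = A and S = "\<lambda>i k. of_bool (i = k) + of_bool (i = u \<and> k = s)"])
  show "I \<noteq> {}" "I - {s} \<noteq> {}" using assms by auto
  show "A i k = (\<Sum>j\<in>I-{s}. A i j * (of_bool (j = k) + of_bool (j = u \<and> k = s)))"
    if "i \<in> I" "k \<in> I" for i k
    using that assms by (cases "k = s") (auto simp: distrib_left sum.distrib sum_mult_indicator)
  show "A i k + (if i = u then A s k else 0) =
      (\<Sum>j\<in>I. (of_bool (i = j) + of_bool (i = u \<and> j = s)) * A j k)" if "i \<in> I-{s}" "k \<in> I-{s}" for i k
    using that assms by (auto simp: distrib_right sum.distrib sum_mult_indicator)
qed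

text \<open>
  A vertex \<open>s\<close> of \<open>T\<close> is entered from \<open>pre s\<close> only, and its image \<open>l s\<close> only from the image of
  \<open>pre s\<close>. If \<open>d s\<close> is minimal, \<open>pre s\<close> is its own image, so that \<open>s\<close> and \<open>l s\<close> have equal columns and
  can be merged. Thereafter \<open>l s\<close> replaces \<open>s\<close> as predecessor, which keeps the assumptions true for
  the remaining vertices.
\<close>

lemma sse_on_collapse_columns:
  fixes A :: "'i \<Rightarrow> 'i \<Rightarrow> nat" and d :: "'i \<Rightarrow> nat"
  assumes "finite V" "T \<subseteq> V"
    and "\<And>v. v \<in> V - T \<Longrightarrow> l v = v" and "\<And>s. s \<in> T \<Longrightarrow> l s \<in> V - T"
    and "\<And>s. s \<in> T \<Longrightarrow> pre s \<in> V"
    and "\<And>s. s \<in> T \<Longrightarrow> pre s \<in> T \<Longrightarrow> d (pre s) < d s"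
    and "\<And>s i. s \<in> T \<Longrightarrow> i \<in> V \<Longrightarrow> A i s = of_bool (i = pre s)"
    and "\<And>s i. s \<in> T \<Longrightarrow> i \<in> V \<Longrightarrow> A i (l s) = of_bool (i = l (pre s))"
    and "V \<noteq> {}"
  shows "sse_on V A (V - T) (\<lambda>i k. \<Sum>j\<in>{j\<in>V. l j = i}. A j k)"
  using assms
proof (induction "card T" arbitrary: T V A l pre)
  case 0
  then have T: "T = {}" by (metis card_eq_0_iff finite_subset)
  have "sse_on V A V A" using 0 sse_on_refl by blast
  moreover have "{j \<in> V. l j = i} = {i}" if "i \<in> V" for i using that 0(4) T by (auto)
  ultimately show ?case unfolding T by (auto elim!: sse_on_cong)
next
  case (Suc n)
  have fT: "finite T" using Suc.prems finite_subset by blast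
  have "T \<noteq> {}" using Suc.hyps by auto
  then obtain s where s: "s \<in> T" "\<And>s'. s' \<in> T \<Longrightarrow> d s \<le> d s'"
    using ex_min_if_finite[OF finite_imageI[OF fT], of d]
    by (metis arg_min_if_finite(1) arg_min_least fT)
  have pre: "pre s \<in> V - T" using Suc.prems(5,6) s by (metis Diff_iff leD)
  define u where "u = l s"
  have u: "u \<in> V - T" using Suc.prems(4) s u_def by auto
  define A1 where "A1 = (\<lambda>i k. A i k + (if i = u then A s k else 0))"
  have "A i s = A i u" if "i \<in> V" for i
    using Suc.prems(7)[OF s(1) that] Suc.prems(8)[OF s(1) that] Suc.prems(3)[OF pre] u_def by simp
  then have m: "sse_on V A (V - {s}) A1"
    unfolding A1_def using Suc.prems s u by (intro sse_on_merge) auto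
  define V1 T1 pre1 where "V1 = V - {s}" "T1 = T - {s}" "pre1 = (\<lambda>t. if pre t = s then u else pre t)"
  note defs = this
  have "sse_on V1 A1 (V1 - T1) (\<lambda>i k. \<Sum>j\<in>{j\<in>V1. l j = i}. A1 j k)"
  proof (rule Suc.hyps(1)[of T1 V1 l pre1 A1])
    show "n = card T1" using Suc.hyps(2) s fT by (simp add: defs)
    show "finite V1" "T1 \<subseteq> V1" using Suc.prems by (auto simp: defs)
    show "l v = v" if "v \<in> V1 - T1" for v using that Suc.prems(3) by (auto simp: defs)
    show "l t \<in> V1 - T1" if "t \<in> T1" for t using that Suc.prems(4) s(1) by (auto simp: defs)
    show "pre1 t \<in> V1" if "t \<in> T1" for t using that Suc.prems(5) u s(1) by (auto simp: defs)
    show "d (pre1 t) < d t" if "t \<in> T1" "pre1 t \<in> T1" for t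
      using that Suc.prems(6) u by (auto simp: defs split: if_splits)
    show "A1 i t = of_bool (i = pre1 t)" if "t \<in> T1" "i \<in> V1" for t i
    proof -
      have "A i t = of_bool (i = pre t)" "A s t = of_bool (s = pre t)"
        using that Suc.prems(2,7) s(1) by (auto simp: defs)
      then show ?thesis using that u s(1) by (auto simp: A1_def defs)
    qed
    show "A1 i (l t) = of_bool (i = l (pre1 t))" if "t \<in> T1" "i \<in> V1" for t i
    proof -
      have t: "t \<in> T" and i: "i \<in> V" and "s \<in> V" using that s(1) Suc.prems(2) by (auto simp: defs)
      have ls: "l (pre t) \<in> V - T"
        by (metis Diff_iff Suc.prems(3,4,5) t)
      have "A i (l t) = of_bool (i = l (pre t))" "A s (l t) = of_bool (s = l (pre t))"
        using t i \<open>s \<in> V\<close> Suc.prems(8) by auto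
      moreover have "l u = u" using Suc.prems(3) u by auto
      ultimately show ?thesis using ls s(1) by (auto simp: A1_def defs u_def)
    qed
    show "V1 \<noteq> {}" using u s(1) by (auto simp: defs)
  qed
  moreover have "V1 - T1 = V - T" using s(1) by (auto simp: defs)
  moreover have "(\<Sum>j\<in>{j\<in>V1. l j = i}. A1 j k) = (\<Sum>j\<in>{j\<in>V. l j = i}. A j k)"
    if i: "i \<in> V - T" for i k
  proof -
    have fin: "finite {j\<in>V1. l j = i}" using Suc.prems(1) by (auto simp: defs)
    have "l u = u" using Suc.prems(3) u by auto
    have "(\<Sum>j\<in>{j\<in>V1. l j = i}. A1 j k)
        = (\<Sum>j\<in>{j\<in>V1. l j = i}. A j k) + (\<Sum>j\<in>{j\<in>V1. l j = i}. if j = u then A s k else 0)"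
      by (simp add: A1_def sum.distrib)
    also have "(\<Sum>j\<in>{j\<in>V1. l j = i}. if j = u then A s k else 0) = (if u = i then A s k else 0)"
      using fin \<open>l u = u\<close> u s(1) by (auto simp: defs)
    also have "(\<Sum>j\<in>{j\<in>V1. l j = i}. A j k) + (if u = i then A s k else 0)
        = (\<Sum>j\<in>{j\<in>V. l j = i}. A j k)"
    proof (cases "u = i")
      case True
      then have "{j\<in>V. l j = i} = insert s {j\<in>V1. l j = i}" "s \<notin> {j\<in>V1. l j = i}"
        using s(1) Suc.prems(2) by (auto simp: defs u_def)
      then show ?thesis using fin True by simp
    next
      case False
      then have "{j\<in>V. l j = i} = {j\<in>V1. l j = i}" by (auto simp: defs u_def)
      then show ?thesis using False by simp
    qed
    finally show ?thesis .
  qed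
  ultimately have "sse_on V1 A1 (V - T) (\<lambda>i k. \<Sum>j\<in>{j\<in>V. l j = i}. A j k)"
    by (auto elim!: sse_on_cong)
  with m show ?case using Suc.prems(1) by (auto simp: defs intro: sse_on_trans)
qed

lemma sse_on_collapse_rows:
  fixes A :: "'i \<Rightarrow> 'i \<Rightarrow> nat" and d :: "'i \<Rightarrow> nat"
  assumes "finite V" "T \<subseteq> V"
    and "\<And>v. v \<in> V - T \<Longrightarrow> l v = v" and "\<And>s. s \<in> T \<Longrightarrow> l s \<in> V - T"
    and "\<And>s. s \<in> T \<Longrightarrow> nxt s \<in> V"
    and "\<And>s. s \<in> T \<Longrightarrow> nxt s \<in> T \<Longrightarrow> d (nxt s) < d s"
    and "\<And>s i. s \<in> T \<Longrightarrow> i \<in> V \<Longrightarrow> A s i = of_bool (i = nxt s)"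
    and "\<And>s i. s \<in> T \<Longrightarrow> i \<in> V \<Longrightarrow> A (l s) i = of_bool (i = l (nxt s))"
    and "V \<noteq> {}"
  shows "sse_on V A (V - T) (\<lambda>i k. \<Sum>j\<in>{j\<in>V. l j = k}. A i j)"
  using sse_on_transpose[OF sse_on_collapse_columns[of V T l nxt d "\<lambda>i k. A k i"]] assms by simp

section \<open>Three cycles with single edges between them\<close>

datatype node = Pn nat | Qn nat | Rn nat

text \<open>
  Multisets of pairs \<open>(i, j)\<close> stand for edges between two cycles of lengths \<open>m\<close> and \<open>n\<close>. Positions
  are read modulo the cycle lengths, so that an edge can be pushed forward without case distinctions
  for wrapping around.
\<close>

definition edge_count :: "nat \<Rightarrow> nat \<Rightarrow> (nat \<times> nat) multiset \<Rightarrow> nat \<Rightarrow> nat \<Rightarrow> nat" where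
  "edge_count m n M i j = size {#w \<in># M. fst w mod m = i \<and> snd w mod n = j#}"

lemma edge_count_image_mset_set:
  assumes "finite T"
  shows "edge_count m n (image_mset f (mset_set T)) i j = card {\<alpha>\<in>T. fst (f \<alpha>) mod m = i \<and> snd (f \<alpha>) mod n = j}"
  using assms by (simp add: edge_count_def filter_mset_image_mset filter_mset_mset_set)

text \<open>
  For enumerations \<open>p\<close>, \<open>q\<close> of two cycles, a path from \<open>p 0\<close> to \<open>q 0\<close> that uses the edge \<open>(i, j)\<close> has
  a length congruent to \<open>i + 1 - j\<close> modulo the greatest common divisor of the cycle lengths.
\<close>

definition path_class :: "nat \<times> nat \<Rightarrow> int" where
  "path_class w = int (fst w) + 1 - int (snd w)"

definition class_count :: "nat \<Rightarrow> (nat \<times> nat) multiset \<Rightarrow> int \<Rightarrow> nat" where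
  "class_count g M h = size {#w \<in># M. [path_class w = h] (mod int g)#}"

lemma class_count_simps [simp]:
  "class_count g {#} h = 0"
  "class_count g (M + N) h = class_count g M h + class_count g N h"
  "class_count g (add_mset w M) h = of_bool ([path_class w = h] (mod int g)) + class_count g M h"
  by (auto simp: class_count_def)

lemma class_count_sum: "class_count g (\<Sum>a\<in>I. f a) h = (\<Sum>a\<in>I. class_count g (f a) h)"
  by (induction I rule: infinite_finite_induct) auto

lemma class_count_repeat: "class_count g (repeat_mset n M) h = n * class_count g M h"
  by (induction n) auto

lemma class_count_cong: "[h = h'] (mod int g) \<Longrightarrow> class_count g M h = class_count g M h'"
  unfolding class_count_def by (metis cong_sym cong_trans)

lemma Suc_mod_eq_iff: "i < x \<Longrightarrow> Suc j mod x = Suc i mod x \<longleftrightarrow> i = j mod (x::nat)"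
  using cong_add_rcancel_nat[of j 1 i x] by (auto simp: cong_def)

locale three_cycles =
  fixes x y z :: nat
  assumes pos: "0 < x" "0 < y" "0 < z"
begin

definition nodes :: "node set" where
  "nodes = Pn ` {..<x} \<union> Qn ` {..<y} \<union> Rn ` {..<z}"

lemma finite_nodes: "finite nodes" and nodes_nonempty: "nodes \<noteq> {}"
  using pos by (auto simp: nodes_def)

fun three_cycle_matrix :: "(nat \<times> nat) multiset \<Rightarrow> (nat \<times> nat) multiset \<Rightarrow> (nat \<times> nat) multiset \<Rightarrow> node \<Rightarrow> node \<Rightarrow> nat" where
  "three_cycle_matrix U V W (Pn i) (Pn j) = of_bool (j = Suc i mod x)"
| "three_cycle_matrix U V W (Qn i) (Qn j) = of_bool (j = Suc i mod y)"
| "three_cycle_matrix U V W (Rn i) (Rn j) = of_bool (j = Suc i mod z)"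
| "three_cycle_matrix U V W (Pn i) (Qn j) = edge_count x y U i j"
| "three_cycle_matrix U V W (Qn i) (Rn j) = edge_count y z V i j"
| "three_cycle_matrix U V W (Pn i) (Rn j) = edge_count x z W i j"
| "three_cycle_matrix U V W _ _ = 0"

abbreviation tri_equiv where
  "tri_equiv U V W U' V' W' \<equiv> sse_on nodes (three_cycle_matrix U V W) nodes (three_cycle_matrix U' V' W')"

lemma tri_equiv_refl: "tri_equiv U V W U V W"
  by (rule sse_on_refl[OF finite_nodes nodes_nonempty])

lemma tri_equiv_trans: "tri_equiv U V W U' V' W' \<Longrightarrow> tri_equiv U' V' W' U'' V'' W'' \<Longrightarrow> tri_equiv U V W U'' V'' W''"
  using sse_on_trans finite_nodes by blast

lemma nodes_cases:
  assumes "a \<in> nodes"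
  obtains i where "i < x" "a = Pn i" | i where "i < y" "a = Qn i" | i where "i < z" "a = Rn i"
  using assms unfolding nodes_def by auto

lemma three_cycle_matrix_cong:
  assumes "edge_count x y U = edge_count x y U'" "edge_count y z V = edge_count y z V'"  "edge_count x z W = edge_count x z W'"
  shows "three_cycle_matrix U V W = three_cycle_matrix U' V' W'"
proof (intro ext)
  fix a b show "three_cycle_matrix U V W a b = three_cycle_matrix U' V' W' a b"
    using assms by (cases a; cases b) auto
qed

text \<open>
  The edge move with \<open>s\<close> the vertex of \<open>P\<close> after position \<open>i\<close> and \<open>t\<close> the vertex of \<open>Q\<close> at position
  \<open>j\<close>: the edge \<open>(i, j)\<close> can be continued along \<open>Q\<close>, or by an edge of \<open>V\<close> that starts at \<open>t\<close>.
\<close>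

lemma move_U:
  "tri_equiv (add_mset (i, j) U) V W (add_mset (Suc i, Suc j) U) V
     (W + image_mset (\<lambda>v. (Suc i, snd v)) {#v \<in># V. fst v mod y = j mod y#})"
proof (rule sse_on_cong[OF sse_on_edge_move[of nodes "Pn (Suc i mod x)" "Qn (j mod y)" "three_cycle_matrix U V W"]])
  show "finite nodes" "Pn (Suc i mod x) \<in> nodes" "Qn (j mod y) \<in> nodes"
    using pos finite_nodes by (auto simp: nodes_def)
next
  fix a b assume "a \<in> nodes" "b \<in> nodes"
  then show "three_cycle_matrix U V W a b + (if b = Qn (j mod y) then three_cycle_matrix U V W a (Pn (Suc i mod x)) else 0)
      = three_cycle_matrix (add_mset (i, j) U) V W a b"
    by (elim nodes_cases) (auto simp: edge_count_def Suc_mod_eq_iff)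
next
  fix a b assume "a \<in> nodes" "b \<in> nodes"
  then show "three_cycle_matrix U V W a b + (if a = Pn (Suc i mod x) then three_cycle_matrix U V W (Qn (j mod y)) b else 0)
      = three_cycle_matrix (add_mset (Suc i, Suc j) U) V
        (W + image_mset (\<lambda>v. (Suc i, snd v)) {#v \<in># V. fst v mod y = j mod y#}) a b"
    by (elim nodes_cases)
       (auto simp: edge_count_def filter_mset_image_mset filter_filter_mset mod_Suc_eq intro!: arg_cong[where f = size] filter_mset_cong)
qed

text \<open>
  The edge move with \<open>s\<close> the vertex of \<open>Q\<close> after position \<open>j\<close> and \<open>t\<close> the vertex of \<open>R\<close> at position
  \<open>k\<close>. The edges into \<open>s\<close> are the one along \<open>Q\<close> and those of \<open>U\<close> that end there; the latter account for
  the additional edges of \<open>W\<close> before the move.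
\<close>

lemma move_V:
  "tri_equiv U (add_mset (j, k) V) (W + image_mset (\<lambda>u. (fst u, k)) {#u \<in># U. snd u mod y = Suc j mod y#})
     U (add_mset (Suc j, Suc k) V) W"
proof (rule sse_on_cong[OF sse_on_edge_move[of nodes "Qn (Suc j mod y)" "Rn (k mod z)" "three_cycle_matrix U V W"]])
  show "finite nodes" "Qn (Suc j mod y) \<in> nodes" "Rn (k mod z) \<in> nodes"
    using pos finite_nodes by (auto simp: nodes_def)
next
  fix a b assume "a \<in> nodes" "b \<in> nodes"
  then show "three_cycle_matrix U V W a b + (if b = Rn (k mod z) then three_cycle_matrix U V W a (Qn (Suc j mod y)) else 0)
      = three_cycle_matrix U (add_mset (j, k) V)
         (W + image_mset (\<lambda>u. (fst u, k)) {#u \<in># U. snd u mod y = Suc j mod y#}) a b"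
    by (elim nodes_cases)
       (auto simp: edge_count_def Suc_mod_eq_iff filter_mset_image_mset filter_filter_mset intro!: arg_cong[where f = size] filter_mset_cong)
next
  fix a b assume "a \<in> nodes" "b \<in> nodes"
  then show "three_cycle_matrix U V W a b + (if a = Qn (Suc j mod y) then three_cycle_matrix U V W (Rn (k mod z)) b else 0)
      = three_cycle_matrix U (add_mset (Suc j, Suc k) V) W a b"
    by (elim nodes_cases) (auto simp: edge_count_def mod_Suc_eq)
qed

lemma move_W: "tri_equiv U V (add_mset (i, k) W) U V (add_mset (Suc i, Suc k) W)"
proof (rule sse_on_cong[OF sse_on_edge_move[of nodes "Pn (Suc i mod x)" "Rn (k mod z)" "three_cycle_matrix U V W"]])
  show "finite nodes" "Pn (Suc i mod x) \<in> nodes" "Rn (k mod z) \<in> nodes"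
    using pos finite_nodes by (auto simp: nodes_def)
next
  fix a b assume "a \<in> nodes" "b \<in> nodes"
  then show "three_cycle_matrix U V W a b + (if b = Rn (k mod z) then three_cycle_matrix U V W a (Pn (Suc i mod x)) else 0)
      = three_cycle_matrix U V (add_mset (i, k) W) a b"
    by (elim nodes_cases) (auto simp: edge_count_def Suc_mod_eq_iff)
next
  fix a b assume "a \<in> nodes" "b \<in> nodes"
  then show "three_cycle_matrix U V W a b + (if a = Pn (Suc i mod x) then three_cycle_matrix U V W (Rn (k mod z)) b else 0)
      = three_cycle_matrix U V (add_mset (Suc i, Suc k) W) a b"
    by (elim nodes_cases) (auto simp: edge_count_def mod_Suc_eq)
qed

lemma moves_W: "tri_equiv U V (add_mset (i, k) W) U V (add_mset (i + n, k + n) W)"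
  by (induction n) (auto intro: tri_equiv_refl tri_equiv_trans[OF _ move_W])

lemma moves_U:
  "tri_equiv (add_mset (i, j) U) V W (add_mset (i + n, j + n) U) V
     (W + (\<Sum>m<n. image_mset (\<lambda>v. (Suc (i + m), snd v)) {#v \<in># V. fst v mod y = (j + m) mod y#}))"
proof (induction n)
  case (Suc n)
  show ?case
    using tri_equiv_trans[OF Suc move_U] by (simp add: ac_simps)
qed (simp add: tri_equiv_refl)

lemma moves_V:
  "tri_equiv U (add_mset (j, k) V)
     (W + (\<Sum>m<n. image_mset (\<lambda>u. (fst u, k + m)) {#u \<in># U. snd u mod y = Suc (j + m) mod y#}))
     U (add_mset (j + n, k + n) V) W"
proof (induction n arbitrary: W)
  case (Suc n)
  show ?case
    using tri_equiv_trans[OF Suc[of "W + image_mset (\<lambda>u. (fst u, k + n)) {#u \<in># U. snd u mod y = Suc (j + n) mod y#}"] move_V]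
    by (simp add: ac_simps)
qed (simp add: tri_equiv_refl)

end

section \<open>Rounds of an edge along two cycles\<close>

text \<open>
  The Chinese remainder theorem for moduli that need not be coprime; Bezout coefficients give a
  solution.
\<close>

lemma simultaneous_cong:
  fixes a b :: int and m n :: nat
  assumes "[a = b] (mod int (gcd m n))" "0 < m" "0 < n"
  shows "\<exists>t::nat. [int t = a] (mod int m) \<and> [int t = b] (mod int n)"
proof -
  obtain q where q: "b - a = int (gcd m n) * q"
    using assms(1) by (metis cong_iff_dvd_diff cong_sym dvdE)
  obtain r s where rs: "r * int m + s * int n = gcd (int m) (int n)"
    using bezout_int by blast
  define t0 where "t0 = a + int m * (r * q)"
  have "b - t0 = (gcd (int m) (int n) - r * int m) * q"
    using q by (simp add: t0_def algebra_simps)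
  moreover have "gcd (int m) (int n) - r * int m = int n * s" using rs by (simp add: algebra_simps)
  ultimately have "b - t0 = int n * (s * q)" by simp
  then have "[b = t0] (mod int n)" by (simp add: cong_iff_dvd_diff)
  then have t0: "[t0 = a] (mod int m)" "[t0 = b] (mod int n)"
    by (simp_all only: cong_sym) (simp add: t0_def cong_iff_dvd_diff)
  define t where "t = nat (t0 mod (int m * int n))"
  have "int t = t0 mod (int m * int n)" using assms by (simp add: t_def)
  then have "[int t = t0] (mod int m * int n)" by (simp add: cong_def)
  then have "[int t = t0] (mod int m)" "[int t = t0] (mod int n)"
    by (auto intro: cong_modulus_mult simp: mult.commute)
  with t0 show ?thesis using cong_trans by blast
qed

lemma card_cong_lessThan:
  fixes L N :: nat and c :: int
  assumes "L dvd N" "0 < L"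
  shows "card {m. m < N \<and> [int m = c] (mod int L)} = N div L"
proof -
  define r where "r = nat (c mod int L)"
  have r: "int r = c mod int L" "r < L" using assms(2) by (auto simp: r_def nat_less_iff)
  have eq: "[int m = c] (mod int L) \<longleftrightarrow> m mod L = r" for m
    using r by (metis cong_def nat_int zmod_int)
  have "bij_betw (\<lambda>t. r + L * t) {..<N div L} {m. m < N \<and> [int m = c] (mod int L)}"
    unfolding eq
  proof (rule bij_betwI[where g = "\<lambda>m. m div L"])
    show "(\<lambda>t. r + L * t) \<in> {..<N div L} \<rightarrow> {m. m < N \<and> m mod L = r}"
    proof
      fix t assume "t \<in> {..<N div L}"
      then have "L * Suc t \<le> L * (N div L)" by (intro mult_le_mono2) auto
      then have "r + L * t < N" using r(2) assms(1) by auto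
      then show "r + L * t \<in> {m. m < N \<and> m mod L = r}" using r(2) by simp
    qed
    show "(\<lambda>m. m div L) \<in> {m. m < N \<and> m mod L = r} \<rightarrow> {..<N div L}"
      using assms by (auto simp: less_mult_imp_div_less)
    show "(r + L * t) div L = t" for t using r(2) assms(2) by simp
    show "r + L * (m div L) = m" if "m \<in> {m. m < N \<and> m mod L = r}" for m using that by auto
  qed
  then show ?thesis by (metis bij_betw_same_card card_lessThan)
qed

text \<open>
  A solution turns the two congruences into a single one modulo \<open>lcm m n\<close>.
\<close>

lemma card_simultaneous_cong:
  fixes m n N :: nat and a b :: int
  assumes "lcm m n dvd N" "0 < m" "0 < n"
  shows "card {t. t < N \<and> [int t = a] (mod int m) \<and> [int t = b] (mod int n)} =
    N div lcm m n * of_bool ([a = b] (mod int (gcd m n)))"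
proof (cases "[a = b] (mod int (gcd m n))")
  case True
  then obtain c where c: "[int c = a] (mod int m)" "[int c = b] (mod int n)"
    using simultaneous_cong assms by blast
  have "[int t = a] (mod int m) \<and> [int t = b] (mod int n) \<longleftrightarrow> [int t = int c] (mod int (lcm m n))" for t
  proof -
    have "[int t = a] (mod int m) \<and> [int t = b] (mod int n)
        \<longleftrightarrow> [int t = int c] (mod int m) \<and> [int t = int c] (mod int n)"
      using c cong_trans cong_sym by metis
    then show ?thesis by (metis cong_iff_dvd_diff lcm_least_iff lcm_int_int_eq)
  qed
  then show ?thesis using True card_cong_lessThan[of "lcm m n" N "int c"] assms
    by (simp add: lcm_pos_nat)
next
  case False
  have "\<not> ([int t = a] (mod int m) \<and> [int t = b] (mod int n))" for t
  proof
    assume "[int t = a] (mod int m) \<and> [int t = b] (mod int n)"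
    then have "[int t = a] (mod int (gcd m n))" "[int t = b] (mod int (gcd m n))"
      by (metis cong_dvd_modulus gcd_dvd1 gcd_dvd2 int_dvd_int_iff)+
    then show False using False cong_sym cong_trans by blast
  qed
  then show ?thesis using False by simp
qed

lemma sum_size_filter_swap:
  fixes n :: nat
  shows "(\<Sum>m<n. size {#v \<in># V. P m v#}) = (\<Sum>v\<in>#V. card {m. m < n \<and> P m v})"
proof (induction V)
  case (add v V)
  have "(\<Sum>m<n. size {#w \<in># add_mset v V. P m w#}) = (\<Sum>m<n. of_bool (P m v) + size {#w \<in># V. P m w#})"
    by (intro sum.cong) auto
  moreover have "(\<Sum>m<n. of_bool (P m v)) = card {m. m < n \<and> P m v}"
    by (simp add: sum_of_bool_eq Int_def)
  ultimately show ?case using add by (simp add: sum.distrib)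
qed simp

lemma sum_mset_of_bool: "(\<Sum>v\<in>#V. c * of_bool (P v)) = c * size {#v \<in># V. P v#}" for c :: nat
  by (induction V) auto


context three_cycles
begin

text \<open>
  Pushing moves an edge of \<open>W\<close> along its diagonal in the product of the two cycles, and the
  diagonals are told apart by the class modulo \<open>gcd x z\<close>.
\<close>

lemma tri_equiv_single_W:
  assumes "[path_class w = path_class w'] (mod int (gcd x z))"
  shows "tri_equiv U V (add_mset w W) U V (add_mset w' W)"
proof -
  obtain i k i' k' where w: "w = (i, k)" "w' = (i', k')" by fastforce
  have "[int i' - int i = int k' - int k] (mod int (gcd x z))"
    using assms unfolding w path_class_def by (simp add: cong_iff_dvd_diff) (metis (no_types, opaque_lifting) add.commute diff_diff_eq2 dvd_minus_iff minus_diff_eq diff_diff_add diff_add_eq)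
  then obtain n :: nat where n: "[int n = int i' - int i] (mod int x)" "[int n = int k' - int k] (mod int z)"
    using simultaneous_cong pos by blast
  have "[int (i + n) = int i'] (mod int x)" "[int (k + n) = int k'] (mod int z)"
    using n by (simp_all add: cong_iff_dvd_diff algebra_simps)
  then have "(i + n) mod x = i' mod x" "(k + n) mod z = k' mod z"
    by (simp_all only: cong_int_iff) (simp_all add: cong_def)
  then have "three_cycle_matrix U V (add_mset (i + n, k + n) W) = three_cycle_matrix U V (add_mset (i', k') W)"
    by (intro three_cycle_matrix_cong) (auto simp: edge_count_def fun_eq_iff)
  then show ?thesis using moves_W[of U V i k W n] unfolding w by simp
qed

lemma tri_equiv_W_class_aux:
  assumes "\<And>h. class_count (gcd x z) W h = class_count (gcd x z) W' h"
  shows "tri_equiv U V (X + W) U V (X + W')"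
  using assms
proof (induction W arbitrary: W' X)
  case empty
  have "W' = {#}"
  proof (rule ccontr)
    assume "W' \<noteq> {#}"
    then obtain w W'' where "W' = add_mset w W''" by (meson multiset_cases)
    then show False using empty[of "path_class w"] by simp
  qed
  then show ?case by (simp add: tri_equiv_refl)
next
  case (add w W)
  have "class_count (gcd x z) W' (path_class w) \<noteq> 0" using add.prems[of "path_class w"] by simp
  then have "{#w' \<in># W'. [path_class w' = path_class w] (mod int (gcd x z))#} \<noteq> {#}"
    unfolding class_count_def by auto
  then obtain w' where w': "w' \<in># W'" "[path_class w' = path_class w] (mod int (gcd x z))"
    by (metis (mono_tags, lifting) mem_Collect_eq multiset_nonemptyE set_mset_filter)
  then obtain W'' where W'': "W' = add_mset w' W''" by (meson mset_add)
  have "class_count (gcd x z) W h = class_count (gcd x z) W'' h" for h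
  proof -
    have "[path_class w = h] (mod int (gcd x z)) \<longleftrightarrow> [path_class w' = h] (mod int (gcd x z))"
      using w'(2) cong_trans cong_sym by metis
    then show ?thesis using add.prems[of h] W'' by simp
  qed
  then have "tri_equiv U V (add_mset w' X + W) U V (add_mset w' X + W'')" by (rule add.IH)
  moreover have "tri_equiv U V (add_mset w (X + W)) U V (add_mset w' (X + W))"
    using tri_equiv_single_W w'(2) cong_sym by blast
  ultimately show ?case using W'' tri_equiv_trans by simp
qed

lemma tri_equiv_W_class:
  assumes "\<And>h. class_count (gcd x z) W h = class_count (gcd x z) W' h"
  shows "tri_equiv U V W U V W'"
  using tri_equiv_W_class_aux[OF assms, of _ _ "{#}"] by simp

definition addable where
  "addable U V D \<longleftrightarrow> (\<forall>W. tri_equiv U V W U V (W + D))"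

lemma addable_simps [intro]:
  "addable U V {#}"
  "addable U V D \<Longrightarrow> addable U V D' \<Longrightarrow> addable U V (D + D')"
proof -
  show "addable U V {#}" by (simp add: addable_def tri_equiv_refl)
  assume "addable U V D" "addable U V D'"
  then show "addable U V (D + D')"
    unfolding addable_def by (metis add.assoc tri_equiv_trans)
qed

lemma addable_repeat [intro]: "addable U V D \<Longrightarrow> addable U V (repeat_mset n D)"
  by (induction n) auto

lemma addable_sum: "(\<And>a. a \<in> I \<Longrightarrow> addable U V (f a)) \<Longrightarrow> addable U V (\<Sum>a\<in>I. f a)"
  by (induction I rule: infinite_finite_induct) auto

lemma mod_add_eq_iff_cong: "(a :: nat) mod y = (j + m) mod y \<longleftrightarrow> [int m = int a - int j] (mod int y)"
proof -
  have "a mod y = (j + m) mod y \<longleftrightarrow> [int a = int (j + m)] (mod int y)"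
    by (simp only: cong_int_iff) (simp add: cong_def)
  also have "\<dots> \<longleftrightarrow> [int m = int a - int j] (mod int y)"
    by (simp add: cong_iff_dvd_diff) (metis add.commute diff_diff_add diff_diff_eq2 dvd_minus_iff minus_diff_eq)
  finally show ?thesis .
qed

text \<open>
  A round of an edge of \<open>U\<close> takes \<open>lcm x y\<close> pushes. For a given edge of \<open>V\<close> and a given class modulo
  \<open>gcd x z\<close>, these pushes create a composite edge of that class either never or \<open>hits_U\<close> times.
\<close>

definition hits_U :: nat where "hits_U = lcm x y div lcm y (gcd x z)"
definition hits_V :: nat where "hits_V = lcm y z div lcm y (gcd x z)"

text \<open>
  Let \<open>u\<close> make a full round. At push \<open>m\<close> it meets the edge \<open>v\<close> if \<open>m\<close> lies in a certain class modulo
  \<open>y\<close>, and the composite has class \<open>h\<close> if \<open>m\<close> lies in a certain class modulo \<open>gcd x z\<close>. Both can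
  happen together iff the classes of \<open>u\<close>, \<open>v\<close> and \<open>h\<close> are compatible modulo \<open>gcd y (gcd x z)\<close>, and
  then they do so equally often for every \<open>h\<close>.
\<close>

lemma addable_round_U:
  assumes "u \<in># U"
  shows "\<exists>D. addable U V D \<and> (\<forall>h. class_count (gcd x z) D h =
    hits_U * size {#v \<in># V. [path_class v = h - path_class u] (mod int (gcd y (gcd x z)))#})"
proof -
  obtain i j where u: "u = (i, j)" by fastforce
  obtain U' where U: "U = add_mset (i, j) U'" using assms u by (meson mset_add)
  \<comment> \<open>This many pushes bring the edge back to its place, modulo \<open>x\<close> and modulo \<open>y\<close>.\<close>
  define N where "N = lcm x y"
  define D where "D = (\<Sum>m<N. image_mset (\<lambda>v. (Suc (i + m), snd v)) {#v \<in># V. fst v mod y = (j + m) mod y#})"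
  have "x dvd N" "y dvd N" by (auto simp: N_def)
  then have "(i + N) mod x = i mod x" "(j + N) mod y = j mod y"
    by (metis add.right_neutral dvd_imp_mod_0 mod_add_right_eq)+
  then have eq: "three_cycle_matrix (add_mset (i + N, j + N) U') V W = three_cycle_matrix U V W" for W
    by (intro three_cycle_matrix_cong) (auto simp: edge_count_def U fun_eq_iff)
  have "addable U V D"
    unfolding addable_def using moves_U[of i j U' V _ N] by (simp add: eq D_def flip: U)
  moreover have "class_count (gcd x z) D h =
    hits_U * size {#v \<in># V. [path_class v = h - path_class u] (mod int (gcd y (gcd x z)))#}" for h
  proof -
    have "class_count (gcd x z) D h
        = (\<Sum>m<N. size {#v \<in># V. [int m = int (fst v) - int j] (mod int y) \<and>
              [int m = h - int i - 2 + int (snd v)] (mod int (gcd x z))#})"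
      unfolding D_def class_count_sum
      by (intro sum.cong refl)
         (auto simp: class_count_def filter_mset_image_mset filter_filter_mset path_class_def mod_add_eq_iff_cong
            cong_iff_dvd_diff algebra_simps intro!: arg_cong[where f = size] filter_mset_cong)
    also have "\<dots> = (\<Sum>v\<in>#V. card {m. m < N \<and> [int m = int (fst v) - int j] (mod int y) \<and>
              [int m = h - int i - 2 + int (snd v)] (mod int (gcd x z))})"
      by (rule sum_size_filter_swap)
    also have "\<dots> = (\<Sum>v\<in>#V. hits_U * of_bool ([path_class v = h - path_class u] (mod int (gcd y (gcd x z)))))"
    proof (intro arg_cong[where f = sum_mset] image_mset_cong)
      fix v
      have "lcm y (gcd x z) dvd N" unfolding N_def
        by (meson dvd_lcm1 dvd_lcm2 dvd_trans gcd_dvd1 lcm_least)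
      then show "card {m. m < N \<and> [int m = int (fst v) - int j] (mod int y) \<and>
              [int m = h - int i - 2 + int (snd v)] (mod int (gcd x z))}
          = hits_U * of_bool ([path_class v = h - path_class u] (mod int (gcd y (gcd x z))))"
        using pos by (subst card_simultaneous_cong)
          (auto simp: N_def hits_U_def path_class_def u cong_iff_dvd_diff algebra_simps)
    qed
    finally show ?thesis by (simp add: sum_mset_of_bool)
  qed
  ultimately show ?thesis by blast
qed

text \<open>
  As for \<open>U\<close>, except that pushing an edge of \<open>V\<close> consumes edges of \<open>W\<close>; the round is therefore run
  backwards.
\<close>

lemma addable_round_V:
  assumes "v \<in># V"
  shows "\<exists>D. addable U V D \<and> (\<forall>h. class_count (gcd x z) D h =
    hits_V * size {#u \<in># U. [path_class u = h - path_class v] (mod int (gcd y (gcd x z)))#})"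
proof -
  obtain j k where v: "v = (j, k)" by fastforce
  obtain V' where V: "V = add_mset (j, k) V'" using assms v by (meson mset_add)
  define N where "N = lcm y z"
  define D where "D = (\<Sum>m<N. image_mset (\<lambda>u. (fst u, k + m)) {#u \<in># U. snd u mod y = Suc (j + m) mod y#})"
  have "y dvd N" "z dvd N" by (auto simp: N_def)
  then have "(j + N) mod y = j mod y" "(k + N) mod z = k mod z"
    by (metis add.right_neutral dvd_imp_mod_0 mod_add_right_eq)+
  then have eq: "three_cycle_matrix U (add_mset (j + N, k + N) V') W = three_cycle_matrix U V W" for W
    by (intro three_cycle_matrix_cong) (auto simp: edge_count_def V fun_eq_iff)
  have "addable U V D"
    unfolding addable_def
    using moves_V[of U j k V' _ N] by (simp add: eq D_def sse_on_sym flip: V)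
  moreover have "class_count (gcd x z) D h =
    hits_V * size {#u \<in># U. [path_class u = h - path_class v] (mod int (gcd y (gcd x z)))#}" for h
  proof -
    have "class_count (gcd x z) D h
        = (\<Sum>m<N. size {#u \<in># U. [int m = int (snd u) - int (Suc j)] (mod int y) \<and>
              [int m = int (fst u) + 1 - int k - h] (mod int (gcd x z))#})"
      unfolding D_def class_count_sum
    proof (intro sum.cong refl)
      fix m
      have "[path_class (fst u, k + m) = h] (mod int (gcd x z)) \<longleftrightarrow>
          [int m = int (fst u) + 1 - int k - h] (mod int (gcd x z))" for u :: "nat \<times> nat"
      proof -
        have "path_class (fst u, k + m) - h = - (int m - (int (fst u) + 1 - int k - h))" by (simp add: path_class_def)
        then show ?thesis by (metis cong_iff_dvd_diff dvd_minus_iff)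
      qed
      then show "class_count (gcd x z) (image_mset (\<lambda>u. (fst u, k + m)) {#u \<in># U. snd u mod y = Suc (j + m) mod y#}) h
          = size {#u \<in># U. [int m = int (snd u) - int (Suc j)] (mod int y) \<and>
              [int m = int (fst u) + 1 - int k - h] (mod int (gcd x z))#}"
        by (auto simp: class_count_def filter_mset_image_mset filter_filter_mset mod_add_eq_iff_cong simp flip: add_Suc
           intro!: arg_cong[where f = size] filter_mset_cong)
    qed
    also have "\<dots> = (\<Sum>u\<in>#U. card {m. m < N \<and> [int m = int (snd u) - int (Suc j)] (mod int y) \<and>
              [int m = int (fst u) + 1 - int k - h] (mod int (gcd x z))})"
      by (rule sum_size_filter_swap)
    also have "\<dots> = (\<Sum>u\<in>#U. hits_V * of_bool ([path_class u = h - path_class v] (mod int (gcd y (gcd x z)))))"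
    proof (intro arg_cong[where f = sum_mset] image_mset_cong)
      fix u
      have "lcm y (gcd x z) dvd N" unfolding N_def
        by (meson dvd_lcm1 dvd_lcm2 dvd_trans gcd_dvd2 lcm_least)
      moreover have "[int (snd u) - int (Suc j) = int (fst u) + 1 - int k - h] (mod int (gcd y (gcd x z)))
         \<longleftrightarrow> [path_class u = h - path_class v] (mod int (gcd y (gcd x z)))"
      proof -
        have "int (snd u) - int (Suc j) - (int (fst u) + 1 - int k - h) = - (path_class u - (h - path_class v))"
          by (simp add: path_class_def v)
        then show ?thesis by (metis cong_iff_dvd_diff dvd_minus_iff)
      qed
      ultimately show "card {m. m < N \<and> [int m = int (snd u) - int (Suc j)] (mod int y) \<and>
              [int m = int (fst u) + 1 - int k - h] (mod int (gcd x z))}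
          = hits_V * of_bool ([path_class u = h - path_class v] (mod int (gcd y (gcd x z))))"
        using pos by (subst card_simultaneous_cong) (auto simp: N_def hits_V_def)
    qed
    finally show ?thesis by (simp add: sum_mset_of_bool)
  qed
  ultimately show ?thesis by blast
qed


text \<open>
  Any edge of class \<open>a\<close> modulo \<open>gcd y (gcd x z)\<close> will do for \<open>n a\<close> rounds. If there is none, \<open>n a\<close> has
  to vanish.
\<close>

lemma addable_classes_U:
  fixes n :: "nat \<Rightarrow> nat"
  assumes "\<And>a. a \<in> I \<Longrightarrow> class_count (gcd y (gcd x z)) U (int a) = 0 \<Longrightarrow> n a = 0"
  shows "\<exists>D. addable U V D \<and> (\<forall>h. class_count (gcd x z) D h =
    hits_U * (\<Sum>a\<in>I. n a * class_count (gcd y (gcd x z)) V (h - int a)))"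
proof -
  let ?d = "gcd y (gcd x z)"
  have "\<forall>a\<in>I. \<exists>D. addable U V D \<and> (\<forall>h. class_count (gcd x z) D h =
    hits_U * (n a * class_count ?d V (h - int a)))"
  proof
    fix a assume a: "a \<in> I"
    show "\<exists>D. addable U V D \<and> (\<forall>h. class_count (gcd x z) D h =
      hits_U * (n a * class_count ?d V (h - int a)))"
    proof (cases "class_count ?d U (int a) = 0")
      case True
      then show ?thesis using assms[OF a] by (intro exI[of _ "{#}"]) auto
    next
      case False
      then have "{#u \<in># U. [path_class u = int a] (mod int ?d)#} \<noteq> {#}"
        unfolding class_count_def by auto
      then obtain u where u: "u \<in># U" "[path_class u = int a] (mod int ?d)"
        by (metis (mono_tags, lifting) mem_Collect_eq multiset_nonemptyE set_mset_filter)
      obtain D where D: "addable U V D"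
        "\<And>h. class_count (gcd x z) D h = hits_U * class_count ?d V (h - path_class u)"
        using addable_round_U[OF u(1)] unfolding class_count_def[of ?d] by blast
      have "class_count ?d V (h - path_class u) = class_count ?d V (h - int a)" for h
        by (rule class_count_cong) (intro cong_diff cong_refl u)
      then show ?thesis using D
        by (intro exI[of _ "repeat_mset (n a) D"]) (auto simp: class_count_repeat)
    qed
  qed
  then obtain D where "\<forall>a\<in>I. addable U V (D a) \<and> (\<forall>h. class_count (gcd x z) (D a) h =
    hits_U * (n a * class_count ?d V (h - int a)))" by metis
  then show ?thesis
    by (intro exI[of _ "\<Sum>a\<in>I. D a"]) (auto simp: class_count_sum sum_distrib_left intro: addable_sum)
qed

lemma addable_classes_V:
  fixes n :: "nat \<Rightarrow> nat"
  assumes "\<And>b. b \<in> I \<Longrightarrow> class_count (gcd y (gcd x z)) V (int b) = 0 \<Longrightarrow> n b = 0"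
  shows "\<exists>D. addable U V D \<and> (\<forall>h. class_count (gcd x z) D h =
    hits_V * (\<Sum>b\<in>I. n b * class_count (gcd y (gcd x z)) U (h - int b)))"
proof -
  let ?d = "gcd y (gcd x z)"
  have "\<forall>b\<in>I. \<exists>D. addable U V D \<and> (\<forall>h. class_count (gcd x z) D h =
    hits_V * (n b * class_count ?d U (h - int b)))"
  proof
    fix b assume b: "b \<in> I"
    show "\<exists>D. addable U V D \<and> (\<forall>h. class_count (gcd x z) D h =
      hits_V * (n b * class_count ?d U (h - int b)))"
    proof (cases "class_count ?d V (int b) = 0")
      case True
      then show ?thesis using assms[OF b] by (intro exI[of _ "{#}"]) auto
    next
      case False
      then have "{#v \<in># V. [path_class v = int b] (mod int ?d)#} \<noteq> {#}"
        unfolding class_count_def by auto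
      then obtain v where v: "v \<in># V" "[path_class v = int b] (mod int ?d)"
        by (metis (mono_tags, lifting) mem_Collect_eq multiset_nonemptyE set_mset_filter)
      obtain D where D: "addable U V D"
        "\<And>h. class_count (gcd x z) D h = hits_V * class_count ?d U (h - path_class v)"
        using addable_round_V[OF v(1)] unfolding class_count_def[of ?d] by blast
      have "class_count ?d U (h - path_class v) = class_count ?d U (h - int b)" for h
        by (rule class_count_cong) (intro cong_diff cong_refl v)
      then show ?thesis using D
        by (intro exI[of _ "repeat_mset (n b) D"]) (auto simp: class_count_repeat)
    qed
  qed
  then obtain D where "\<forall>b\<in>I. addable U V (D b) \<and> (\<forall>h. class_count (gcd x z) (D b) h =
    hits_V * (n b * class_count ?d U (h - int b)))" by metis
  then show ?thesis
    by (intro exI[of _ "\<Sum>b\<in>I. D b"]) (auto simp: class_count_sum sum_distrib_left intro: addable_sum)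
qed

text \<open>
  Only positive numbers of rounds are available. The positive parts of \<open>l\<close> and \<open>m\<close> are used to
  enlarge \<open>W\<close> and the negative parts to enlarge \<open>W'\<close>; the results agree in all classes.
\<close>

lemma tri_equiv_of_class_difference:
  fixes l m :: "nat \<Rightarrow> int"
  defines "g \<equiv> gcd x z" and "d \<equiv> gcd y (gcd x z)"
  assumes l: "\<And>a. a \<in> I \<Longrightarrow> class_count d U (int a) = 0 \<Longrightarrow> l a = 0"
    and m: "\<And>b. b \<in> I \<Longrightarrow> class_count d V (int b) = 0 \<Longrightarrow> m b = 0"
    and diff: "\<And>h. h \<in> {1..g} \<Longrightarrow>
      int (class_count g W' (int h)) - int (class_count g W (int h)) =
      int hits_U * (\<Sum>a\<in>I. l a * int (class_count d V (int h - int a))) +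
      int hits_V * (\<Sum>b\<in>I. m b * int (class_count d U (int h - int b)))"
  shows "tri_equiv U V W U V W'"
proof -
  obtain A where A: "addable U V A"
    "\<And>h. class_count g A h = hits_U * (\<Sum>a\<in>I. nat (l a) * class_count d V (h - int a))"
    using addable_classes_U[of I U "\<lambda>a. nat (l a)" V] l unfolding g_def d_def by auto
  obtain A' where A': "addable U V A'"
    "\<And>h. class_count g A' h = hits_U * (\<Sum>a\<in>I. nat (- l a) * class_count d V (h - int a))"
    using addable_classes_U[of I U "\<lambda>a. nat (- l a)" V] l unfolding g_def d_def by auto
  obtain B where B: "addable U V B"
    "\<And>h. class_count g B h = hits_V * (\<Sum>b\<in>I. nat (m b) * class_count d U (h - int b))"
    using addable_classes_V[of I V "\<lambda>b. nat (m b)" U] m unfolding g_def d_def by auto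
  obtain B' where B': "addable U V B'"
    "\<And>h. class_count g B' h = hits_V * (\<Sum>b\<in>I. nat (- m b) * class_count d U (h - int b))"
    using addable_classes_V[of I V "\<lambda>b. nat (- m b)" U] m unfolding g_def d_def by auto
  have pm: "int (\<Sum>a\<in>I. nat (f a) * F a) - int (\<Sum>a\<in>I. nat (- f a) * F a) = (\<Sum>a\<in>I. f a * int (F a))"
    for f :: "nat \<Rightarrow> int" and F :: "nat \<Rightarrow> nat"
  proof -
    have "int (nat (f a) * F a) - int (nat (- f a) * F a) = f a * int (F a)" for a
      by (cases "f a \<ge> 0") auto
    then show ?thesis by (simp only: of_nat_sum flip: sum_subtractf)
  qed
  have "class_count g (W + (A + B)) h = class_count g (W' + (A' + B')) h" for h
  proof -
    have "0 < g" using pos by (simp add: g_def)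
    obtain k where k: "k \<in> {1..g}" "[h = int k] (mod int g)"
    proof (cases "h mod int g = 0")
      case True
      then show ?thesis using that[of g] \<open>0 < g\<close> by (auto simp: cong_def)
    next
      case False
      have "0 \<le> h mod int g" "h mod int g < int g" using \<open>0 < g\<close> by auto
      then show ?thesis using that[of "nat (h mod int g)"] False
        by (auto simp: cong_def nat_le_iff)
    qed
    have "int (class_count g A k) - int (class_count g A' k)
        = int hits_U * (\<Sum>a\<in>I. l a * int (class_count d V (int k - int a)))"
      unfolding A A' pm[symmetric] by (simp only: of_nat_mult right_diff_distrib)
    moreover have "int (class_count g B k) - int (class_count g B' k)
        = int hits_V * (\<Sum>b\<in>I. m b * int (class_count d U (int k - int b)))"
      unfolding B B' pm[symmetric] by (simp only: of_nat_mult right_diff_distrib)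
    ultimately have "class_count g (W + (A + B)) k = class_count g (W' + (A' + B')) k"
      using diff[OF k(1)] by simp
    then show ?thesis using class_count_cong[OF k(2)] by simp
  qed
  then have "tri_equiv U V (W + (A + B)) U V (W' + (A' + B'))"
    unfolding g_def by (rule tri_equiv_W_class)
  moreover have "tri_equiv U V W U V (W + (A + B))"
    using A(1) B(1) addable_simps(2) unfolding addable_def by blast
  moreover have "tri_equiv U V (W' + (A' + B')) U V W'"
    using A'(1) B'(1) addable_simps(2) sse_on_sym unfolding addable_def by blast
  ultimately show ?thesis by (meson tri_equiv_trans)
qed

end

section \<open>Finite digraphs with disjoint cycles\<close>

lemma same_cycle_refl: "same_cycle C C"
  unfolding same_cycle_def by (metis rotate0 id_apply)

lemma same_cycle_sym: assumes "same_cycle C D" shows "same_cycle D C"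
proof -
  obtain n where n: "D = rotate n C" using assms unfolding same_cycle_def by blast
  define m where "m = length C * n - n"
  show ?thesis
  proof (cases "C = []")
    case False
    then have "m + n = length C * n" by (cases "length C") (auto simp: m_def)
    then have "rotate m D = C" unfolding n by (simp add: rotate_rotate rotate_id)
    then show ?thesis unfolding same_cycle_def by metis
  qed (use n in \<open>simp add: same_cycle_refl\<close>)
qed

lemma same_cycle_trans: "same_cycle C D \<Longrightarrow> same_cycle D H \<Longrightarrow> same_cycle C H"
  unfolding same_cycle_def by (metis rotate_rotate)

lemma walk_verts_same_cycle: "same_cycle C D \<Longrightarrow> walk_verts G D = walk_verts G C"
  by (auto simp: same_cycle_def walk_verts_def)

locale disjoint_cycle_digraph = fin_digraph +
  assumes disjoint: "disjoint_cycles G"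
    and ex_out_arc: "\<And>v. v \<in> verts G \<Longrightarrow> \<exists>e\<in>arcs G. tail G e = v"
    and ex_in_arc: "\<And>v. v \<in> verts G \<Longrightarrow> \<exists>e\<in>arcs G. head G e = v"
begin

text \<open>
  These are the arcs of cycles. The formulation by reachability avoids the choice of a cycle and
  of its starting point.
\<close>

definition returning :: "'b \<Rightarrow> bool" where
  "returning e \<longleftrightarrow> e \<in> arcs G \<and> head G e \<rightarrow>\<^sup>* tail G e"

lemma arc_reachable: "e \<in> arcs G \<Longrightarrow> tail G e \<rightarrow>\<^sup>* head G e"
  by (metis in_arcs_imp_in_arcs_ends reachable_adjI)

lemma returning_apath:
  assumes "returning e"
  obtains p where "apath (head G e) p (tail G e)" "e \<in> arcs G"
  using assms unfolding returning_def reachable_apath by blast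

lemma returning_imp_cycle_Cons:
  assumes "returning e" shows "\<exists>p. cycle (e # p)"
proof -
  obtain p where p: "apath (head G e) p (tail G e)" "e \<in> arcs G"
    using returning_apath[OF assms] .
  then have "awalk (tail G e) (e # p) (tail G e) \<and> distinct (tl (awalk_verts (tail G e) (e # p)))"
    by (auto simp: apath_def awalk_Cons_iff)
  then show ?thesis unfolding cycle_def by blast
qed

lemma returning_imp_cycle_snoc:
  assumes "returning e" shows "\<exists>p. cycle (p @ [e]) \<and> tail G (hd (p @ [e])) = head G e"
proof -
  obtain p where p: "apath (head G e) p (tail G e)" "e \<in> arcs G"
    using returning_apath[OF assms] .
  then have w: "awalk (head G e) p (tail G e)" "awalk (tail G e) [e] (head G e)"
    by (auto simp: apath_def awalk_Cons_iff awalk_Nil_iff)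
  then have w2: "awalk (head G e) (p @ [e]) (head G e)" by (rule awalk_appendI)
  have "cas (head G e) p (tail G e)" "cas (head G e) (p @ [e]) (head G e)" using w w2 by (auto simp: awalk_def)
  note conv = this[THEN awalk_verts_conv']
  have hd: "tail G (hd (p @ [e])) = head G e"
    using w2 by (cases p) (auto simp: awalk_Cons_iff)
  have "distinct (tl (awalk_verts (head G e) (p @ [e])))"
    using p(1) hd conv by (cases p) (auto simp: apath_def)
  with w2 hd show ?thesis unfolding cycle_def by blast
qed

lemma cycle_arc_returning:
  assumes "cycle C" "e \<in> set C" shows "returning e"
proof -
  obtain u where u: "awalk u C u" using assms(1) unfolding cycle_def by blast
  obtain as bs where C: "C = as @ e # bs" using assms(2) by (meson split_list)
  have "awalk u as (tail G e)" "awalk (head G e) bs u" "e \<in> arcs G"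
    using u unfolding C by (auto simp: awalk_Cons_iff)
  then show ?thesis unfolding returning_def by (meson reachable_awalkI reachable_trans)
qed

text \<open>
  Complete both arcs to cycles that begin with them. The cycles share their base vertex, so they
  are equal as lists.
\<close>

lemma returning_tail_unique:
  assumes "returning e" "returning e'" "tail G e = tail G e'" shows "e = e'"
proof -
  obtain p p' where "cycle (e # p)" "cycle (e' # p')"
    using assms returning_imp_cycle_Cons by metis
  with disjoint assms(3) show ?thesis unfolding disjoint_cycles_def
    by (metis list.sel(1))
qed

text \<open>
  Here the arcs are completed to cycles that end with them.
\<close>

lemma returning_head_unique:
  assumes "returning e" "returning e'" "head G e = head G e'" shows "e = e'"
proof -
  obtain p p' where "cycle (p @ [e])" "tail G (hd (p @ [e])) = head G e"
     "cycle (p' @ [e'])" "tail G (hd (p' @ [e'])) = head G e'"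
    using assms returning_imp_cycle_snoc by metis
  with disjoint assms(3) show ?thesis unfolding disjoint_cycles_def
    by (metis last_snoc)
qed

lemma cycle_successive:
  assumes "cycle C" "m < length C"
  shows "head G (C ! m) = tail G (C ! (Suc m mod length C))"
proof -
  obtain u where u: "awalk u C u" "C \<noteq> []" using assms(1) unfolding cycle_def by blast
  then have "map (tail G) C @ [head G (last C)] = tail G (hd C) # map (head G) C"
    using awalk_verts_conv[of u C] awalk_verts_conv'[of u C u] by (auto simp: awalk_def)
  then have *: "(map (tail G) C @ [head G (last C)]) ! Suc m = head G (C ! m)"
    using assms(2) by simp
  show ?thesis
  proof (cases "Suc m < length C")
    case True then show ?thesis using * by (simp add: nth_append)
  next
    case False
    then have m: "Suc m = length C" using assms(2) by simp
    have "head G (last C) = u" "tail G (hd C) = u"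
      using u awlast_of_awalk[of u C u] awhd_of_awalk[of u C u] awalk_verts_conv[of u C]
      by (auto simp: hd_append hd_map)
    then show ?thesis using m u(2) by (metis diff_Suc_1 hd_conv_nth last_conv_nth mod_self)
  qed
qed

lemma walk_verts_cycle:
  assumes "cycle C" shows "walk_verts G C = tail G ` set C"
proof -
  have "head G e \<in> tail G ` set C" if e: "e \<in> set C" for e
  proof -
    obtain m where m: "m < length C" "e = C ! m" using e by (auto simp: in_set_conv_nth)
    then have "C ! (Suc m mod length C) \<in> set C" by (intro nth_mem mod_less_divisor) auto
    then show ?thesis using cycle_successive[OF assms m(1)] m(2) by simp
  qed
  then show ?thesis by (auto simp: walk_verts_def)
qed

lemma on_cycle_iff: "on_cycle G v \<longleftrightarrow> (\<exists>e. returning e \<and> tail G e = v)"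
proof
  assume "on_cycle G v"
  then show "\<exists>e. returning e \<and> tail G e = v"
    unfolding on_cycle_def by (metis cycle_arc_returning image_iff walk_verts_cycle)
next
  assume "\<exists>e. returning e \<and> tail G e = v"
  then obtain e p where "tail G e = v" "cycle (e # p)" using returning_imp_cycle_Cons by blast
  then show "on_cycle G v" unfolding on_cycle_def using walk_verts_cycle by fastforce
qed

lemma returning_on_cycle: "returning e \<Longrightarrow> on_cycle G (tail G e)" "returning e \<Longrightarrow> on_cycle G (head G e)"
proof -
  assume e: "returning e"
  then show "on_cycle G (tail G e)" using on_cycle_iff by blast
  obtain p where "cycle (e # p)" using e returning_imp_cycle_Cons by blast
  then show "on_cycle G (head G e)" unfolding on_cycle_def by (auto simp: walk_verts_def)
qed

text \<open>
  All arcs of a walk from \<open>u\<close> to \<open>v\<close> are returning, and the only returning arc out of a vertex of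
  \<open>C\<close> belongs to \<open>C\<close>, so the walk never leaves \<open>C\<close>.
\<close>

lemma cycle_closed_under_mutual_reachability:
  assumes "u \<rightarrow>\<^sup>* v" "v \<rightarrow>\<^sup>* u" "cycle C" "u \<in> walk_verts G C"
  shows "v \<in> walk_verts G C"
  using assms(1,2,4)
proof (induction rule: converse_reachable_induct)
  case base then show ?case by simp
next
  case (step u w)
  obtain e where e: "e \<in> arcs G" "tail G e = u" "head G e = w"
    using step.hyps(1) by (auto simp: arcs_ends_conv)
  have "returning e" unfolding returning_def using e step.hyps(2) step.prems(1) reachable_trans by blast
  moreover obtain e0 where "e0 \<in> set C" "tail G e0 = u"
    using step.prems(2) walk_verts_cycle[OF assms(3)] by auto
  ultimately have "e \<in> set C"
    using e(2) returning_tail_unique cycle_arc_returning[OF assms(3)] by metis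
  then have "w \<in> walk_verts G C" using e by (auto simp: walk_verts_def)
  moreover have "v \<rightarrow>\<^sup>* w" using step.prems(1) step.hyps(1) by (meson reachable_adj_trans)
  ultimately show ?case using step.IH by blast
qed

lemma cycle_reachable:
  assumes "cycle C" "u \<in> walk_verts G C" "v \<in> walk_verts G C" shows "u \<rightarrow>\<^sup>* v"
proof -
  obtain a where a: "awalk a C a" "C \<noteq> []" using assms(1) unfolding cycle_def by blast
  then have "u \<in> set (awalk_verts a C)" "v \<in> set (awalk_verts a C)"
    using assms(2,3) set_awalk_verts_not_Nil[OF a] by (auto simp: walk_verts_def)
  then show ?thesis using a(1) awalk_verts_reachable_from awalk_verts_reachable_to reachable_trans by blast
qed

text \<open>
  The periodic enumeration starting at \<open>v\<close>, with \<open>c i\<close> the arc out of the \<open>i\<close>-th vertex.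
\<close>

lemma cycle_enumeration:
  assumes C: "cycle C" and v: "v \<in> walk_verts G C"
  shows "\<exists>p c. p 0 = v \<and> (\<forall>i::nat. returning (c i) \<and> tail G (c i) = p i \<and> head G (c i) = p (Suc i)) \<and>
    (\<forall>i j. p i = p j \<longleftrightarrow> i mod length C = j mod length C) \<and> walk_verts G C = p ` {..<length C}"
proof -
  define n where "n = length C"
  obtain k where k: "k < n" "v = tail G (C ! k)"
    using v unfolding walk_verts_cycle[OF C] n_def by (metis imageE in_set_conv_nth)
  then have n: "0 < n" by simp
  define c where "c i = C ! ((k + i) mod n)" for i
  define p where "p i = tail G (c i)" for i
  have ret: "returning (c i)" for i
    using cycle_arc_returning[OF C] n by (simp add: c_def n_def)
  have hd: "head G (c i) = p (Suc i)" for i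
    using cycle_successive[OF C, of "(k + i) mod n"] n unfolding p_def c_def n_def[symmetric]
    by (simp add: mod_Suc_eq)
  have inj: "p i = p j \<longleftrightarrow> i mod n = j mod n" for i j
  proof
    assume "p i = p j"
    then have "c i = c j" unfolding p_def using ret returning_tail_unique by blast
    moreover have "distinct C" using C by (auto simp: cycle_conv)
    ultimately have "(k + i) mod n = (k + j) mod n"
      using n by (simp add: c_def n_def nth_eq_iff_index_eq)
    then show "i mod n = j mod n"
      using cong_add_lcancel_nat[of k i j n] by (simp add: cong_def)
  next
    assume "i mod n = j mod n"
    then show "p i = p j" unfolding p_def c_def by (metis mod_add_right_eq)
  qed
  have "walk_verts G C = p ` {..<n}"
  proof
    show "p ` {..<n} \<subseteq> walk_verts G C" unfolding walk_verts_cycle[OF C] p_def c_def n_def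
      using n n_def by auto
    show "walk_verts G C \<subseteq> p ` {..<n}"
    proof
      fix u assume "u \<in> walk_verts G C"
      then obtain m where m: "m < n" "u = tail G (C ! m)"
        unfolding walk_verts_cycle[OF C] n_def by (metis imageE in_set_conv_nth)
      have "(k + (n + m - k) mod n) mod n = m" using m k
        by (simp add: mod_add_right_eq)
      then have "u = p ((n + m - k) mod n)" using m by (simp add: p_def c_def)
      then show "u \<in> p ` {..<n}" using n by auto
    qed
  qed
  moreover have "p 0 = v" using k by (simp add: p_def c_def)
  moreover have "\<forall>i. returning (c i) \<and> tail G (c i) = p i \<and> head G (c i) = p (Suc i)"
    using ret hd by (simp add: p_def)
  ultimately show ?thesis using inj unfolding n_def by blast
qed

text \<open>
  Following arcs forward from \<open>v\<close> must repeat a vertex; the arc with which the first visit to it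
  is left is returning.
\<close>

lemma reaches_cycle:
  assumes "v \<in> verts G" shows "\<exists>w. v \<rightarrow>\<^sup>* w \<and> on_cycle G w"
proof -
  obtain f where f: "\<And>v. v \<in> verts G \<Longrightarrow> f v \<in> arcs G \<and> tail G (f v) = v"
    using ex_out_arc by metis
  define s where "s i = ((\<lambda>v. head G (f v)) ^^ i) v" for i
  have s: "s i \<in> verts G" for i by (induction i) (auto simp: s_def assms f)
  have step: "head G (f (s i)) = s (Suc i)" for i by (simp add: s_def)
  have reach: "s i \<rightarrow>\<^sup>* s (i + k)" for i k
    by (induction k) (use s f arc_reachable step reachable_trans in \<open>auto simp: s_def, metis\<close>)
  have "\<not> inj s" using s finite_verts
    by (metis finite_imageD finite_subset image_subsetI infinite_UNIV_nat)
  then obtain i j where "s i = s j" "i < j" by (metis injI nat_neq_iff)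
  then have "s (Suc i) \<rightarrow>\<^sup>* s i" using reach[of "Suc i" "j - Suc i"] by simp
  then have "returning (f (s i))" unfolding returning_def using f s step by auto
  then have "on_cycle G (s i)" using returning_on_cycle f s by metis
  moreover have "v \<rightarrow>\<^sup>* s i" using reach[of 0 i] by (simp add: s_def)
  ultimately show ?thesis by blast
qed

lemma reached_from_cycle:
  assumes "v \<in> verts G" shows "\<exists>w. w \<rightarrow>\<^sup>* v \<and> on_cycle G w"
proof -
  obtain f where f: "\<And>v. v \<in> verts G \<Longrightarrow> f v \<in> arcs G \<and> head G (f v) = v"
    using ex_in_arc by metis
  define s where "s i = ((\<lambda>v. tail G (f v)) ^^ i) v" for i
  have s: "s i \<in> verts G" for i by (induction i) (auto simp: s_def assms f)
  have step: "tail G (f (s i)) = s (Suc i)" for i by (simp add: s_def)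
  have reach: "s (i + k) \<rightarrow>\<^sup>* s i" for i k
    by (induction k) (use s f arc_reachable step reachable_trans in \<open>auto simp: s_def, metis\<close>)
  have "\<not> inj s" using s finite_verts
    by (metis finite_imageD finite_subset image_subsetI infinite_UNIV_nat)
  then obtain i j where "s i = s j" "i < j" by (metis injI nat_neq_iff)
  then have "s i \<rightarrow>\<^sup>* s (Suc i)" using reach[of "Suc i" "j - Suc i"] by simp
  then have "returning (f (s i))" unfolding returning_def using f s step by auto
  then have "on_cycle G (s i)" using returning_on_cycle f s by metis
  moreover have "s i \<rightarrow>\<^sup>* v" using reach[of 0 i] by (simp add: s_def)
  ultimately show ?thesis by blast
qed

lemma walk_to_cycle:
  assumes "v \<in> verts G"
  shows "\<exists>p w. awalk v p w \<and> on_cycle G w \<and> (\<forall>e\<in>set p. \<not> on_cycle G (tail G e))"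
proof -
  have "\<exists>p' w. awalk v p' w \<and> on_cycle G w \<and> (\<forall>e\<in>set p'. \<not> on_cycle G (tail G e))"
    if "awalk v p w" "on_cycle G w" for p w
    using that
  proof (induction p arbitrary: v)
    case Nil
    then show ?case by (intro exI[of _ "[]"] exI[of _ v]) (auto simp: awalk_Nil_iff)
  next
    case (Cons e p)
    show ?case
    proof (cases "on_cycle G v")
      case True
      then show ?thesis using Cons.prems(1)
        by (intro exI[of _ "[]"] exI[of _ v]) (auto simp: awalk_Nil_iff awalk_hd_in_verts)
    next
      case False
      obtain p' w' where "awalk (head G e) p' w'" "on_cycle G w'" "\<forall>e\<in>set p'. \<not> on_cycle G (tail G e)"
        using Cons.IH[of "head G e"] Cons.prems by (auto simp: awalk_Cons_iff)
      then show ?thesis using Cons.prems(1) False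
        by (intro exI[of _ "e # p'"] exI[of _ w']) (auto simp: awalk_Cons_iff)
    qed
  qed
  moreover obtain p w where "awalk v p w" "on_cycle G w"
    using reaches_cycle[OF assms] by (auto simp: reachable_awalk)
  ultimately show ?thesis by blast
qed

text \<open>
  The walk is cut at its last visit to a cycle. It is empty if \<open>v\<close> itself lies on a cycle, which is
  needed for prolonging it by an arc out of \<open>v\<close>.
\<close>

lemma walk_from_cycle:
  assumes "v \<in> verts G"
  shows "\<exists>p w. awalk w p v \<and> on_cycle G w \<and> (\<forall>e\<in>set (tl p). \<not> on_cycle G (tail G e)) \<and>
    (p \<noteq> [] \<longrightarrow> \<not> on_cycle G v)"
proof -
  have "\<exists>p' w. awalk w p' v \<and> on_cycle G w \<and> (\<forall>e\<in>set (tl p'). \<not> on_cycle G (tail G e)) \<and>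
    (p' \<noteq> [] \<longrightarrow> \<not> on_cycle G v)"
    if "awalk w p v" "on_cycle G w" for p w
    using that
  proof (induction p arbitrary: v rule: rev_induct)
    case Nil
    then show ?case by (intro exI[of _ "[]"] exI[of _ v]) (auto simp: awalk_Nil_iff)
  next
    case (snoc e p)
    show ?case
    proof (cases "on_cycle G v")
      case True
      then show ?thesis using snoc.prems(1)
        by (intro exI[of _ "[]"] exI[of _ v]) (auto simp: awalk_Nil_iff awalk_last_in_verts simp del: awalk_append_iff)
    next
      case False
      have e: "awalk w p (tail G e)" "awalk (tail G e) [e] v" using snoc.prems by (auto simp: awalk_Cons_iff)
      obtain p' w' where p': "awalk w' p' (tail G e)" "on_cycle G w'"
         "\<forall>e\<in>set (tl p'). \<not> on_cycle G (tail G e)" "p' \<noteq> [] \<longrightarrow> \<not> on_cycle G (tail G e)"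
        using snoc.IH[OF e(1)] snoc.prems by auto
      then have "awalk w' (p' @ [e]) v" using e(2) awalk_appendI by blast
      moreover have "\<forall>e\<in>set (tl (p' @ [e])). \<not> on_cycle G (tail G e)"
        using p'(3,4) by (cases p') auto
      ultimately show ?thesis using p'(2) False by blast
    qed
  qed
  moreover obtain p w where "awalk w p v" "on_cycle G w"
    using reached_from_cycle[OF assms] by (auto simp: reachable_awalk)
  ultimately show ?thesis by blast
qed

lemma awalk_nth_Suc:
  assumes "awalk u p v" "Suc i < length p" shows "head G (p ! i) = tail G (p ! Suc i)"
  using assms
proof (induction p arbitrary: u i)
  case (Cons e p)
  then show ?case by (cases i; cases p) (auto simp: awalk_Cons_iff)
qed simp

lemma awalk_nth_reachable:
  assumes "awalk u p v" "i < j" "j < length p" shows "head G (p ! i) \<rightarrow>\<^sup>* tail G (p ! j)"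
  using assms(2,3)
proof (induction j)
  case (Suc j)
  have sub: "set p \<subseteq> arcs G" using assms(1) by auto
  have j: "head G (p ! j) = tail G (p ! Suc j)" using awalk_nth_Suc[OF assms(1)] Suc.prems by blast
  have arc: "p ! j \<in> arcs G" using Suc.prems sub by (meson Suc_lessD nth_mem subsetD)
  show ?case
  proof (cases "i = j")
    case True then show ?thesis using j arc head_in_verts by (metis reachable_refl)
  next
    case False
    then have "head G (p ! i) \<rightarrow>\<^sup>* tail G (p ! j)" using Suc by auto
    then show ?thesis using arc_reachable[OF arc] j reachable_trans by metis
  qed
qed simp

end

section \<open>Trails between the cycles of a meteor graph\<close>

locale meteor3_digraph = disjoint_cycle_digraph +
  fixes P Q R :: "'b list"
  assumes cycle_iff: "\<And>C. cycle C \<longleftrightarrow> same_cycle P C \<or> same_cycle Q C \<or> same_cycle R C"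
    and PQ: "\<not> same_cycle P Q" and QR: "\<not> same_cycle Q R" and PR: "\<not> same_cycle P R"
    and ge_PQ: "cycle_ge G P Q" and ge_QR: "cycle_ge G Q R"
    and nf: "normal_form G P Q R"
begin

abbreviation "VP \<equiv> walk_verts G P"
abbreviation "VQ \<equiv> walk_verts G Q"
abbreviation "VR \<equiv> walk_verts G R"

lemma cycles: "cycle P" "cycle Q" "cycle R"
  by (simp_all add: cycle_iff same_cycle_refl)

lemma length_pos: "0 < length P" "0 < length Q" "0 < length R"
  using cycles unfolding cycle_def by auto

lemma on_cycle_iff_in: "on_cycle G v \<longleftrightarrow> v \<in> VP \<or> v \<in> VQ \<or> v \<in> VR"
proof
  assume "on_cycle G v"
  then obtain C where "v \<in> walk_verts G C" "same_cycle P C \<or> same_cycle Q C \<or> same_cycle R C"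
    unfolding on_cycle_def cycle_iff by blast
  then show "v \<in> VP \<or> v \<in> VQ \<or> v \<in> VR"
    using walk_verts_same_cycle[of P C G] walk_verts_same_cycle[of Q C G] walk_verts_same_cycle[of R C G]
    by (elim disjE) simp_all
next
  assume "v \<in> VP \<or> v \<in> VQ \<or> v \<in> VR"
  then show "on_cycle G v" unfolding on_cycle_def using cycles by blast
qed

lemma same_cycle_if_common_vertex:
  assumes "cycle C" "cycle D" "v \<in> walk_verts G C" "v \<in> walk_verts G D"
  shows "same_cycle C D"
proof -
  have rot: "\<exists>n. cycle (rotate n C) \<and> tail G (hd (rotate n C)) = v"
    if C: "cycle C" "v \<in> walk_verts G C" for C
  proof -
    obtain k where k: "k < length C" "tail G (C ! k) = v"
      using C(2) unfolding walk_verts_cycle[OF C(1)] by (auto simp: in_set_conv_nth)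
    have "same_cycle C (rotate k C)" unfolding same_cycle_def by blast
    then have "cycle (rotate k C)" using C(1) cycle_iff same_cycle_trans by blast
    moreover have "hd (rotate k C) = C ! k" using k(1) by (subst hd_rotate_conv_nth) auto
    ultimately show ?thesis using k(2) by metis
  qed
  obtain m where m: "cycle (rotate m C)" "tail G (hd (rotate m C)) = v" using rot[OF assms(1,3)] by blast
  obtain n where n: "cycle (rotate n D)" "tail G (hd (rotate n D)) = v" using rot[OF assms(2,4)] by blast
  have eq: "rotate m C = rotate n D" using disjoint m n unfolding disjoint_cycles_def by simp
  have 1: "same_cycle C (rotate m C)" unfolding same_cycle_def by (rule exI, rule refl)
  have 2: "same_cycle D (rotate n D)" unfolding same_cycle_def by (rule exI, rule refl)
  show ?thesis using same_cycle_trans[OF 1] same_cycle_sym[OF 2] eq by simp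
qed

lemma cycle_verts_disjoint:
  "v \<in> VP \<Longrightarrow> v \<notin> VQ" "v \<in> VP \<Longrightarrow> v \<notin> VR" "v \<in> VQ \<Longrightarrow> v \<notin> VR"
  using same_cycle_if_common_vertex[OF cycles(1,2)] same_cycle_if_common_vertex[OF cycles(1,3)]
    same_cycle_if_common_vertex[OF cycles(2,3)] PQ QR PR by auto

lemma ge_reachable:
  assumes "cycle C" "cycle D" "cycle_ge G C D" "u \<in> walk_verts G C" "v \<in> walk_verts G D"
  shows "u \<rightarrow>\<^sup>* v"
proof -
  obtain a b where "a \<in> walk_verts G C" "b \<in> walk_verts G D" "a \<rightarrow>\<^sup>* b"
    using assms(3) unfolding cycle_ge_def by blast
  then show ?thesis
    using cycle_reachable[OF assms(1,4), of a] cycle_reachable[OF assms(2) _ assms(5), of b]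
    by (meson reachable_trans)
qed

lemma down:
  "u \<in> VP \<Longrightarrow> v \<in> VQ \<Longrightarrow> u \<rightarrow>\<^sup>* v" "u \<in> VQ \<Longrightarrow> v \<in> VR \<Longrightarrow> u \<rightarrow>\<^sup>* v"
  "u \<in> VP \<Longrightarrow> v \<in> VR \<Longrightarrow> u \<rightarrow>\<^sup>* v"
proof -
  show a: "u \<rightarrow>\<^sup>* v" if "u \<in> VP" "v \<in> VQ" for u v using that ge_reachable[OF cycles(1,2) ge_PQ] by blast
  show b: "u \<rightarrow>\<^sup>* v" if "u \<in> VQ" "v \<in> VR" for u v using that ge_reachable[OF cycles(2,3) ge_QR] by blast
  obtain w where "w \<in> VQ" using ge_PQ unfolding cycle_ge_def by blast
  then show "u \<rightarrow>\<^sup>* v" if "u \<in> VP" "v \<in> VR" using reachable_trans[OF a b] that by blast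
qed

lemma not_up:
  "u \<in> VP \<Longrightarrow> v \<in> VQ \<Longrightarrow> \<not> v \<rightarrow>\<^sup>* u" "u \<in> VQ \<Longrightarrow> v \<in> VR \<Longrightarrow> \<not> v \<rightarrow>\<^sup>* u"
  "u \<in> VP \<Longrightarrow> v \<in> VR \<Longrightarrow> \<not> v \<rightarrow>\<^sup>* u"
proof -
  show "\<not> v \<rightarrow>\<^sup>* u" if "u \<in> VP" "v \<in> VQ"
    using cycle_closed_under_mutual_reachability[OF down(1)[OF that] _ cycles(1) that(1)]
      cycle_verts_disjoint(1)[of v] that(2) by fast
  show "\<not> v \<rightarrow>\<^sup>* u" if "u \<in> VQ" "v \<in> VR"
    using cycle_closed_under_mutual_reachability[OF down(2)[OF that] _ cycles(2) that(1)]
      cycle_verts_disjoint(3)[of v] that(2) by fast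
  show "\<not> v \<rightarrow>\<^sup>* u" if "u \<in> VP" "v \<in> VR"
    using cycle_closed_under_mutual_reachability[OF down(3)[OF that] _ cycles(1) that(1)]
      cycle_verts_disjoint(2)[of v] that(2) by fast
qed

text \<open>
  The trails between different cycles. They lead down the chain, since no path leads up.
\<close>

definition link :: "'b list \<Rightarrow> bool" where
  "link \<alpha> \<longleftrightarrow> cycle_trail G P Q \<alpha> \<or> cycle_trail G Q R \<alpha> \<or> cycle_trail G P R \<alpha>"

lemma link_walk:
  assumes "link \<alpha>"
  shows "\<alpha> \<noteq> []" "awalk (tail G (hd \<alpha>)) \<alpha> (head G (last \<alpha>))" "set \<alpha> \<subseteq> arcs G"
    "\<And>e. e \<in> set (tl \<alpha>) \<Longrightarrow> \<not> on_cycle G (tail G e)"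
    "on_cycle G (tail G (hd \<alpha>))" "on_cycle G (head G (last \<alpha>))"
    "\<not> head G (last \<alpha>) \<rightarrow>\<^sup>* tail G (hd \<alpha>)"
proof -
  obtain u v where uv: "\<alpha> \<noteq> []" "awalk u \<alpha> v" "\<forall>e\<in>set (tl \<alpha>). \<not> on_cycle G (tail G e)"
    "(u \<in> VP \<and> v \<in> VQ) \<or> (u \<in> VQ \<and> v \<in> VR) \<or> (u \<in> VP \<and> v \<in> VR)"
    using assms unfolding link_def cycle_trail_def by blast
  have u: "tail G (hd \<alpha>) = u" using uv(1,2) by (cases \<alpha>) (auto simp: awalk_Cons_iff)
  have v: "head G (last \<alpha>) = v"
    using uv(1,2) by (cases \<alpha> rule: rev_cases) (auto simp: awalk_Cons_iff awalk_Nil_iff)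
  show "\<alpha> \<noteq> []" "awalk (tail G (hd \<alpha>)) \<alpha> (head G (last \<alpha>))" "set \<alpha> \<subseteq> arcs G"
    "\<And>e. e \<in> set (tl \<alpha>) \<Longrightarrow> \<not> on_cycle G (tail G e)"
    "on_cycle G (tail G (hd \<alpha>))" "on_cycle G (head G (last \<alpha>))"
    "\<not> head G (last \<alpha>) \<rightarrow>\<^sup>* tail G (hd \<alpha>)"
    using uv not_up unfolding u v on_cycle_iff_in by auto
qed

lemma link_nth_Suc: "link \<alpha> \<Longrightarrow> Suc i < length \<alpha> \<Longrightarrow> head G (\<alpha> ! i) = tail G (\<alpha> ! Suc i)"
  using awalk_nth_Suc link_walk(2) by blast

lemma link_tail_on_cycle:
  assumes "link \<alpha>" "i < length \<alpha>" shows "on_cycle G (tail G (\<alpha> ! i)) \<longleftrightarrow> i = 0"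
proof (cases i)
  case 0 then show ?thesis using link_walk(1,5)[OF assms(1)] by (simp add: hd_conv_nth)
next
  case (Suc j)
  then have "\<alpha> ! i = tl \<alpha> ! j" "j < length (tl \<alpha>)" using assms(2) by (auto simp: nth_tl)
  then have "\<alpha> ! i \<in> set (tl \<alpha>)" by (metis nth_mem)
  then show ?thesis using link_walk(4)[OF assms(1)] Suc by blast
qed

lemma link_head_on_cycle:
  assumes "link \<alpha>" "i < length \<alpha>" shows "on_cycle G (head G (\<alpha> ! i)) \<longleftrightarrow> Suc i = length \<alpha>"
proof (cases "Suc i = length \<alpha>")
  case True
  then have "\<alpha> ! i = last \<alpha>" using link_walk(1)[OF assms(1)] by (metis diff_Suc_1 last_conv_nth)
  then show ?thesis using link_walk(6)[OF assms(1)] True by simp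
next
  case False
  then have "Suc i < length \<alpha>" using assms(2) by simp
  then show ?thesis using link_nth_Suc[OF assms(1)] link_tail_on_cycle[OF assms(1)] False by fastforce
qed

lemma link_not_returning:
  assumes "link \<alpha>" "e \<in> set \<alpha>" shows "\<not> returning e"
proof
  assume r: "returning e"
  obtain i where i: "i < length \<alpha>" "e = \<alpha> ! i" using assms(2) by (auto simp: in_set_conv_nth)
  have "i = 0" "Suc i = length \<alpha>"
    using returning_on_cycle[OF r] link_tail_on_cycle link_head_on_cycle assms(1) i by auto
  then have "hd \<alpha> = e" "last \<alpha> = e" using i link_walk(1)[OF assms(1)]
    by (auto simp: hd_conv_nth last_conv_nth)
  then show False using link_walk(7)[OF assms(1)] r unfolding returning_def by simp
qed

text \<open>
  Prolong the arc backwards and forwards until cycles are met. If the resulting trail did not lead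
  down, its end would reach its start, so its first arc would be returning and would end on a cycle;
  being a trail it would then consist of that arc, which is the given one.
\<close>

lemma arc_on_link:
  assumes e: "e \<in> arcs G" "\<not> returning e"
  shows "\<exists>\<alpha>. link \<alpha> \<and> e \<in> set \<alpha>"
proof -
  obtain p u where p: "awalk u p (tail G e)" "on_cycle G u" "\<forall>e\<in>set (tl p). \<not> on_cycle G (tail G e)"
    "p \<noteq> [] \<longrightarrow> \<not> on_cycle G (tail G e)"
    using walk_from_cycle[of "tail G e"] e(1) by auto
  obtain f v where f: "awalk (head G e) f v" "on_cycle G v" "\<forall>e\<in>set f. \<not> on_cycle G (tail G e)"
    using walk_to_cycle[of "head G e"] e(1) by auto
  define \<alpha> where "\<alpha> = p @ e # f"
  have w: "awalk u \<alpha> v" unfolding \<alpha>_def using p(1) f(1) e(1) by (auto simp: awalk_Cons_iff)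
  have tl: "\<forall>e\<in>set (tl \<alpha>). \<not> on_cycle G (tail G e)"
    unfolding \<alpha>_def using p(3,4) f(3) by (cases p) auto
  have "\<alpha> \<noteq> []" unfolding \<alpha>_def by simp
  then have u: "tail G (hd \<alpha>) = u" using w by (cases \<alpha>) (auto simp: awalk_Cons_iff)
  have "link \<alpha>"
  proof (rule ccontr)
    assume "\<not> link \<alpha>"
    then have "\<not> (u \<in> VP \<and> v \<in> VQ)" "\<not> (u \<in> VQ \<and> v \<in> VR)" "\<not> (u \<in> VP \<and> v \<in> VR)"
      using w tl unfolding link_def cycle_trail_def \<alpha>_def by blast+
    then have "(u \<in> VP \<and> v \<in> VP) \<or> (u \<in> VQ \<and> v \<in> VQ) \<or> (u \<in> VR \<and> v \<in> VR) \<or>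
      (v \<in> VP \<and> u \<in> VQ) \<or> (v \<in> VQ \<and> u \<in> VR) \<or> (v \<in> VP \<and> u \<in> VR)"
      using p(2) f(2) unfolding on_cycle_iff_in by blast
    then have "v \<rightarrow>\<^sup>* u" using down cycle_reachable cycles by blast
    moreover obtain e1 \<alpha>' where \<alpha>': "\<alpha> = e1 # \<alpha>'" unfolding \<alpha>_def by (cases p) auto
    moreover have "awalk (head G e1) \<alpha>' v" "e1 \<in> arcs G" using w \<alpha>' by (auto simp: awalk_Cons_iff)
    ultimately have r: "returning e1" unfolding returning_def
      using u by (metis list.sel(1) reachable_awalkI reachable_trans)
    show False
    proof (cases \<alpha>')
      case Nil
      then have "e1 = e" using \<alpha>' unfolding \<alpha>_def by (cases p) auto
      then show ?thesis using r e by simp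
    next
      case (Cons e2 \<alpha>'')
      then have "tail G e2 = head G e1" using \<open>awalk (head G e1) \<alpha>' v\<close> by (auto simp: awalk_Cons_iff)
      then show ?thesis using tl \<alpha>' Cons returning_on_cycle(2)[OF r] by simp
    qed
  qed
  then show ?thesis unfolding \<alpha>_def by auto
qed

lemma link_unique_vertex:
  assumes "link \<alpha>" "link \<beta>" "v \<in> walk_verts G \<alpha>" "v \<in> walk_verts G \<beta>" "\<not> on_cycle G v"
  shows "\<alpha> = \<beta>"
proof (rule ccontr)
  assume ne: "\<alpha> \<noteq> \<beta>"
  have *: "\<exists>A B. cycle A \<and> cycle B \<and> \<not> same_cycle A B \<and> cycle_trail G A B \<gamma>" if "link \<gamma>" for \<gamma>
    using that cycles PQ QR PR unfolding link_def by blast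
  have "interior_verts G \<alpha> \<inter> interior_verts G \<beta> = {}"
    using nf *[OF assms(1)] *[OF assms(2)] ne unfolding normal_form_def by meson
  then show False using assms unfolding interior_verts_def by blast
qed

text \<open>
  An arc between two vertices of cycles is a link by itself; any other arc has an interior vertex
  at one of its ends.
\<close>

lemma link_unique_arc:
  assumes "link \<alpha>" "link \<beta>" "e \<in> set \<alpha>" "e \<in> set \<beta>" shows "\<alpha> = \<beta>"
proof (cases "on_cycle G (tail G e) \<and> on_cycle G (head G e)")
  case False
  have "tail G e \<in> walk_verts G \<alpha>" "tail G e \<in> walk_verts G \<beta>"
     "head G e \<in> walk_verts G \<alpha>" "head G e \<in> walk_verts G \<beta>"
    using assms by (auto simp: walk_verts_def)
  then show ?thesis using False link_unique_vertex assms(1,2) by blast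
next
  case True
  have "\<gamma> = [e]" if \<gamma>: "link \<gamma>" "e \<in> set \<gamma>" for \<gamma>
  proof -
    obtain i where i: "i < length \<gamma>" "e = \<gamma> ! i" using \<gamma>(2) by (auto simp: in_set_conv_nth)
    then have "i = 0" "Suc i = length \<gamma>" using True link_tail_on_cycle link_head_on_cycle \<gamma>(1) by auto
    then show ?thesis using i by (cases \<gamma>) auto
  qed
  then show ?thesis using assms by metis
qed

text \<open>
  A repeated vertex would put a returning arc on the link.
\<close>

lemma link_position_unique:
  assumes "link \<alpha>" "i < length \<alpha>" "j < length \<alpha>"
  shows "head G (\<alpha> ! i) = head G (\<alpha> ! j) \<Longrightarrow> i = j" "tail G (\<alpha> ! i) = tail G (\<alpha> ! j) \<Longrightarrow> i = j"
proof -
  have arc: "\<alpha> ! i \<in> arcs G" if "i < length \<alpha>" for i using link_walk(3)[OF assms(1)] that by force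
  have False if ij: "i < j" "j < length \<alpha>"
    "head G (\<alpha> ! i) = head G (\<alpha> ! j) \<or> tail G (\<alpha> ! i) = tail G (\<alpha> ! j)" for i j
  proof -
    have r: "head G (\<alpha> ! i) \<rightarrow>\<^sup>* tail G (\<alpha> ! j)"
      using awalk_nth_reachable[OF link_walk(2)[OF assms(1)] ij(1,2)] .
    have "returning (\<alpha> ! i) \<or> returning (\<alpha> ! j)"
      using r ij arc unfolding returning_def by (metis less_trans)
    then show False using link_not_returning[OF assms(1)] ij by (meson less_trans nth_mem)
  qed
  then show "head G (\<alpha> ! i) = head G (\<alpha> ! j) \<Longrightarrow> i = j" "tail G (\<alpha> ! i) = tail G (\<alpha> ! j) \<Longrightarrow> i = j"
    using assms(2,3) by (metis nat_neq_iff)+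
qed

lemma interior_position:
  assumes "s \<in> verts G" "\<not> on_cycle G s"
  shows "\<exists>\<alpha> k. link \<alpha> \<and> Suc k < length \<alpha> \<and> head G (\<alpha> ! k) = s \<and> tail G (\<alpha> ! Suc k) = s"
proof -
  obtain e where e: "e \<in> arcs G" "tail G e = s" using ex_out_arc assms(1) by blast
  then have "\<not> returning e" using returning_on_cycle(1) assms(2) by blast
  then obtain \<alpha> where \<alpha>: "link \<alpha>" "e \<in> set \<alpha>" using arc_on_link e by blast
  obtain i where i: "i < length \<alpha>" "e = \<alpha> ! i" using \<alpha>(2) by (auto simp: in_set_conv_nth)
  then obtain k where k: "i = Suc k" using link_tail_on_cycle[OF \<alpha>(1) i(1)] e(2) assms(2) by (cases i) auto
  show ?thesis using link_nth_Suc[OF \<alpha>(1), of k] i k e(2) \<alpha>(1) by metis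
qed

text \<open>
  The link through an interior vertex, and the index on it of the arc that enters the vertex.
\<close>

definition the_link :: "'a \<Rightarrow> 'b list" where
  "the_link s = (SOME \<alpha>. \<exists>k. link \<alpha> \<and> Suc k < length \<alpha> \<and> head G (\<alpha> ! k) = s \<and> tail G (\<alpha> ! Suc k) = s)"

definition depth :: "'a \<Rightarrow> nat" where
  "depth s = (SOME k. Suc k < length (the_link s) \<and> head G (the_link s ! k) = s \<and> tail G (the_link s ! Suc k) = s)"

lemma the_link:
  assumes "s \<in> verts G" "\<not> on_cycle G s"
  shows "link (the_link s)" "Suc (depth s) < length (the_link s)"
    "head G (the_link s ! depth s) = s" "tail G (the_link s ! Suc (depth s)) = s"
proof -
  have "\<exists>k. link (the_link s) \<and> Suc k < length (the_link s) \<and> head G (the_link s ! k) = s \<and> tail G (the_link s ! Suc k) = s"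
    unfolding the_link_def by (rule someI_ex) (rule interior_position[OF assms])
  moreover from this have "Suc (depth s) < length (the_link s) \<and> head G (the_link s ! depth s) = s \<and> tail G (the_link s ! Suc (depth s)) = s"
    unfolding depth_def by (intro someI_ex[of "\<lambda>k. Suc k < length (the_link s) \<and> head G (the_link s ! k) = s \<and> tail G (the_link s ! Suc k) = s"]) blast
  ultimately show "link (the_link s)" "Suc (depth s) < length (the_link s)"
    "head G (the_link s ! depth s) = s" "tail G (the_link s ! Suc (depth s)) = s" by auto
qed

lemma the_link_eq:
  assumes "link \<alpha>" "Suc k < length \<alpha>"
  shows "\<not> on_cycle G (head G (\<alpha> ! k))" "the_link (head G (\<alpha> ! k)) = \<alpha>" "depth (head G (\<alpha> ! k)) = k"
    "head G (\<alpha> ! k) \<in> verts G"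
proof -
  let ?s = "head G (\<alpha> ! k)"
  have mem: "\<alpha> ! k \<in> set \<alpha>" using assms(2) by simp
  show v: "?s \<in> verts G" using mem link_walk(3)[OF assms(1)] by auto
  show o: "\<not> on_cycle G ?s" using link_head_on_cycle[OF assms(1)] assms(2) by simp
  note t = the_link[OF v o]
  have "the_link ?s ! depth ?s \<in> set (the_link ?s)" using t(2) by simp
  then have "?s \<in> walk_verts G (the_link ?s)" unfolding walk_verts_def using t(3) by (metis UnI2 imageI)
  moreover have "?s \<in> walk_verts G \<alpha>" using mem by (auto simp: walk_verts_def)
  ultimately show eq: "the_link ?s = \<alpha>" using link_unique_vertex t(1) assms(1) o by blast
  show "depth ?s = k" using link_position_unique(1)[OF assms(1)] t(2,3) assms(2) unfolding eq by auto
qed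

lemma in_arc_interior:
  assumes "e \<in> arcs G" "\<not> on_cycle G (head G e)"
  shows "e = the_link (head G e) ! depth (head G e)"
proof -
  have "\<not> returning e" using returning_on_cycle(2) assms(2) by blast
  then obtain \<alpha> where \<alpha>: "link \<alpha>" "e \<in> set \<alpha>" using arc_on_link assms by blast
  obtain i where i: "i < length \<alpha>" "e = \<alpha> ! i" using \<alpha>(2) by (auto simp: in_set_conv_nth)
  then have "Suc i < length \<alpha>" using link_head_on_cycle[OF \<alpha>(1) i(1)] assms(2) by auto
  then show ?thesis using the_link_eq[OF \<alpha>(1)] i by metis
qed

lemma out_arc_interior:
  assumes "e \<in> arcs G" "\<not> on_cycle G (tail G e)"
  shows "e = the_link (tail G e) ! Suc (depth (tail G e))"
proof -
  have "\<not> returning e" using returning_on_cycle(1) assms(2) by blast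
  then obtain \<alpha> where \<alpha>: "link \<alpha>" "e \<in> set \<alpha>" using arc_on_link assms by blast
  obtain i where i: "i < length \<alpha>" "e = \<alpha> ! i" using \<alpha>(2) by (auto simp: in_set_conv_nth)
  then obtain k where k: "i = Suc k" using link_tail_on_cycle[OF \<alpha>(1) i(1)] assms(2) by (cases i) auto
  then show ?thesis using the_link_eq[OF \<alpha>(1), of k] link_nth_Suc[OF \<alpha>(1), of k] i by metis
qed

end

section \<open>Merging trails into cycles\<close>

definition adj :: "('a, 'b) pre_digraph \<Rightarrow> 'a \<Rightarrow> 'a \<Rightarrow> nat" where
  "adj G u v = card {e \<in> arcs G. tail G e = u \<and> head G e = v}"

lemma adjacency_mat_eq: "adjacency_mat G vs = enum_mat vs (adj G)"
  by (simp add: adjacency_mat_def enum_mat_def adj_def)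

lemma (in fin_digraph) sum_adj:
  assumes "finite X" "finite Y"
  shows "(\<Sum>v\<in>Y. \<Sum>u\<in>X. adj G u v) = card {e \<in> arcs G. tail G e \<in> X \<and> head G e \<in> Y}"
proof -
  let ?S = "{e \<in> arcs G. tail G e \<in> X \<and> head G e \<in> Y}"
  let ?g = "\<lambda>e. (head G e, tail G e)"
  have "card ?S = (\<Sum>e\<in>?S. 1)" by simp
  also have "\<dots> = (\<Sum>y\<in>Y \<times> X. \<Sum>e\<in>{e \<in> ?S. ?g e = y}. 1)"
    using assms by (intro sum.group[symmetric]) auto
  also have "\<dots> = (\<Sum>(v, u)\<in>Y \<times> X. adj G u v)"
    unfolding adj_def card_eq_sum by (intro sum.cong) (auto intro!: arg_cong[where f = card])
  finally show ?thesis by (simp add: sum.cartesian_product)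
qed

text \<open>
  The cycles are enumerated from the base vertices of the normal form.
\<close>

locale meteor3_enumerated = meteor3_digraph +
  fixes p q r :: "nat \<Rightarrow> 'a" and cp cq cr :: "nat \<Rightarrow> 'b"
  assumes cp: "\<And>i. returning (cp i) \<and> tail G (cp i) = p i \<and> head G (cp i) = p (Suc i)"
    and cq: "\<And>i. returning (cq i) \<and> tail G (cq i) = q i \<and> head G (cq i) = q (Suc i)"
    and cr: "\<And>i. returning (cr i) \<and> tail G (cr i) = r i \<and> head G (cr i) = r (Suc i)"
    and p_eq: "\<And>i j. p i = p j \<longleftrightarrow> i mod length P = j mod length P"
    and q_eq: "\<And>i j. q i = q j \<longleftrightarrow> i mod length Q = j mod length Q"
    and r_eq: "\<And>i j. r i = r j \<longleftrightarrow> i mod length R = j mod length R"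
    and VP: "VP = p ` {..<length P}" and VQ: "VQ = q ` {..<length Q}" and VR: "VR = r ` {..<length R}"
    and trail_PQ: "\<And>\<alpha>. cycle_trail G P Q \<alpha> \<Longrightarrow> awalk (p 0) \<alpha> (q 0)"
    and trail_QR: "\<And>\<alpha>. cycle_trail G Q R \<alpha> \<Longrightarrow> awalk (q 0) \<alpha> (r 0)"
    and trail_PR: "\<And>\<alpha>. cycle_trail G P R \<alpha> \<Longrightarrow> awalk (p 0) \<alpha> (r 0)"
begin

sublocale three_cycles "length P" "length Q" "length R"
  using length_pos by unfold_locales

lemma in_VP: "p i \<in> VP" and in_VQ: "q i \<in> VQ" and in_VR: "r i \<in> VR"
proof -
  show "p i \<in> VP" unfolding VP using length_pos by (intro image_eqI[of _ _ "i mod length P"]) (auto simp: p_eq)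
  show "q i \<in> VQ" unfolding VQ using length_pos by (intro image_eqI[of _ _ "i mod length Q"]) (auto simp: q_eq)
  show "r i \<in> VR" unfolding VR using length_pos by (intro image_eqI[of _ _ "i mod length R"]) (auto simp: r_eq)
qed

lemma on_cycle_pqr: "on_cycle G (p i)" "on_cycle G (q i)" "on_cycle G (r i)"
  using in_VP[of i] in_VQ[of i] in_VR[of i] by (simp_all add: on_cycle_iff_in)

lemma on_cycle_in_verts: "on_cycle G v \<Longrightarrow> v \<in> verts G"
proof -
  assume "on_cycle G v"
  then obtain e where "returning e" "tail G e = v" unfolding on_cycle_iff by blast
  then show "v \<in> verts G" unfolding returning_def by auto
qed

lemma verts_pqr: "p i \<in> verts G" "q i \<in> verts G" "r i \<in> verts G"
  using on_cycle_pqr by (simp_all add: on_cycle_in_verts)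

lemma pqr_distinct [simp]: "p i \<noteq> q j" "q j \<noteq> p i" "p i \<noteq> r j" "r j \<noteq> p i" "q i \<noteq> r j" "r j \<noteq> q i"
proof -
  have "p i \<notin> VQ" "p i \<notin> VR" "q i \<notin> VR"
    using cycle_verts_disjoint in_VP[of i] in_VQ[of i] by auto
  then show "p i \<noteq> q j" "q j \<noteq> p i" "p i \<noteq> r j" "r j \<noteq> p i" "q i \<noteq> r j" "r j \<noteq> q i"
    using in_VQ[of j] in_VR[of j] by auto
qed

lemma walk_ends:
  assumes "awalk u \<alpha> v" "\<alpha> \<noteq> []" shows "tail G (hd \<alpha>) = u" "head G (last \<alpha>) = v"
proof -
  show "tail G (hd \<alpha>) = u" using assms by (cases \<alpha>) (auto simp: awalk_Cons_iff)
  show "head G (last \<alpha>) = v" using assms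
    by (cases \<alpha> rule: rev_cases) (auto simp: awalk_Cons_iff awalk_Nil_iff)
qed

lemma ends_PQ: assumes "cycle_trail G P Q \<alpha>"
  shows "link \<alpha>" "tail G (hd \<alpha>) = p 0" "head G (last \<alpha>) = q 0"
proof -
  show "link \<alpha>" using assms unfolding link_def by simp
  have "\<alpha> \<noteq> []" using assms unfolding cycle_trail_def by simp
  then show "tail G (hd \<alpha>) = p 0" "head G (last \<alpha>) = q 0"
    using walk_ends[OF trail_PQ[OF assms]] by auto
qed

lemma ends_QR: assumes "cycle_trail G Q R \<alpha>"
  shows "link \<alpha>" "tail G (hd \<alpha>) = q 0" "head G (last \<alpha>) = r 0"
proof -
  show "link \<alpha>" using assms unfolding link_def by simp
  have "\<alpha> \<noteq> []" using assms unfolding cycle_trail_def by simp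
  then show "tail G (hd \<alpha>) = q 0" "head G (last \<alpha>) = r 0"
    using walk_ends[OF trail_QR[OF assms]] by auto
qed

lemma ends_PR: assumes "cycle_trail G P R \<alpha>"
  shows "link \<alpha>" "tail G (hd \<alpha>) = p 0" "head G (last \<alpha>) = r 0"
proof -
  show "link \<alpha>" using assms unfolding link_def by simp
  have "\<alpha> \<noteq> []" using assms unfolding cycle_trail_def by simp
  then show "tail G (hd \<alpha>) = p 0" "head G (last \<alpha>) = r 0"
    using walk_ends[OF trail_PR[OF assms]] by auto
qed

lemma link_cases:
  assumes "link \<alpha>"
  obtains "cycle_trail G P Q \<alpha>" "tail G (hd \<alpha>) = p 0" "head G (last \<alpha>) = q 0" "\<not> cycle_trail G Q R \<alpha>"
  | "cycle_trail G P R \<alpha>" "tail G (hd \<alpha>) = p 0" "head G (last \<alpha>) = r 0" "\<not> cycle_trail G Q R \<alpha>"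
  | "cycle_trail G Q R \<alpha>" "tail G (hd \<alpha>) = q 0" "head G (last \<alpha>) = r 0"
proof -
  have n: "tail G (hd \<alpha>) = p 0 \<Longrightarrow> \<not> cycle_trail G Q R \<alpha>" using ends_QR(2)[of \<alpha>] by auto
  consider "cycle_trail G P Q \<alpha>" | "cycle_trail G P R \<alpha>" | "cycle_trail G Q R \<alpha>"
    using assms unfolding link_def by blast
  then show ?thesis
  proof cases
    case 1 show ?thesis by (rule that(1)[OF 1 ends_PQ(2,3)[OF 1] n[OF ends_PQ(2)[OF 1]]])
  next
    case 2 show ?thesis by (rule that(2)[OF 2 ends_PR(2,3)[OF 2] n[OF ends_PR(2)[OF 2]]])
  next
    case 3 show ?thesis by (rule that(3)[OF 3 ends_QR(2,3)[OF 3]])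
  qed
qed

lemma hd_nth: "link \<alpha> \<Longrightarrow> hd \<alpha> = \<alpha> ! 0"
  using link_walk(1) by (simp add: hd_conv_nth)

lemma last_nth: "link \<alpha> \<Longrightarrow> last \<alpha> = \<alpha> ! (length \<alpha> - 1)"
  using link_walk(1) by (simp add: last_conv_nth)

lemma arc_cases:
  assumes "e \<in> arcs G" "\<not> returning e"
  obtains \<alpha> k where "link \<alpha>" "k < length \<alpha>" "e = \<alpha> ! k"
proof -
  obtain \<alpha> where \<alpha>: "link \<alpha>" "e \<in> set \<alpha>" using arc_on_link[OF assms] by blast
  then obtain k where "k < length \<alpha>" "e = \<alpha> ! k" by (auto simp: in_set_conv_nth)
  then show ?thesis using that \<alpha>(1) by blast
qed

lemma in_arc_P: assumes "e \<in> arcs G" "head G e = p (Suc i)" shows "e = cp i"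
proof -
  have "returning e"
  proof (rule ccontr)
    assume nr: "\<not> returning e"
    obtain \<alpha> k where \<alpha>: "link \<alpha>" "k < length \<alpha>" "e = \<alpha> ! k" by (rule arc_cases[OF assms(1) nr])
    then have "Suc k = length \<alpha>" using link_head_on_cycle[of \<alpha> k] on_cycle_pqr assms(2) by simp
    then have "e = last \<alpha>" using last_nth[OF \<alpha>(1)] \<alpha>(3) by (simp flip: \<open>Suc k = length \<alpha>\<close>)
    then show False using assms(2) by (cases rule: link_cases[OF \<alpha>(1)]) auto
  qed
  moreover have "returning (cp i)" "head G (cp i) = p (Suc i)" using cp by simp_all
  ultimately show ?thesis using returning_head_unique assms(2) by simp
qed

lemma out_arc_R: assumes "e \<in> arcs G" "tail G e = r i" shows "e = cr i"
proof -
  have "returning e"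
  proof (rule ccontr)
    assume nr: "\<not> returning e"
    obtain \<alpha> k where \<alpha>: "link \<alpha>" "k < length \<alpha>" "e = \<alpha> ! k" by (rule arc_cases[OF assms(1) nr])
    then have "k = 0" using link_tail_on_cycle[of \<alpha> k] on_cycle_pqr assms(2) by simp
    then have "e = hd \<alpha>" using hd_nth[OF \<alpha>(1)] \<alpha>(3) by simp
    then show False using assms(2) by (cases rule: link_cases[OF \<alpha>(1)]) auto
  qed
  moreover have "returning (cr i)" "tail G (cr i) = r i" using cr by simp_all
  ultimately show ?thesis using returning_tail_unique assms(2) by simp
qed

lemma adj_eq_head:
  assumes "\<And>e. e \<in> arcs G \<Longrightarrow> head G e = v \<Longrightarrow> e = e0" "e0 \<in> arcs G" "head G e0 = v"
  shows "adj G u v = of_bool (u = tail G e0)"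
proof -
  have "{e \<in> arcs G. tail G e = u \<and> head G e = v} = (if u = tail G e0 then {e0} else {})"
    (is "?L = ?R")
  proof (intro equalityI subsetI)
    fix e assume e: "e \<in> ?L"
    then have "e = e0" by (intro assms(1)) simp_all
    then show "e \<in> ?R" using e by simp
  next
    fix e assume "e \<in> ?R"
    then show "e \<in> ?L" using assms(2,3) by (simp split: if_splits)
  qed
  then show ?thesis by (simp add: adj_def)
qed

lemma adj_eq_tail:
  assumes "\<And>e. e \<in> arcs G \<Longrightarrow> tail G e = u \<Longrightarrow> e = e0" "e0 \<in> arcs G" "tail G e0 = u"
  shows "adj G u v = of_bool (v = head G e0)"
proof -
  have "{e \<in> arcs G. tail G e = u \<and> head G e = v} = (if v = head G e0 then {e0} else {})"
    (is "?L = ?R")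
  proof (intro equalityI subsetI)
    fix e assume e: "e \<in> ?L"
    then have "e = e0" by (intro assms(1)) simp_all
    then show "e \<in> ?R" using e by simp
  next
    fix e assume "e \<in> ?R"
    then show "e \<in> ?L" using assms(2,3) by (simp split: if_splits)
  qed
  then show ?thesis by (simp add: adj_def)
qed

text \<open>
  Interior vertices of links from \<open>P\<close> are merged into \<open>P\<close>, which works because no link enters
  \<open>P\<close>: its vertices have a single incoming arc. Those of links from \<open>Q\<close> to \<open>R\<close> are merged into \<open>R\<close>,
  which no link leaves. Neither is possible with \<open>Q\<close>.
\<close>

definition after_P :: "'a set" where
  "after_P = {s \<in> verts G. \<not> on_cycle G s \<and> \<not> cycle_trail G Q R (the_link s)}"

definition before_R :: "'a set" where
  "before_R = {s \<in> verts G. \<not> on_cycle G s \<and> cycle_trail G Q R (the_link s)}"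

text \<open>
  The vertex that is reached from the start of the link in as many steps along \<open>P\<close>.
\<close>

definition to_P :: "'a \<Rightarrow> 'a" where
  "to_P s = (if s \<in> after_P then p (Suc (depth s)) else s)"

text \<open>
  The vertex that needs as many steps along \<open>R\<close> to the end of the link. Going back \<open>k\<close> steps is
  going forward \<open>k * (length R - 1)\<close> steps.
\<close>

definition to_R :: "'a \<Rightarrow> 'a" where
  "to_R s = (if s \<in> before_R then r ((length (the_link s) - Suc (depth s)) * (length R - 1)) else s)"

lemma not_T [simp]: "on_cycle G s \<Longrightarrow> s \<notin> after_P" "on_cycle G s \<Longrightarrow> s \<notin> before_R" "s \<in> before_R \<Longrightarrow> s \<notin> after_P"
  by (auto simp: after_P_def before_R_def)

lemma to_P_to_R_on_cycle [simp]: "on_cycle G s \<Longrightarrow> to_P s = s" "on_cycle G s \<Longrightarrow> to_R s = s"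
  by (auto simp: to_P_def to_R_def)

lemma arc_in_arcs: "link \<alpha> \<Longrightarrow> k < length \<alpha> \<Longrightarrow> \<alpha> ! k \<in> arcs G"
  by (meson link_walk(3) nth_mem subsetD)

lemma to_P_tail:
  assumes "link \<alpha>" "\<not> cycle_trail G Q R \<alpha>" "k < length \<alpha>"
  shows "to_P (tail G (\<alpha> ! k)) = p k"
proof (cases k)
  case 0
  then have "tail G (\<alpha> ! k) = p 0" using hd_nth[OF assms(1)] assms(2) by (cases rule: link_cases[OF assms(1)]) auto
  then show ?thesis using 0 on_cycle_pqr by simp
next
  case (Suc j)
  then have "tail G (\<alpha> ! k) = head G (\<alpha> ! j)" using link_nth_Suc[OF assms(1)] assms(3) by simp
  moreover note the_link_eq[OF assms(1), of j]
  ultimately show ?thesis using Suc assms unfolding to_P_def after_P_def by simp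
qed

lemma to_P_tail_QR:
  assumes "cycle_trail G Q R \<alpha>" "k < length \<alpha>"
  shows "to_P (tail G (\<alpha> ! k)) = tail G (\<alpha> ! k)"
proof (cases k)
  case 0
  then have "tail G (\<alpha> ! k) = q 0" using hd_nth[of \<alpha>] ends_QR[OF assms(1)] by simp
  then show ?thesis using on_cycle_pqr by simp
next
  case (Suc j)
  then have "tail G (\<alpha> ! k) = head G (\<alpha> ! j)" using link_nth_Suc ends_QR(1)[OF assms(1)] assms(2) by simp
  moreover note the_link_eq[OF ends_QR(1)[OF assms(1)], of j]
  ultimately show ?thesis using Suc assms unfolding to_P_def after_P_def by simp
qed

lemma to_R_head:
  assumes "cycle_trail G Q R \<alpha>" "k < length \<alpha>"
  shows "to_R (head G (\<alpha> ! k)) = r ((length \<alpha> - Suc k) * (length R - 1))" "head G (\<alpha> ! k) \<notin> after_P"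
proof -
  note l = ends_QR(1)[OF assms(1)]
  have "to_R (head G (\<alpha> ! k)) = r ((length \<alpha> - Suc k) * (length R - 1)) \<and> head G (\<alpha> ! k) \<notin> after_P"
  proof (cases "Suc k = length \<alpha>")
    case True
    then have "head G (\<alpha> ! k) = r 0" using last_nth[OF l] ends_QR(3)[OF assms(1)] by (simp flip: True)
    then show ?thesis using True on_cycle_pqr by simp
  next
    case False
    then have "Suc k < length \<alpha>" using assms(2) by simp
    then show ?thesis using the_link_eq[OF l] assms(1) unfolding to_R_def after_P_def before_R_def by simp
  qed
  then show "to_R (head G (\<alpha> ! k)) = r ((length \<alpha> - Suc k) * (length R - 1))" "head G (\<alpha> ! k) \<notin> after_P" by auto
qed

lemma collapse_after_P:
  "sse_on (verts G) (adj G) (verts G - after_P) (\<lambda>i k. \<Sum>j\<in>{j\<in>verts G. to_P j = i}. adj G j k)"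
proof -
  define pre where "pre s = tail G (the_link s ! depth s)" for s
  have after_P: "link (the_link s)" "Suc (depth s) < length (the_link s)"
    "head G (the_link s ! depth s) = s" "\<not> cycle_trail G Q R (the_link s)"
    "the_link s ! depth s \<in> arcs G" "\<not> on_cycle G s"
    if "s \<in> after_P" for s
    using that the_link[of s] arc_in_arcs unfolding after_P_def by auto
  have to_P_pre: "to_P (pre s) = p (depth s)" if "s \<in> after_P" for s
    unfolding pre_def using to_P_tail[OF after_P(1)[OF that] after_P(4)[OF that]] after_P(2)[OF that] by simp
  show ?thesis
  proof (rule sse_on_collapse_columns[where pre = pre and d = depth])
    show "finite (verts G)" "after_P \<subseteq> verts G" by (auto simp: after_P_def)
    show "to_P v = v" if "v \<in> verts G - after_P" for v using that by (simp add: to_P_def)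
    show "to_P s \<in> verts G - after_P" if "s \<in> after_P" for s
      using that on_cycle_pqr verts_pqr by (simp add: to_P_def)
    show "pre s \<in> verts G" if "s \<in> after_P" for s using after_P(5)[OF that] by (simp add: pre_def)
    show "depth (pre s) < depth s" if "s \<in> after_P" "pre s \<in> after_P" for s
    proof -
      let ?\<alpha> = "the_link s"
      have "depth s \<noteq> 0"
        using link_tail_on_cycle[OF after_P(1)[OF that(1)], of "depth s"] after_P(2)[OF that(1)] after_P(6)[OF that(2), unfolded pre_def]
        by simp
      then obtain j where j: "depth s = Suc j" by (cases "depth s") auto
      then have "pre s = head G (?\<alpha> ! j)" unfolding pre_def
        using link_nth_Suc[OF after_P(1)[OF that(1)], of j] after_P(2)[OF that(1)] by simp
      then show ?thesis using the_link_eq(3)[OF after_P(1)[OF that(1)], of j] after_P(2)[OF that(1)] j by simp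
    qed
    show "adj G i s = of_bool (i = pre s)" if s: "s \<in> after_P" for s i
      unfolding pre_def
    proof (rule adj_eq_head)
      show "e = the_link s ! depth s" if "e \<in> arcs G" "head G e = s" for e
        using in_arc_interior[OF that(1)] after_P(6)[OF s] that(2) by simp
    qed (use after_P(3,5)[OF s] in simp_all)
    show "adj G i (to_P s) = of_bool (i = to_P (pre s))" if "s \<in> after_P" for s i
    proof -
      have "adj G i (p (Suc (depth s))) = of_bool (i = tail G (cp (depth s)))"
        using cp[of "depth s"] by (intro adj_eq_head in_arc_P) (simp_all add: returning_def)
      then show ?thesis using to_P_pre that cp by (simp add: to_P_def)
    qed
    show "verts G \<noteq> {}" using verts_pqr(1)[of 0] by blast
  qed
qed

lemma collapse_before_R:
  "sse_on (verts G - after_P) (\<lambda>i k. \<Sum>j\<in>{j\<in>verts G. to_P j = i}. adj G j k)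
     (verts G - after_P - before_R) (\<lambda>i k. \<Sum>j'\<in>{j'\<in>verts G - after_P. to_R j' = k}. \<Sum>j\<in>{j\<in>verts G. to_P j = i}. adj G j j')"
proof -
  define nxt where "nxt s = head G (the_link s ! Suc (depth s))" for s
  have before_R: "link (the_link s)" "Suc (depth s) < length (the_link s)"
    "tail G (the_link s ! Suc (depth s)) = s" "cycle_trail G Q R (the_link s)"
    "the_link s ! Suc (depth s) \<in> arcs G" "\<not> on_cycle G s" "s \<in> verts G"
    if "s \<in> before_R" for s
    using that the_link[of s] arc_in_arcs unfolding before_R_def by auto
  have to_R_nxt: "to_R (nxt s) = r ((length (the_link s) - Suc (Suc (depth s))) * (length R - 1))"
    "nxt s \<notin> after_P" if "s \<in> before_R" for s
    unfolding nxt_def using to_R_head[OF before_R(4)[OF that] before_R(2)[OF that]] by simp_all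
  have row: "(\<Sum>j\<in>{j\<in>verts G. to_P j = v}. adj G j k) = adj G v k" if v: "v \<in> verts G" "v \<notin> after_P" "v \<notin> VP" for v k
  proof -
    have "{j\<in>verts G. to_P j = v} = {v}" using v in_VP by (auto simp: to_P_def)
    then show ?thesis by simp
  qed
  show ?thesis
  proof (rule sse_on_collapse_rows[where nxt = nxt and d = "\<lambda>s. length (the_link s) - depth s"])
    show "finite (verts G - after_P)" "before_R \<subseteq> verts G - after_P" by (auto simp: before_R_def after_P_def)
    show "to_R v = v" if "v \<in> verts G - after_P - before_R" for v using that by (simp add: to_R_def)
    show "to_R s \<in> verts G - after_P - before_R" if "s \<in> before_R" for s
      using that verts_pqr on_cycle_pqr by (simp add: to_R_def)
    show "nxt s \<in> verts G - after_P" if "s \<in> before_R" for s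
      using before_R(5)[OF that] to_R_nxt(2)[OF that] by (simp add: nxt_def)
    show "length (the_link (nxt s)) - depth (nxt s) < length (the_link s) - depth s"
      if "s \<in> before_R" "nxt s \<in> before_R" for s
    proof -
      have "Suc (Suc (depth s)) \<noteq> length (the_link s)"
        using link_head_on_cycle[OF before_R(1,2)[OF that(1)]] before_R(6)[OF that(2)] unfolding nxt_def by auto
      then have "Suc (Suc (depth s)) < length (the_link s)" using before_R(2)[OF that(1)] by simp
      then show ?thesis using the_link_eq(2,3)[OF before_R(1)[OF that(1)], of "Suc (depth s)"]
        unfolding nxt_def by simp
    qed
    show "(\<Sum>j\<in>{j\<in>verts G. to_P j = s}. adj G j i) = of_bool (i = nxt s)" if "s \<in> before_R" for s i
    proof -
      have "adj G s i = of_bool (i = nxt s)" unfolding nxt_def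
      proof (rule adj_eq_tail)
        show "e = the_link s ! Suc (depth s)" if "e \<in> arcs G" "tail G e = s" for e
          using out_arc_interior[OF that(1)] before_R(6)[OF \<open>s \<in> before_R\<close>] that(2) by simp
      qed (use before_R(3,5)[OF that] in simp_all)
      moreover have "s \<notin> VP" using before_R(6)[OF that] on_cycle_iff_in by blast
      ultimately show ?thesis using row[of s i] before_R(7)[OF that] that by simp
    qed
    show "(\<Sum>j\<in>{j\<in>verts G. to_P j = to_R s}. adj G j i) = of_bool (i = to_R (nxt s))" if "s \<in> before_R" for s i
    proof -
      let ?m = "length (the_link s) - Suc (Suc (depth s))" and ?z = "length R"
      have m: "length (the_link s) - Suc (depth s) = Suc ?m" using before_R(2)[OF that] by simp
      have l: "to_R s = r (Suc ?m * (?z - 1))" using that unfolding to_R_def m by simp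
      have "adj G (r (Suc ?m * (?z - 1))) i = of_bool (i = head G (cr (Suc ?m * (?z - 1))))"
        using cr[of "Suc ?m * (?z - 1)"] by (intro adj_eq_tail out_arc_R) (simp_all add: returning_def)
      also have "head G (cr (Suc ?m * (?z - 1))) = r (Suc (Suc ?m * (?z - 1)))" using cr by simp
      also have "Suc (Suc ?m * (?z - 1)) = ?m * (?z - 1) + ?z" using length_pos(3) by (cases ?z) auto
      also have "r (?m * (?z - 1) + ?z) = r (?m * (?z - 1))" by (simp add: r_eq)
      also have "\<dots> = to_R (nxt s)" using to_R_nxt(1)[OF that] by simp
      finally have "adj G (to_R s) i = of_bool (i = to_R (nxt s))" unfolding l .
      moreover have "to_R s \<notin> VP" using l in_VR cycle_verts_disjoint by metis
      ultimately show ?thesis using row[of "to_R s" i] l verts_pqr on_cycle_pqr by simp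
    qed
    show "verts G - after_P \<noteq> {}" using verts_pqr(3)[of 0] on_cycle_pqr by force
  qed
qed

text \<open>
  The arcs that are counted at the entry \<open>(i, k)\<close> of the matrix after both collapses. An arc into a
  vertex merged into \<open>P\<close> has disappeared, since the column of that vertex has.
\<close>

definition merged_arcs :: "'a \<Rightarrow> 'a \<Rightarrow> 'b set" where
  "merged_arcs i k = {e \<in> arcs G. to_P (tail G e) = i \<and> head G e \<notin> after_P \<and> to_R (head G e) = k}"

lemma sse_on_merged:
  "sse_on (verts G) (adj G) (VP \<union> VQ \<union> VR) (\<lambda>i k. card (merged_arcs i k))"
proof -
  have "verts G - after_P - before_R = VP \<union> VQ \<union> VR"
  proof -
    have "VP \<union> VQ \<union> VR \<subseteq> verts G"
      using on_cycle_iff_in on_cycle_in_verts by blast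
    then show ?thesis using on_cycle_iff_in by (auto simp: after_P_def before_R_def)
  qed
  moreover have "(\<Sum>j'\<in>{j'\<in>verts G - after_P. to_R j' = k}. \<Sum>j\<in>{j\<in>verts G. to_P j = i}. adj G j j') = card (merged_arcs i k)"
    for i k
    by (subst sum_adj) (auto simp: merged_arcs_def intro!: arg_cong[where f = card])
  ultimately show ?thesis
    using sse_on_trans[OF collapse_after_P collapse_before_R] by simp
qed

end

definition trails :: "('a, 'b) pre_digraph \<Rightarrow> 'b list \<Rightarrow> 'b list \<Rightarrow> 'b list set" where
  "trails G A B = {\<alpha>. cycle_trail G A B \<alpha>}"

text \<open>
  What is left of a trail of length \<open>n\<close> whose interior is merged into \<open>A\<close>: its last arc, issuing
  from the vertex \<open>n - 1\<close> steps after the base vertex of \<open>A\<close>.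
\<close>

definition forward_mset :: "('a, 'b) pre_digraph \<Rightarrow> 'b list \<Rightarrow> 'b list \<Rightarrow> (nat \<times> nat) multiset" where
  "forward_mset G A B = image_mset (\<lambda>\<alpha>. (length \<alpha> - 1, 0)) (mset_set (trails G A B))"

text \<open>
  What is left of a trail of length \<open>n\<close> whose interior is merged into \<open>B\<close>: its first arc, ending
  \<open>n - 1\<close> steps before the base vertex of \<open>B\<close>.
\<close>

definition backward_mset :: "('a, 'b) pre_digraph \<Rightarrow> 'b list \<Rightarrow> 'b list \<Rightarrow> (nat \<times> nat) multiset" where
  "backward_mset G A B = image_mset (\<lambda>\<alpha>. (0, (length \<alpha> - 1) * (length B - 1))) (mset_set (trails G A B))"

context meteor3_digraph
begin

text \<open>
  In particular the links are finite in number, and sets of links can be counted by their first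
  or last arcs.
\<close>

lemma link_eq_if_same_end:
  assumes "link \<alpha>" "link \<beta>"
  shows "hd \<alpha> = hd \<beta> \<Longrightarrow> \<alpha> = \<beta>" "last \<alpha> = last \<beta> \<Longrightarrow> \<alpha> = \<beta>"
proof -
  note ne = link_walk(1)[OF assms(1)] link_walk(1)[OF assms(2)]
  have "hd \<alpha> \<in> set \<alpha>" "hd \<beta> \<in> set \<beta>" "last \<alpha> \<in> set \<alpha>" "last \<beta> \<in> set \<beta>" using ne by auto
  then show "hd \<alpha> = hd \<beta> \<Longrightarrow> \<alpha> = \<beta>" "last \<alpha> = last \<beta> \<Longrightarrow> \<alpha> = \<beta>"
    using link_unique_arc[OF assms] by auto
qed

lemma finite_links: "finite {\<alpha>. link \<alpha>}"
proof (rule inj_on_finite[of hd _ "arcs G"])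
  show "inj_on hd {\<alpha>. link \<alpha>}" using link_eq_if_same_end(1) by (intro inj_onI) simp
  have "hd \<alpha> \<in> arcs G" if "link \<alpha>" for \<alpha> using link_walk(1,3)[OF that] hd_in_set by blast
  then show "hd ` {\<alpha>. link \<alpha>} \<subseteq> arcs G" by blast
qed simp

end

lemma (in meteor3_digraph) finite_trails:
  "finite (trails G P Q)" "finite (trails G Q R)" "finite (trails G P R)"
  using finite_links by (auto simp: trails_def link_def elim: rev_finite_subset)

context meteor3_enumerated
begin

lemma to_R_eq_iff [simp]: "to_R v = p j \<longleftrightarrow> v = p j" "to_R v = q j \<longleftrightarrow> v = q j"
  using on_cycle_pqr by (auto simp: to_R_def)

lemma to_P_eq_iff [simp]: "to_P v = q j \<longleftrightarrow> v = q j" "to_P v = r j \<longleftrightarrow> v = r j"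
  using on_cycle_pqr by (auto simp: to_P_def)

lemma returning_merged:
  assumes "returning e" "e \<in> merged_arcs u v"
  shows "tail G e = u" "head G e = v"
  using assms returning_on_cycle[OF assms(1)] unfolding merged_arcs_def by auto

lemma no_arc_up: "e \<in> arcs G \<Longrightarrow> \<not> (tail G e = q i \<and> head G e = p j)"
  "e \<in> arcs G \<Longrightarrow> \<not> (tail G e = r i \<and> head G e = p j)"
  "e \<in> arcs G \<Longrightarrow> \<not> (tail G e = r i \<and> head G e = q j)"
  using arc_reachable[of e] not_up(1)[OF in_VP[of j] in_VQ[of i]] not_up(3)[OF in_VP[of j] in_VR[of i]]
    not_up(2)[OF in_VQ[of j] in_VR[of i]] by auto

lemma p_pred: "\<exists>j'. p j = p (Suc j')"
proof -
  have "Suc (j + (length P - 1)) = j + length P" using length_pos by simp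
  moreover have "p j = p (j + length P)" by (simp add: p_eq)
  ultimately show ?thesis by metis
qed

lemma card_merged_pp: "card (merged_arcs (p i) (p j)) = of_bool (p j = p (Suc i))"
proof (cases "p j = p (Suc i)")
  case True
  have "merged_arcs (p i) (p j) = {cp i}"
  proof (intro equalityI subsetI)
    fix e assume "e \<in> merged_arcs (p i) (p j)"
    then show "e \<in> {cp i}" using in_arc_P[of e i] True by (simp add: merged_arcs_def)
  next
    fix e assume "e \<in> {cp i}"
    then show "e \<in> merged_arcs (p i) (p j)"
      using cp[of i] True on_cycle_pqr unfolding merged_arcs_def returning_def by simp
  qed
  then show ?thesis using True by simp
next
  case False
  have "e \<notin> merged_arcs (p i) (p j)" for e
  proof
    assume e: "e \<in> merged_arcs (p i) (p j)"
    obtain j' where j': "p j = p (Suc j')" using p_pred by blast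
    then have "e = cp j'" using e in_arc_P[of e j'] by (simp add: merged_arcs_def)
    then have "p j' = p i" using e cp[of j'] on_cycle_pqr by (simp add: merged_arcs_def)
    then have "p (Suc j') = p (Suc i)" unfolding p_eq by (metis mod_Suc_eq)
    then show False using False j' by simp
  qed
  then have "merged_arcs (p i) (p j) = {}" by blast
  then show ?thesis using False by simp
qed

lemma card_merged_rr: "card (merged_arcs (r i) (r j)) = of_bool (r j = r (Suc i))"
proof -
  have "merged_arcs (r i) (r j) = (if r j = r (Suc i) then {cr i} else {})" (is "?L = ?R")
  proof (intro equalityI subsetI)
    fix e assume e: "e \<in> ?L"
    then have "e = cr i" using out_arc_R[of e i] by (simp add: merged_arcs_def)
    then show "e \<in> ?R" using e cr[of i] on_cycle_pqr by (simp add: merged_arcs_def)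
  next
    fix e assume "e \<in> ?R"
    then have "e = cr i" "r j = r (Suc i)" by (auto split: if_splits)
    then show "e \<in> ?L" using cr[of i] on_cycle_pqr unfolding merged_arcs_def returning_def by simp
  qed
  then show ?thesis by simp
qed

lemma card_merged_qq: "card (merged_arcs (q i) (q j)) = of_bool (q j = q (Suc i))"
proof -
  have "merged_arcs (q i) (q j) = (if q j = q (Suc i) then {cq i} else {})" (is "?L = ?R")
  proof (intro equalityI subsetI)
    fix e assume e: "e \<in> ?L"
    then have e': "e \<in> arcs G" "tail G e = q i" "head G e = q j" by (auto simp: merged_arcs_def)
    have "returning e"
    proof (rule ccontr)
      assume nr: "\<not> returning e"
      obtain \<alpha> k where \<alpha>: "link \<alpha>" "k < length \<alpha>" "e = \<alpha> ! k" by (rule arc_cases[OF e'(1) nr])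
      then have k: "k = 0" "Suc k = length \<alpha>"
        using link_tail_on_cycle[of \<alpha> k] link_head_on_cycle[of \<alpha> k] on_cycle_pqr e' by auto
      then have "hd \<alpha> = e" "last \<alpha> = e" using hd_nth[OF \<alpha>(1)] last_nth[OF \<alpha>(1)] \<alpha>(3) by (auto simp flip: k(2))
      then show False using e' by (cases rule: link_cases[OF \<alpha>(1)]) auto
    qed
    then have "e = cq i" using returning_tail_unique[of e "cq i"] cq[of i] e' by simp
    then show "e \<in> ?R" using e' cq[of i] by simp
  next
    fix e assume "e \<in> ?R"
    then have "e = cq i" "q j = q (Suc i)" by (auto split: if_splits)
    then show "e \<in> ?L" using cq[of i] on_cycle_pqr unfolding merged_arcs_def returning_def by simp
  qed
  then show ?thesis by simp
qed

lemma card_merged_up: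
  "card (merged_arcs (q i) (p j)) = 0" "card (merged_arcs (r i) (p j)) = 0" "card (merged_arcs (r i) (q j)) = 0"
proof -
  have "merged_arcs (q i) (p j) = {}" "merged_arcs (r i) (p j) = {}" "merged_arcs (r i) (q j) = {}"
    using no_arc_up unfolding merged_arcs_def by auto
  then show "card (merged_arcs (q i) (p j)) = 0" "card (merged_arcs (r i) (p j)) = 0" "card (merged_arcs (r i) (q j)) = 0"
    by simp_all
qed

lemma link_nth_merged:
  assumes "link \<alpha>" "\<not> cycle_trail G Q R \<alpha>" "k < length \<alpha>"
  shows "\<alpha> ! k \<in> merged_arcs u v \<longleftrightarrow> Suc k = length \<alpha> \<and> p k = u \<and> head G (last \<alpha>) = v"
proof (cases "Suc k = length \<alpha>")
  case True
  then have "last \<alpha> = \<alpha> ! k" using last_nth[OF assms(1)] by (simp flip: True)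
  moreover have "on_cycle G (head G (\<alpha> ! k))" using link_head_on_cycle[OF assms(1,3)] True by simp
  ultimately show ?thesis using True to_P_tail[OF assms] arc_in_arcs[OF assms(1,3)] by (auto simp: merged_arcs_def)
next
  case False
  then have "Suc k < length \<alpha>" using assms(3) by simp
  then have "head G (\<alpha> ! k) \<in> after_P" using the_link_eq[OF assms(1)] assms(2) unfolding after_P_def by simp
  then show ?thesis using False by (simp add: merged_arcs_def)
qed

lemma QR_nth_merged:
  assumes "cycle_trail G Q R \<alpha>" "k < length \<alpha>"
  shows "\<alpha> ! k \<in> merged_arcs u v \<longleftrightarrow> tail G (\<alpha> ! k) = u \<and> r ((length \<alpha> - Suc k) * (length R - 1)) = v"
  using to_P_tail_QR[OF assms] to_R_head[OF assms] arc_in_arcs[OF ends_QR(1)[OF assms(1)] assms(2)]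
  by (simp add: merged_arcs_def)

text \<open>
  Among the arcs of a link from \<open>P\<close>, exactly the last one has its head outside the merged part,
  and an arc of a link from \<open>Q\<close> to \<open>R\<close> never has its tail merged into \<open>P\<close>.
\<close>

lemma card_merged_from_P:
  assumes T: "\<And>\<alpha>. \<alpha> \<in> T \<longleftrightarrow> link \<alpha> \<and> tail G (hd \<alpha>) = p 0 \<and> head G (last \<alpha>) = w 0"
    and w: "w = q \<or> w = r"
  shows "card (merged_arcs (p i) (w j)) = card {\<alpha>\<in>T. p (length \<alpha> - 1) = p i \<and> w 0 = w j}"
proof -
  have nQR: "\<not> cycle_trail G Q R \<alpha>" if "tail G (hd \<alpha>) = p k" for \<alpha> k using ends_QR(2)[of \<alpha>] that by auto
  have "bij_betw last {\<alpha>\<in>T. p (length \<alpha> - 1) = p i \<and> w 0 = w j} (merged_arcs (p i) (w j))"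
  proof (rule bij_betw_imageI)
    show "inj_on last {\<alpha>\<in>T. p (length \<alpha> - 1) = p i \<and> w 0 = w j}"
    proof (rule inj_onI)
      fix \<alpha> \<beta> assume "\<alpha> \<in> {\<alpha>\<in>T. p (length \<alpha> - 1) = p i \<and> w 0 = w j}"
        "\<beta> \<in> {\<alpha>\<in>T. p (length \<alpha> - 1) = p i \<and> w 0 = w j}" "last \<alpha> = last \<beta>"
      then show "\<alpha> = \<beta>" using link_eq_if_same_end(2) T by blast
    qed
    show "last ` {\<alpha>\<in>T. p (length \<alpha> - 1) = p i \<and> w 0 = w j} = merged_arcs (p i) (w j)"
    proof (intro equalityI subsetI)
      fix e assume "e \<in> last ` {\<alpha>\<in>T. p (length \<alpha> - 1) = p i \<and> w 0 = w j}"
      then obtain \<alpha> where \<alpha>: "\<alpha> \<in> T" "p (length \<alpha> - 1) = p i" "w 0 = w j" "e = last \<alpha>" by blast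
      then have l: "link \<alpha>" "tail G (hd \<alpha>) = p 0" "head G (last \<alpha>) = w 0" using T by auto
      have "length \<alpha> - 1 < length \<alpha>" using link_walk(1)[OF l(1)] by (cases \<alpha>) auto
      then show "e \<in> merged_arcs (p i) (w j)"
        using link_nth_merged[OF l(1) nQR[OF l(2)], of "length \<alpha> - 1"] \<alpha>(2,3,4) l(3) last_nth[OF l(1)] by simp
    next
      fix e assume e: "e \<in> merged_arcs (p i) (w j)"
      have nr: "\<not> returning e"
      proof
        assume r: "returning e"
        then have "tail G e = p i" "head G e = w j" using returning_merged e by auto
        moreover have "head G e \<rightarrow>\<^sup>* tail G e" using r by (simp add: returning_def)
        ultimately show False using w not_up(1)[OF in_VP[of i] in_VQ[of j]] not_up(3)[OF in_VP[of i] in_VR[of j]]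
          by (elim disjE) simp_all
      qed
      have "e \<in> arcs G" using e by (simp add: merged_arcs_def)
      then obtain \<alpha> k where \<alpha>: "link \<alpha>" "k < length \<alpha>" "e = \<alpha> ! k" using nr by (rule arc_cases)
      show "e \<in> last ` {\<alpha>\<in>T. p (length \<alpha> - 1) = p i \<and> w 0 = w j}"
      proof (cases rule: link_cases[OF \<alpha>(1)])
        case 3
        then have "tail G (\<alpha> ! k) = p i" using e QR_nth_merged[OF 3(1) \<alpha>(2)] \<alpha>(3) by simp
        then have "k = 0" using link_tail_on_cycle[OF \<alpha>(1,2)] on_cycle_pqr by simp
        then show ?thesis using \<open>tail G (\<alpha> ! k) = p i\<close> 3(2) hd_nth[OF \<alpha>(1)] by simp
      next
        case 1
        then have k: "Suc k = length \<alpha>" "p k = p i" "head G (last \<alpha>) = w j"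
          using e link_nth_merged[OF \<alpha>(1) 1(4) \<alpha>(2)] \<alpha>(3) by auto
        then have "w = q" using 1(3) w by auto
        then have "\<alpha> \<in> T" "w 0 = w j" using T[of \<alpha>] \<alpha>(1) 1 k(3) by auto
        moreover have "e = last \<alpha>" using last_nth[OF \<alpha>(1)] \<alpha>(3) by (simp flip: k(1))
        ultimately show ?thesis using k(2) by (intro image_eqI[of _ _ \<alpha>]) (auto simp flip: k(1))
      next
        case 2
        then have k: "Suc k = length \<alpha>" "p k = p i" "head G (last \<alpha>) = w j"
          using e link_nth_merged[OF \<alpha>(1) 2(4) \<alpha>(2)] \<alpha>(3) by auto
        then have "w = r" using 2(3) w by auto
        then have "\<alpha> \<in> T" "w 0 = w j" using T[of \<alpha>] \<alpha>(1) 2 k(3) by auto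
        moreover have "e = last \<alpha>" using last_nth[OF \<alpha>(1)] \<alpha>(3) by (simp flip: k(1))
        ultimately show ?thesis using k(2) by (intro image_eqI[of _ _ \<alpha>]) (auto simp flip: k(1))
      qed
    qed
  qed
  from bij_betw_same_card[OF this] show ?thesis by simp
qed

lemma trails_PQ_iff: "\<alpha> \<in> trails G P Q \<longleftrightarrow> link \<alpha> \<and> tail G (hd \<alpha>) = p 0 \<and> head G (last \<alpha>) = q 0"
proof
  assume "\<alpha> \<in> trails G P Q"
  then show "link \<alpha> \<and> tail G (hd \<alpha>) = p 0 \<and> head G (last \<alpha>) = q 0"
    using ends_PQ[of \<alpha>] by (simp add: trails_def)
next
  assume a: "link \<alpha> \<and> tail G (hd \<alpha>) = p 0 \<and> head G (last \<alpha>) = q 0"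
  then have "link \<alpha>" ..
  then show "\<alpha> \<in> trails G P Q"
    by (cases rule: link_cases) (use a in \<open>auto simp: trails_def\<close>)
qed

lemma trails_PR_iff: "\<alpha> \<in> trails G P R \<longleftrightarrow> link \<alpha> \<and> tail G (hd \<alpha>) = p 0 \<and> head G (last \<alpha>) = r 0"
proof
  assume "\<alpha> \<in> trails G P R"
  then show "link \<alpha> \<and> tail G (hd \<alpha>) = p 0 \<and> head G (last \<alpha>) = r 0"
    using ends_PR[of \<alpha>] by (simp add: trails_def)
next
  assume a: "link \<alpha> \<and> tail G (hd \<alpha>) = p 0 \<and> head G (last \<alpha>) = r 0"
  then have "link \<alpha>" ..
  then show "\<alpha> \<in> trails G P R"
    by (cases rule: link_cases) (use a in \<open>auto simp: trails_def\<close>)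
qed

text \<open>
  Among the arcs of a link from \<open>Q\<close>, exactly the first one has its tail on a cycle.
\<close>

lemma card_merged_QR:
  "card (merged_arcs (q i) (r j)) = card {\<alpha>\<in>trails G Q R. q 0 = q i \<and> r ((length \<alpha> - 1) * (length R - 1)) = r j}"
    (is "_ = card ?T")
proof -
  have nonempty: "0 < length \<alpha>" if "\<alpha> \<in> trails G Q R" for \<alpha>
    using that unfolding trails_def cycle_trail_def by auto
  have hd0: "hd \<alpha> = \<alpha> ! 0" "link \<alpha>" "tail G (hd \<alpha>) = q 0" "cycle_trail G Q R \<alpha>" if "\<alpha> \<in> trails G Q R" for \<alpha>
    using that hd_nth ends_QR unfolding trails_def by auto
  have "bij_betw hd ?T (merged_arcs (q i) (r j))"
  proof (rule bij_betw_imageI)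
    show "inj_on hd ?T"
    proof (rule inj_onI)
      fix \<alpha> \<beta> assume "\<alpha> \<in> ?T" "\<beta> \<in> ?T" "hd \<alpha> = hd \<beta>"
      then show "\<alpha> = \<beta>" using link_eq_if_same_end(1) hd0(2) by blast
    qed
    show "hd ` ?T = merged_arcs (q i) (r j)"
    proof (intro equalityI subsetI)
      fix e assume "e \<in> hd ` ?T"
      then obtain \<alpha> where \<alpha>: "\<alpha> \<in> trails G Q R" "q 0 = q i" "r ((length \<alpha> - 1) * (length R - 1)) = r j" "e = hd \<alpha>"
        by blast
      then show "e \<in> merged_arcs (q i) (r j)"
        using QR_nth_merged[OF hd0(4)[OF \<alpha>(1)] nonempty[OF \<alpha>(1)]] hd0(1,3)[OF \<alpha>(1)] by simp
    next
      fix e assume e: "e \<in> merged_arcs (q i) (r j)"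
      then have e': "e \<in> arcs G" "tail G e = q i" by (auto simp: merged_arcs_def)
      have nr: "\<not> returning e"
      proof
        assume r: "returning e"
        then have "tail G e = q i" "head G e = r j" using returning_merged e by auto
        then show False using r not_up(2)[OF in_VQ[of i] in_VR[of j]] by (simp add: returning_def)
      qed
      obtain \<alpha> k where \<alpha>: "link \<alpha>" "k < length \<alpha>" "e = \<alpha> ! k" by (rule arc_cases[OF e'(1) nr])
      have k: "k = 0" using link_tail_on_cycle[OF \<alpha>(1,2)] on_cycle_pqr e' \<alpha>(3) by simp
      then have hd: "e = hd \<alpha>" using hd_nth[OF \<alpha>(1)] \<alpha>(3) by simp
      then have QR: "cycle_trail G Q R \<alpha>" "q 0 = q i" using e'(2) by (cases rule: link_cases[OF \<alpha>(1)]; simp)+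
      then show "e \<in> hd ` ?T" using e QR_nth_merged[OF QR(1) \<alpha>(2)] hd k \<alpha>(3) by (auto simp: trails_def)
    qed
  qed
  from bij_betw_same_card[OF this] show ?thesis by simp
qed

lemma p_eq_less: "j < length P \<Longrightarrow> p i = p j \<longleftrightarrow> j = i mod length P"
  "j < length P \<Longrightarrow> p j = p i \<longleftrightarrow> j = i mod length P"
  and q_eq_less: "j < length Q \<Longrightarrow> q i = q j \<longleftrightarrow> j = i mod length Q"
   "j < length Q \<Longrightarrow> q j = q i \<longleftrightarrow> j = i mod length Q"
  and r_eq_less: "j < length R \<Longrightarrow> r i = r j \<longleftrightarrow> j = i mod length R"
   "j < length R \<Longrightarrow> r j = r i \<longleftrightarrow> j = i mod length R"
  by (auto simp: p_eq q_eq r_eq)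

lemma sse_on_three_cycle_matrix:
  "sse_on (verts G) (adj G) nodes (three_cycle_matrix (forward_mset G P Q) (backward_mset G Q R) (forward_mset G P R))"
    (is "sse_on _ _ _ ?M")
proof -
  define f where "f = case_node p q r"
  have "bij_betw f nodes (VP \<union> VQ \<union> VR)"
  proof (rule bij_betw_imageI)
    show "inj_on f nodes"
    proof (rule inj_onI)
      fix a b assume "a \<in> nodes" "b \<in> nodes" "f a = f b"
      then show "a = b" by (elim nodes_cases) (auto simp: f_def p_eq_less q_eq_less r_eq_less)
    qed
    show "f ` nodes = VP \<union> VQ \<union> VR"
      by (simp add: nodes_def f_def image_Un image_image VP VQ VR)
  qed
  then have "sse_on nodes ?M (VP \<union> VQ \<union> VR) (\<lambda>i k. card (merged_arcs i k))"
  proof (rule sse_on_reindex[OF _ finite_nodes nodes_nonempty])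
    fix a b assume ab: "a \<in> nodes" "b \<in> nodes"
    have eq: "card (merged_arcs (p i) (q j)) = edge_count (length P) (length Q) (forward_mset G P Q) i j"
      if "i < length P" "j < length Q" for i j
      unfolding card_merged_from_P[of "trails G P Q" q, OF trails_PQ_iff disjI1[OF refl]]
        forward_mset_def edge_count_image_mset_set[OF finite_trails(1)]
      using that by (intro arg_cong[where f = card] Collect_cong) (auto simp: p_eq_less q_eq_less)
    have eq2: "card (merged_arcs (p i) (r j)) = edge_count (length P) (length R) (forward_mset G P R) i j"
      if "i < length P" "j < length R" for i j
      unfolding card_merged_from_P[of "trails G P R" r, OF trails_PR_iff disjI2[OF refl]]
        forward_mset_def edge_count_image_mset_set[OF finite_trails(3)]
      using that by (intro arg_cong[where f = card] Collect_cong) (auto simp: p_eq_less r_eq_less)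
    have eq3: "card (merged_arcs (q i) (r j)) = edge_count (length Q) (length R) (backward_mset G Q R) i j"
      if "i < length Q" "j < length R" for i j
      unfolding card_merged_QR backward_mset_def edge_count_image_mset_set[OF finite_trails(2)]
      using that by (intro arg_cong[where f = card] Collect_cong) (auto simp: q_eq_less r_eq_less)
    show "?M a b = card (merged_arcs (f a) (f b))"
      using ab by (elim nodes_cases)
        (simp_all add: f_def eq eq2 eq3 card_merged_pp card_merged_qq card_merged_rr card_merged_up
          p_eq_less q_eq_less r_eq_less)
  qed
  moreover have "finite (VP \<union> VQ \<union> VR)" unfolding VP VQ VR by simp
  ultimately show ?thesis using sse_on_trans[OF sse_on_merged] sse_on_sym by blast
qed

end

context meteor3_digraph
begin

lemma sse_on_three_cycles:
  "sse_on (verts G) (adj G) (three_cycles.nodes (length P) (length Q) (length R))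
     (three_cycles.three_cycle_matrix (length P) (length Q) (length R)
       (forward_mset G P Q) (backward_mset G Q R) (forward_mset G P R))"
proof -
  obtain p1 q1 r1 where v: "p1 \<in> VP" "q1 \<in> VQ" "r1 \<in> VR"
    and t: "\<And>\<alpha>. cycle_trail G P Q \<alpha> \<Longrightarrow> awalk p1 \<alpha> q1"
      "\<And>\<alpha>. cycle_trail G Q R \<alpha> \<Longrightarrow> awalk q1 \<alpha> r1"
      "\<And>\<alpha>. cycle_trail G P R \<alpha> \<Longrightarrow> awalk p1 \<alpha> r1"
    using nf unfolding normal_form_def by auto
  obtain p cp where p: "p 0 = p1" "\<And>i. returning (cp i) \<and> tail G (cp i) = p i \<and> head G (cp i) = p (Suc i)"
    "\<And>i j. p i = p j \<longleftrightarrow> i mod length P = j mod length P" "VP = p ` {..<length P}"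
    using cycle_enumeration[OF cycles(1) v(1)] by blast
  obtain q cq where q: "q 0 = q1" "\<And>i. returning (cq i) \<and> tail G (cq i) = q i \<and> head G (cq i) = q (Suc i)"
    "\<And>i j. q i = q j \<longleftrightarrow> i mod length Q = j mod length Q" "VQ = q ` {..<length Q}"
    using cycle_enumeration[OF cycles(2) v(2)] by blast
  obtain r cr where r: "r 0 = r1" "\<And>i. returning (cr i) \<and> tail G (cr i) = r i \<and> head G (cr i) = r (Suc i)"
    "\<And>i j. r i = r j \<longleftrightarrow> i mod length R = j mod length R" "VR = r ` {..<length R}"
    using cycle_enumeration[OF cycles(3) v(3)] by blast
  interpret meteor3_enumerated G P Q R p q r cp cq cr
    by unfold_locales (fact p q r t[folded p(1) q(1) r(1)])+
  show ?thesis by (rule sse_on_three_cycle_matrix)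
qed

end

section \<open>Trail counts and the equivalence of meteor graphs\<close>

lemma cycle_trail_nonempty: "\<alpha> \<in> trails G A B \<Longrightarrow> 0 < length \<alpha>"
  unfolding trails_def cycle_trail_def by auto

lemma path_class_forward: "0 < n \<Longrightarrow> path_class (n - 1, 0) = int n"
  by (simp add: path_class_def)

text \<open>
  Since \<open>-(n - 1) * (z - 1)\<close> is congruent to \<open>n - 1\<close> modulo \<open>z\<close>.
\<close>

lemma path_class_backward:
  assumes "0 < n" "0 < z" "g dvd z"
  shows "[path_class (0, (n - 1) * (z - 1)) = int n] (mod int g)"
proof -
  obtain n' z' where "n = Suc n'" "z = Suc z'" using assms(1,2) by (auto simp: gr0_conv_Suc)
  then have "path_class (0, (n - 1) * (z - 1)) - int n = - (int (n - 1) * int z)"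
    by (simp add: path_class_def algebra_simps)
  then show ?thesis using assms(3) by (simp add: cong_iff_dvd_diff)
qed

lemma class_count_image_mset_set:
  assumes "finite T" "\<And>\<alpha>. \<alpha> \<in> T \<Longrightarrow> [path_class (f \<alpha>) = int (length \<alpha>)] (mod int g)"
  shows "class_count g (image_mset f (mset_set T)) h = card {\<alpha>\<in>T. [int (length \<alpha>) = h] (mod int g)}"
proof -
  have "class_count g (image_mset f (mset_set T)) h = card {\<alpha>\<in>T. [path_class (f \<alpha>) = h] (mod int g)}"
    using assms(1) by (simp add: class_count_def filter_mset_image_mset filter_mset_mset_set)
  also have "{\<alpha>\<in>T. [path_class (f \<alpha>) = h] (mod int g)} = {\<alpha>\<in>T. [int (length \<alpha>) = h] (mod int g)}"
    using assms(2) cong_trans cong_sym by blast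
  finally show ?thesis .
qed

lemma class_count_forward:
  assumes "finite (trails G A B)"
  shows "class_count g (forward_mset G A B) h = card {\<alpha>\<in>trails G A B. [int (length \<alpha>) = h] (mod int g)}"
  unfolding forward_mset_def using assms
  by (rule class_count_image_mset_set) (metis path_class_forward cycle_trail_nonempty cong_refl)

lemma class_count_backward:
  assumes "finite (trails G A B)" "0 < length B" "g dvd length B"
  shows "class_count g (backward_mset G A B) h = card {\<alpha>\<in>trails G A B. [int (length \<alpha>) = h] (mod int g)}"
  unfolding backward_mset_def using assms(1)
  by (rule class_count_image_mset_set) (intro path_class_backward cycle_trail_nonempty assms)

lemma trail_count_eq:
  "trail_count G A B c = card {\<alpha>\<in>trails G A B. [int (length \<alpha>) = int c] (mod int (gcd (length A) (length B)))}"
  unfolding trail_count_def trails_def by (simp add: cong_int_iff)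

text \<open>
  The trail counts are indexed by the residues \<open>1, \<dots>, g\<close>, in which \<open>g\<close> takes the place of \<open>0\<close>.
\<close>

lemma residue_representative:
  fixes g n k :: nat
  assumes "0 < g" "k \<in> {1..g}"
  shows "(if n mod g = 0 then g else n mod g) = k \<longleftrightarrow> [n = k] (mod g)"
proof (cases "k = g")
  case True
  then show ?thesis using mod_less_divisor[OF assms(1), of n] by (auto simp: cong_def)
next
  case False
  then have "k mod g = k" "k \<noteq> 0" "k < g" using assms by auto
  then show ?thesis by (auto simp: cong_def)
qed

text \<open>
  Every length has exactly one representative between 1 and the gcd of the cycle lengths, so the
  sum counts each trail once.
\<close>

lemma trail_sum_eq:
  assumes "finite (trails G A B)" "0 < length A" "d dvd gcd (length A) (length B)"
  shows "trail_sum G d A B a = card {\<alpha>\<in>trails G A B. [int (length \<alpha>) = int a] (mod int d)}"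
proof -
  define g where "g = gcd (length A) (length B)"
  have g: "0 < g" "d dvd g" using assms by (auto simp: g_def)
  define S where "S = {\<alpha>\<in>trails G A B. [length \<alpha> = a] (mod d)}"
  define rep where "rep n = (if n mod g = 0 then g else n mod g)" for n :: nat
  define K where "K = {k \<in> {1..g}. [k = a] (mod d)}"
  have rep: "rep n \<in> {1..g}" "[n = rep n] (mod g)" for n
    using g(1) unfolding rep_def by (auto simp: cong_def less_imp_le)
  have "card S = (\<Sum>\<alpha>\<in>S. 1)" by simp
  also have "\<dots> = (\<Sum>k\<in>K. \<Sum>\<alpha>\<in>{\<alpha>\<in>S. rep (length \<alpha>) = k}. 1)"
  proof (rule sum.group[symmetric])
    show "finite S" "finite K" using assms(1) by (auto simp: S_def K_def)
    show "(\<lambda>\<alpha>. rep (length \<alpha>)) ` S \<subseteq> K"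
    proof (rule image_subsetI)
      fix \<alpha> assume "\<alpha> \<in> S"
      then have \<alpha>: "[length \<alpha> = a] (mod d)" by (simp add: S_def)
      have "[rep (length \<alpha>) = length \<alpha>] (mod d)"
        using rep(2) g(2) cong_dvd_modulus_nat cong_sym by blast
      then have "[rep (length \<alpha>) = a] (mod d)" using \<alpha> by (rule cong_trans)
      then show "rep (length \<alpha>) \<in> K" using rep(1) unfolding K_def by blast
    qed
  qed
  also have "\<dots> = (\<Sum>k\<in>K. trail_count G A B k)"
  proof (rule sum.cong)
    fix k assume k: "k \<in> K"
    have "{\<alpha>\<in>S. rep (length \<alpha>) = k} = {\<alpha>. cycle_trail G A B \<alpha> \<and> [length \<alpha> = k] (mod g)}"
    proof -
      have eq: "rep n = k \<longleftrightarrow> [n = k] (mod g)" for n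
        using residue_representative[OF g(1), of k n] k unfolding rep_def K_def by simp
      have "[n = a] (mod d)" if "[n = k] (mod g)" for n
      proof -
        have "[n = k] (mod d)" using that g(2) cong_dvd_modulus_nat by blast
        moreover have "[k = a] (mod d)" using k by (simp add: K_def)
        ultimately show ?thesis by (rule cong_trans)
      qed
      then show ?thesis unfolding eq S_def trails_def by blast
    qed
    then show "(\<Sum>\<alpha>\<in>{\<alpha>\<in>S. rep (length \<alpha>) = k}. 1) = trail_count G A B k"
      by (simp add: trail_count_def g_def)
  qed simp
  finally show ?thesis unfolding S_def trail_sum_def K_def g_def by (simp add: cong_int_iff)
qed

definition residue_mset :: "('a, 'b) pre_digraph \<Rightarrow> 'b list \<Rightarrow> 'b list \<Rightarrow> nat multiset" where
  "residue_mset G A B = image_mset (\<lambda>\<alpha>. length \<alpha> mod gcd (length A) (length B)) (mset_set (trails G A B))"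

text \<open>
  Equal trail counts say that the lengths modulo the gcd of the cycle lengths agree as multisets.
\<close>

lemma residue_mset_eq:
  assumes "finite (trails G A B)" "finite (trails H A' B')"
    "length A = length A'" "length B = length B'" "0 < length A"
    "\<And>c. c \<in> {1..gcd (length A) (length B)} \<Longrightarrow> trail_count G A B c = trail_count H A' B' c"
  shows "residue_mset G A B = residue_mset H A' B'"
proof (rule multiset_eqI)
  fix c
  define g where "g = gcd (length A) (length B)"
  have "0 < g" using assms by (simp add: g_def)
  have *: "count (residue_mset G A B) c = card {\<alpha>\<in>trails G A B. length \<alpha> mod g = c}"
    "count (residue_mset H A' B') c = card {\<alpha>\<in>trails H A' B'. length \<alpha> mod g = c}"
    unfolding residue_mset_def using assms by (simp_all add: count_image_mset_eq_card_vimage g_def)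
  show "count (residue_mset G A B) c = count (residue_mset H A' B') c"
  proof (cases "c < g")
    case False
    then have "n mod g \<noteq> c" for n :: nat using \<open>0 < g\<close> by (metis mod_less_divisor)
    then show ?thesis unfolding * by simp
  next
    case True
    define c' where "c' = (if c = 0 then g else c)"
    have "c' \<in> {1..g}" using True \<open>0 < g\<close> by (auto simp: c'_def)
    moreover have "n mod g = c \<longleftrightarrow> [n = c'] (mod g)" for n
      using True by (auto simp: c'_def cong_def)
    ultimately show ?thesis
      using assms(6)[of c'] assms(3,4) unfolding * by (simp add: trail_count_def trails_def g_def)
  qed
qed

lemma edge_count_image_cong:
  assumes "\<And>a. a \<in># A \<Longrightarrow> fst (f a) mod m = fst (f' a) mod m \<and> snd (f a) mod n = snd (f' a) mod n"
  shows "edge_count m n (image_mset f A) = edge_count m n (image_mset f' A)"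
proof (intro ext)
  fix i j
  have "filter_mset (\<lambda>a. fst (f a) mod m = i \<and> snd (f a) mod n = j) A
      = filter_mset (\<lambda>a. fst (f' a) mod m = i \<and> snd (f' a) mod n = j) A"
    using assms by (intro filter_mset_cong) auto
  then show "edge_count m n (image_mset f A) i j = edge_count m n (image_mset f' A) i j"
    by (simp add: edge_count_def filter_mset_image_mset)
qed

lemma pred_mod_eq:
  fixes n t x :: nat
  assumes "n mod x = t mod x" "0 < n" "0 < x"
  shows "(n - 1) mod x = (t + x - 1) mod x"
proof -
  have "[n - 1 + 1 = t + x - 1 + 1] (mod x)" using assms by (simp add: cong_def)
  then show ?thesis using cong_add_rcancel_nat[of "n - 1" 1 "t + x - 1" x] by (simp add: cong_def)
qed

lemma edge_count_forward:
  assumes "finite (trails G A B)" "0 < length A"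
    and "\<And>\<alpha>. \<alpha> \<in> trails G A B \<Longrightarrow> length \<alpha> mod length A = length \<alpha> mod gcd (length A) (length B)"
  shows "edge_count (length A) n (forward_mset G A B) =
    edge_count (length A) n (image_mset (\<lambda>t. (t + length A - 1, 0)) (residue_mset G A B))"
  unfolding forward_mset_def residue_mset_def image_mset.compositionality
proof (rule edge_count_image_cong)
  fix \<alpha> assume "\<alpha> \<in># mset_set (trails G A B)"
  then have \<alpha>: "\<alpha> \<in> trails G A B" using assms(1) by simp
  then have "length \<alpha> mod length A = length \<alpha> mod gcd (length A) (length B) mod length A"
    using assms(3) by (metis mod_mod_trivial)
  from pred_mod_eq[OF this cycle_trail_nonempty[OF \<alpha>] assms(2)]
  show "fst (length \<alpha> - 1, 0) mod length A =
     fst (((\<lambda>t. (t + length A - 1, 0)) \<circ> (\<lambda>\<alpha>. length \<alpha> mod gcd (length A) (length B))) \<alpha>) mod length A \<and>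
     snd (length \<alpha> - 1, 0) mod n =
     snd (((\<lambda>t. (t + length A - 1, 0)) \<circ> (\<lambda>\<alpha>. length \<alpha> mod gcd (length A) (length B))) \<alpha>) mod n"
    by simp
qed

lemma edge_count_backward:
  assumes "finite (trails G A B)" "0 < length B"
    and "\<And>\<alpha>. \<alpha> \<in> trails G A B \<Longrightarrow> length \<alpha> mod length B = length \<alpha> mod gcd (length A) (length B)"
  shows "edge_count n (length B) (backward_mset G A B) =
    edge_count n (length B) (image_mset (\<lambda>t. (0, (t + length B - 1) * (length B - 1))) (residue_mset G A B))"
  unfolding backward_mset_def residue_mset_def image_mset.compositionality
proof (rule edge_count_image_cong)
  fix \<alpha> assume "\<alpha> \<in># mset_set (trails G A B)"
  then have \<alpha>: "\<alpha> \<in> trails G A B" using assms(1) by simp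
  then have "length \<alpha> mod length B = length \<alpha> mod gcd (length A) (length B) mod length B"
    using assms(3) by (metis mod_mod_trivial)
  from pred_mod_eq[OF this cycle_trail_nonempty[OF \<alpha>] assms(2)]
  have "(length \<alpha> - 1) * (length B - 1) mod length B =
    (length \<alpha> mod gcd (length A) (length B) + length B - 1) * (length B - 1) mod length B"
    by (rule mod_mult_cong) simp
  then show "fst (0, (length \<alpha> - 1) * (length B - 1)) mod n =
     fst (((\<lambda>t. (0, (t + length B - 1) * (length B - 1))) \<circ> (\<lambda>\<alpha>. length \<alpha> mod gcd (length A) (length B))) \<alpha>) mod n \<and>
     snd (0, (length \<alpha> - 1) * (length B - 1)) mod length B =
     snd (((\<lambda>t. (0, (t + length B - 1) * (length B - 1))) \<circ> (\<lambda>\<alpha>. length \<alpha> mod gcd (length A) (length B))) \<alpha>) mod length B"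
    by simp
qed

text \<open>
  The last condition of the normal form determines the length modulo the product of the cycle
  lengths by the length modulo their gcd. Hence equal trail counts even give equal multisets of
  lengths modulo either cycle length.
\<close>

lemma normal_form_length_mod:
  assumes "normal_form G P Q R" "pre_digraph.cycle G A" "pre_digraph.cycle G B" "\<not> same_cycle A B"
    "0 < length A" "\<alpha> \<in> trails G A B"
  shows "length \<alpha> mod length A = length \<alpha> mod gcd (length A) (length B)"
    "0 < length B \<Longrightarrow> length \<alpha> mod length B = length \<alpha> mod gcd (length A) (length B)"
proof -
  define g where "g = gcd (length A) (length B)"
  define t where "t = length \<alpha> mod g"
  have "0 < g" using assms(5) by (simp add: g_def)
  then have t: "t < g" "[length \<alpha> = t] (mod g)" by (auto simp: t_def cong_def)
  have "[length \<alpha> = t] (mod (length A * length B))"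
    using assms t unfolding normal_form_def g_def trails_def by blast
  then have "[length \<alpha> = t] (mod length A)" "[length \<alpha> = t] (mod length B)"
    by (meson cong_dvd_modulus_nat dvd_triv_left, meson cong_dvd_modulus_nat dvd_triv_right)
  moreover have "g \<le> length A" using assms(5) by (simp add: g_def dvd_imp_le)
  ultimately show "length \<alpha> mod length A = length \<alpha> mod gcd (length A) (length B)"
    using t(1) by (simp add: cong_def t_def g_def)
  assume "0 < length B"
  then have "g \<le> length B" by (simp add: g_def dvd_imp_le)
  then show "length \<alpha> mod length B = length \<alpha> mod gcd (length A) (length B)"
    using t(1) \<open>[length \<alpha> = t] (mod length B)\<close> by (simp add: cong_def t_def g_def)
qed

text \<open>
  For each \<open>a\<close> there is exactly one \<open>b\<close> between 1 and \<open>d\<close> with \<open>a + b\<close> congruent to \<open>h\<close>.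
\<close>

lemma sum_congruent_pairs:
  fixes f :: "nat \<Rightarrow> rat" and C :: "int \<Rightarrow> nat" and d h :: nat
  assumes "0 < d" and C: "\<And>i j. [i = j] (mod int d) \<Longrightarrow> C i = C j"
  shows "(\<Sum>(a, b) \<in> {(a, b). a \<in> {1..d} \<and> b \<in> {1..d} \<and> [a + b = h] (mod d)}. f a * rat_of_nat (C (int b)))
    = (\<Sum>a\<in>{1..d}. f a * rat_of_nat (C (int h - int a)))"
proof -
  have "{(a, b). a \<in> {1..d} \<and> b \<in> {1..d} \<and> [a + b = h] (mod d)}
     = (SIGMA a:{1..d}. {b\<in>{1..d}. [a + b = h] (mod d)})" by auto
  then have "(\<Sum>(a, b) \<in> {(a, b). a \<in> {1..d} \<and> b \<in> {1..d} \<and> [a + b = h] (mod d)}. f a * rat_of_nat (C (int b)))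
    = (\<Sum>a\<in>{1..d}. \<Sum>b\<in>{b\<in>{1..d}. [a + b = h] (mod d)}. f a * rat_of_nat (C (int b)))"
    by (simp add: sum.Sigma)
  also have "\<dots> = (\<Sum>a\<in>{1..d}. f a * rat_of_nat (C (int h - int a)))"
  proof (rule sum.cong[OF refl])
    fix a assume a: "a \<in> {1..d}"
    define m where "m = h + d - a"
    define k where "k = (if m mod d = 0 then d else m mod d)"
    have "[a + b = h] (mod d) \<longleftrightarrow> [m = b] (mod d)" for b
    proof -
      have "[a + b = h] (mod d) \<longleftrightarrow> [a + b = a + m] (mod d)" using a by (simp add: m_def cong_def)
      also have "\<dots> \<longleftrightarrow> [m = b] (mod d)" by (metis cong_add_lcancel_nat cong_sym_eq)
      finally show ?thesis .
    qed
    then have "[a + b = h] (mod d) \<longleftrightarrow> k = b" if "b \<in> {1..d}" for b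
      using residue_representative[OF assms(1) that, of m] unfolding k_def by simp
    then have "{b\<in>{1..d}. [a + b = h] (mod d)} = {b\<in>{1..d}. k = b}" by blast
    also have "\<dots> = {k}" using assms(1) by (auto simp: k_def less_imp_le)
    finally have "(\<Sum>b\<in>{b\<in>{1..d}. [a + b = h] (mod d)}. f a * rat_of_nat (C (int b))) = f a * rat_of_nat (C (int k))"
      by simp
    moreover have "[int k = int h - int a] (mod int d)"
    proof -
      have "[int k = int m] (mod int d)" unfolding cong_int_iff by (simp add: k_def cong_def)
      also have "[int m = int h - int a] (mod int d)" using a by (simp add: m_def of_nat_diff cong_iff_dvd_diff)
      finally show ?thesis .
    qed
    ultimately show "(\<Sum>b\<in>{b\<in>{1..d}. [a + b = h] (mod d)}. f a * rat_of_nat (C (int b)))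
      = f a * rat_of_nat (C (int h - int a))" using C by simp
  qed
  finally show ?thesis .
qed

lemma sum_congruent_pairs':
  fixes f :: "nat \<Rightarrow> rat" and C :: "int \<Rightarrow> nat" and d h :: nat
  assumes "0 < d" and C: "\<And>i j. [i = j] (mod int d) \<Longrightarrow> C i = C j"
  shows "(\<Sum>(a, b) \<in> {(a, b). a \<in> {1..d} \<and> b \<in> {1..d} \<and> [a + b = h] (mod d)}. rat_of_nat (C (int a)) * f b)
    = (\<Sum>b\<in>{1..d}. f b * rat_of_nat (C (int h - int b)))"
proof -
  have "(\<Sum>(a, b) \<in> {(a, b). a \<in> {1..d} \<and> b \<in> {1..d} \<and> [a + b = h] (mod d)}. rat_of_nat (C (int a)) * f b)
    = (\<Sum>(b, a) \<in> {(a, b). a \<in> {1..d} \<and> b \<in> {1..d} \<and> [a + b = h] (mod d)}. f b * rat_of_nat (C (int a)))"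
    by (rule sum.reindex_bij_witness[of _ prod.swap prod.swap]) (auto simp: add.commute)
  then show ?thesis using sum_congruent_pairs[OF assms] by simp
qed

lemma meteor3_digraphI:
  assumes "meteor3 G P Q R" "normal_form G P Q R"
  shows "meteor3_digraph G P Q R"
proof -
  have e: "essential G" "disjoint_cycles G" using assms(1) unfolding meteor3_def by auto
  then interpret fin_digraph G unfolding essential_def by auto
  show ?thesis
  proof unfold_locales
    show "disjoint_cycles G" by (rule e)
    show "\<exists>e\<in>arcs G. tail G e = v" if "v \<in> verts G" for v
      using e(1) that unfolding essential_def out_arcs_def by blast
    show "\<exists>e\<in>arcs G. head G e = v" if "v \<in> verts G" for v
      using e(1) that unfolding essential_def in_arcs_def by blast
    show "cycle C \<longleftrightarrow> same_cycle P C \<or> same_cycle Q C \<or> same_cycle R C" for C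
      using assms(1) unfolding meteor3_def by blast
    show "\<not> same_cycle P Q" "\<not> same_cycle Q R" "\<not> same_cycle P R"
      using assms(1) unfolding meteor3_def by blast+
    show "cycle_ge G P Q" "cycle_ge G Q R"
      using assms(1) unfolding meteor3_def cycle_gt_def by blast+
    show "normal_form G P Q R" by (rule assms(2))
  qed
qed

text \<open>
  The coefficient \<open>\<delta> / (y gcd x z)\<close> in the definition of \<open>E \<approx> F\<close> is \<open>hits_U / lcm x y\<close>, and also
  \<open>hits_V / lcm y z\<close>, because \<open>\<delta> = gcd y (gcd x z)\<close>.
\<close>

lemma (in three_cycles) hits_eq:
  "int (lcm x y) * int (gcd y (gcd x z)) = int hits_U * int (y * gcd x z)"
  "int (lcm y z) * int (gcd y (gcd x z)) = int hits_V * int (y * gcd x z)"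
proof -
  have p: "gcd y (gcd x z) * lcm y (gcd x z) = y * gcd x z" by (metis prod_gcd_lcm_nat)
  have "lcm y (gcd x z) dvd lcm x y" "lcm y (gcd x z) dvd lcm y z"
    by (meson dvd_lcm1 dvd_lcm2 dvd_trans gcd_dvd1 gcd_dvd2 lcm_least)+
  then have "hits_U * lcm y (gcd x z) = lcm x y" "hits_V * lcm y (gcd x z) = lcm y z"
    unfolding hits_U_def hits_V_def by simp_all
  then have "lcm x y * gcd y (gcd x z) = hits_U * (y * gcd x z)"
    "lcm y z * gcd y (gcd x z) = hits_V * (y * gcd x z)" by (metis p mult.assoc mult.commute)+
  then show "int (lcm x y) * int (gcd y (gcd x z)) = int hits_U * int (y * gcd x z)"
   "int (lcm y z) * int (gcd y (gcd x z)) = int hits_V * int (y * gcd x z)" by (metis of_nat_mult)+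
qed

theorem proposition4p13:
  fixes E :: "('a, 'b) pre_digraph" and F :: "('c, 'd) pre_digraph"
  assumes "meteor3 E PE QE RE" and "normal_form E PE QE RE"
    and "meteor3 F PF QF RF" and "normal_form F PF QF RF"
    and "meteor3_equiv E PE QE RE F PF QF RF"
    and "distinct vsE" and "set vsE = verts E"
    and "distinct vsF" and "set vsF = verts F"
  shows "strong_shift_equiv (adjacency_mat E vsE) (adjacency_mat F vsF)"
proof -
  interpret E: meteor3_digraph E PE QE RE by (rule meteor3_digraphI) fact+
  interpret F: meteor3_digraph F PF QF RF by (rule meteor3_digraphI) fact+
  define x y z where "x = length PE" and "y = length QE" and "z = length RE"
  note xyz = this
  have F_len: "length PF = x" "length QF = y" "length RF = z"
    using assms(5) unfolding meteor3_equiv_def xyz by simp_all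
  have pos: "0 < x" "0 < y" "0 < z" using E.length_pos unfolding xyz .
  interpret three_cycles x y z using pos by unfold_locales
  define g d where "g = gcd x z" and "d = gcd y g"
  have d_eq: "gcd (gcd x y) z = d" unfolding d_def g_def by (simp add: ac_simps)
  have gd: "0 < g" "0 < d" using pos by (simp_all add: g_def d_def)
  define U V WE WF where "U = forward_mset E PE QE" and "V = backward_mset E QE RE"
    and "WE = forward_mset E PE RE" and "WF = forward_mset F PF RF"
  note finE = E.finite_trails and finF = F.finite_trails

  have count_PQ: "trail_count E PE QE c = trail_count F PF QF c" if "c \<in> {1..gcd x y}" for c
    using assms(5) that unfolding meteor3_equiv_def Let_def xyz by blast
  have count_QR: "trail_count E QE RE c = trail_count F QF RF c" if "c \<in> {1..gcd y z}" for c
    using assms(5) that unfolding meteor3_equiv_def Let_def xyz by blast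
  have resPQ: "residue_mset E PE QE = residue_mset F PF QF"
    using finE(1) finF(1) F_len pos count_PQ by (intro residue_mset_eq) (simp_all add: xyz)
  have resQR: "residue_mset E QE RE = residue_mset F QF RF"
    using finE(2) finF(2) F_len pos count_QR by (intro residue_mset_eq) (simp_all add: xyz)

  have U_eq: "edge_count x y (forward_mset F PF QF) = edge_count x y U"
    unfolding U_def
    using edge_count_forward[OF finE(1) _ normal_form_length_mod(1)[OF assms(2) E.cycles(1,2) E.PQ], of y]
      edge_count_forward[OF finF(1) _ normal_form_length_mod(1)[OF assms(4) F.cycles(1,2) F.PQ], of y]
      pos F_len resPQ by (simp add: xyz)
  have V_eq: "edge_count y z (backward_mset F QF RF) = edge_count y z V"
    unfolding V_def
    using edge_count_backward[OF finE(2) _ normal_form_length_mod(2)[OF assms(2) E.cycles(2,3) E.QR], of y]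
      edge_count_backward[OF finF(2) _ normal_form_length_mod(2)[OF assms(4) F.cycles(2,3) F.QR], of y]
      pos F_len resQR by (simp add: xyz)

  have EM: "sse_on (verts E) (adj E) nodes (three_cycle_matrix U V WE)"
    using E.sse_on_three_cycles unfolding U_def V_def WE_def xyz .
  have "sse_on (verts F) (adj F) nodes (three_cycle_matrix (forward_mset F PF QF) (backward_mset F QF RF) WF)"
    using F.sse_on_three_cycles unfolding WF_def F_len .
  then have FM: "sse_on (verts F) (adj F) nodes (three_cycle_matrix U V WF)"
    using three_cycle_matrix_cong[OF U_eq V_eq refl] by simp

  obtain gg l :: "nat \<Rightarrow> int" where
      dv: "\<forall>a \<in> {1..d}. int (lcm x y) dvd l a \<and> int (lcm y z) dvd gg a"
    and l0: "\<forall>a \<in> {1..d}. trail_sum E d PE QE a = 0 \<longrightarrow> l a = 0"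
    and g0: "\<forall>b \<in> {1..d}. trail_sum E d QE RE b = 0 \<longrightarrow> gg b = 0"
    and diff: "\<forall>h \<in> {1..g}.
             rat_of_nat (trail_count F PF RF h) - rat_of_nat (trail_count E PE RE h) =
             rat_of_nat d / rat_of_nat (y * g) *
             ((\<Sum>(a, b) \<in> {(a, b). a \<in> {1..d} \<and> b \<in> {1..d} \<and> [a + b = h] (mod d)}.
                 rat_of_nat (trail_sum E d PE QE a) * rat_of_int (gg b)) +
              (\<Sum>(a, b) \<in> {(a, b). a \<in> {1..d} \<and> b \<in> {1..d} \<and> [a + b = h] (mod d)}.
                 rat_of_int (l a) * rat_of_nat (trail_sum E d QE RE b)))"
    using assms(5) unfolding meteor3_equiv_def Let_def xyz[symmetric] d_eq g_def[symmetric] by blast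

  have d_dvd: "d dvd x" "d dvd y" "d dvd z"
    unfolding d_def g_def by (meson dvd_trans gcd_dvd1 gcd_dvd2)+
  have SU: "trail_sum E d PE QE a = class_count d U (int a)" for a
  proof -
    have "d dvd gcd (length PE) (length QE)" using d_dvd by (simp add: xyz)
    then show ?thesis unfolding U_def using finE(1) E.length_pos
      by (simp add: trail_sum_eq class_count_forward)
  qed
  have SV: "trail_sum E d QE RE a = class_count d V (int a)" for a
  proof -
    have "d dvd gcd (length QE) (length RE)" "d dvd length RE"
      using d_dvd by (simp_all add: xyz)
    then show ?thesis unfolding V_def using finE(2) E.length_pos
      by (simp add: trail_sum_eq class_count_backward)
  qed
  have NE: "trail_count E PE RE h = class_count g WE (int h)" for h
    unfolding WE_def using finE(3) by (simp add: trail_count_eq class_count_forward g_def xyz)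
  have NF: "trail_count F PF RF h = class_count g WF (int h)" for h
    unfolding WF_def using finF(3) by (simp add: trail_count_eq class_count_forward g_def F_len)

  \<comment> \<open>The numbers of rounds to be made by edges of each class; negative ones refer to \<open>F\<close>.\<close>
  define l' where "l' a = l a div int (lcm x y)" for a
  define g' where "g' b = gg b div int (lcm y z)" for b
  have l': "l a = l' a * int (lcm x y)" and g': "gg a = g' a * int (lcm y z)" if "a \<in> {1..d}" for a
    using dv that by (auto simp: l'_def g'_def)

  have "tri_equiv U V WE U V WF"
  proof (rule tri_equiv_of_class_difference[where I = "{1..d}" and l = l' and m = g', folded g_def, folded d_def])
    show "l' a = 0" if "a \<in> {1..d}" "class_count d U (int a) = 0" for a
      using l0 that by (simp add: SU l'_def)
    show "g' a = 0" if "a \<in> {1..d}" "class_count d V (int a) = 0" for a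
      using g0 that by (simp add: SV g'_def)
    fix h assume h: "h \<in> {1..g}"
    define A where "A = (\<Sum>a\<in>{1..d}. l' a * int (class_count d V (int h - int a)))"
    define B where "B = (\<Sum>b\<in>{1..d}. g' b * int (class_count d U (int h - int b)))"
    have "(\<Sum>(a, b) \<in> {(a, b). a \<in> {1..d} \<and> b \<in> {1..d} \<and> [a + b = h] (mod d)}.
                 rat_of_int (l a) * rat_of_nat (trail_sum E d QE RE b))
        = (\<Sum>a\<in>{1..d}. rat_of_int (l a) * rat_of_nat (class_count d V (int h - int a)))"
      unfolding SV by (rule sum_congruent_pairs[OF gd(2) class_count_cong])
    also have "\<dots> = rat_of_int A * rat_of_nat (lcm x y)"
      unfolding A_def of_int_sum sum_distrib_right by (intro sum.cong) (auto simp: l')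
    finally have A: "(\<Sum>(a, b) \<in> {(a, b). a \<in> {1..d} \<and> b \<in> {1..d} \<and> [a + b = h] (mod d)}.
                 rat_of_int (l a) * rat_of_nat (trail_sum E d QE RE b)) = rat_of_int A * rat_of_nat (lcm x y)" .
    have "(\<Sum>(a, b) \<in> {(a, b). a \<in> {1..d} \<and> b \<in> {1..d} \<and> [a + b = h] (mod d)}.
                 rat_of_nat (trail_sum E d PE QE a) * rat_of_int (gg b))
        = (\<Sum>b\<in>{1..d}. rat_of_int (gg b) * rat_of_nat (class_count d U (int h - int b)))"
      unfolding SU by (rule sum_congruent_pairs'[OF gd(2) class_count_cong])
    also have "\<dots> = rat_of_int B * rat_of_nat (lcm y z)"
      unfolding B_def of_int_sum sum_distrib_right by (intro sum.cong) (auto simp: g')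
    finally have B: "(\<Sum>(a, b) \<in> {(a, b). a \<in> {1..d} \<and> b \<in> {1..d} \<and> [a + b = h] (mod d)}.
                 rat_of_nat (trail_sum E d PE QE a) * rat_of_int (gg b)) = rat_of_int B * rat_of_nat (lcm y z)" .
    have "rat_of_nat (y * g) \<noteq> 0" using pos gd by simp
    moreover have "rat_of_nat (lcm x y) * rat_of_nat d = rat_of_nat hits_U * rat_of_nat (y * g)"
      "rat_of_nat (lcm y z) * rat_of_nat d = rat_of_nat hits_V * rat_of_nat (y * g)"
      using hits_eq[folded g_def, folded d_def] by (metis of_int_mult of_int_of_nat_eq)+
    ultimately have k: "rat_of_nat d / rat_of_nat (y * g) * rat_of_nat (lcm x y) = rat_of_nat hits_U"
      "rat_of_nat d / rat_of_nat (y * g) * rat_of_nat (lcm y z) = rat_of_nat hits_V"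
      by (simp_all add: field_simps)
    have "rat_of_nat (class_count g WF (int h)) - rat_of_nat (class_count g WE (int h))
        = rat_of_nat d / rat_of_nat (y * g) * (rat_of_int B * rat_of_nat (lcm y z) + rat_of_int A * rat_of_nat (lcm x y))"
      using diff[rule_format, OF h] unfolding A B NE NF .
    also have "\<dots> = rat_of_nat hits_U * rat_of_int A + rat_of_nat hits_V * rat_of_int B"
      unfolding k[symmetric] by (simp only: distrib_left mult_ac add.commute)
    finally have "rat_of_int (int (class_count g WF (int h)) - int (class_count g WE (int h)))
        = rat_of_int (int hits_U * A + int hits_V * B)" by simp
    then show "int (class_count g WF (int h)) - int (class_count g WE (int h)) = int hits_U * A + int hits_V * B"
      unfolding of_int_eq_iff .
  qed
  then have "sse_on (verts E) (adj E) (verts F) (adj F)"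
    using sse_on_trans[OF EM] sse_on_trans sse_on_sym[OF FM] finite_nodes by blast
  then show ?thesis using assms(6-9) unfolding sse_on_def adjacency_mat_eq by blast
qed

end
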